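(* For all $\vec{x}=(a,b,c,d,e,f,g)^T\in V$ we have the relation $$\pi^3\sin\pi(e-a-b)\,\beta(\sigma\vec{x})K_{p_0}(\vec{x})+\gamma(\vec{x})K_{p_1}(\vec{x})-\pi^3\sin\pi(a-b)\,\beta(\vec{x})K_{n_4}(\vec{x})=0,$$ where $\sigma:V\to V$ is $$\sigma\vec{x}=(1+b-e,\;b,\;f-c,\;g-c,\;1+a+b-e,\;1+b-c,\;1+b+d-e)^T$$ (which satisfies $\sigma^3\vec{x}=\vec{x}$). This is a $224$ relation, i.e. the triple $(p_0,p_1,n_4)$ has Hamming type $224$.
   Context: Let $V=\{(a,b,c,d,e,f,g)^T\in\mathbb{C}^7 : e+f+g-a-b-c-d=1\}$. With $(u)_k=u(u+1)\cdots(u+k-1)$, $(u)_0=1$, and ${}_4F_3(a,b,c,d;e,f,g;1)=\sum_{k\ge0}\frac{(a)_k(b)_k(c)_k(d)_k}{k!\,(e)_k(f)_k(g)_k}$, define for $\vec{x}=(a,b,c,d,e,f,g)^T\in V$ $$K(\vec{x})=K(a;b,c,d;e,f,g)=\frac{{}_4F_3(a,b,c,d;e,f,g;1)}{\Gamma(e)\Gamma(f)\Gamma(g)\Gamma(1+a-e)\Gamma(1+a-f)\Gamma(1+a-g)}+\frac{{}_4F_3(a,1+a-e,1+a-f,1+a-g;1+a-b,1+a-c,1+a-d;1)}{\Gamma(1+a-b)\Gamma(1+a-c)\Gamma(1+a-d)\Gamma(b)\Gamma(c)\Gamma(d)},$$ where each ${}_4F_3(A,B,C,D;E,F,G;1)/(\Gamma(E)\Gamma(F)\Gamma(G))$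 is read as $\sum_{k\ge0}\frac{(A)_k(B)_k(C)_k(D)_k}{k!\,\Gamma(k+E)\Gamma(k+F)\Gamma(k+G)}$, so $K$ is entire on $V$. Put $$\beta(\vec{x})=\frac{1}{\Gamma(a)\Gamma(1+b-e)\Gamma(f-c)\Gamma(f-d)\Gamma(g-c)\Gamma(g-d)},$$ $$\gamma(\vec{x})=\frac{\sin\pi(e-b)}{\sin\pi(c-b)}\Bigl[\sin\pi(a-c)\sin\pi(e-a-b)\sin\pi(f-b)\sin\pi(g-b)-\sin\pi(a-b)\sin\pi(e-a-c)\sin\pi(f-c)\sin\pi(g-c)\Bigr],$$ with $\gamma$ extended by continuity across its removable singularities $c-b\in\mathbb{Z}$. For an element $\mu$ of the group $M_K$ below, $K_\mu(\vec{x})=K(\mu\vec{x})$. The elements $p_0,p_1,n_4\in M_K$ act on $V$ by $p_0\vec{x}=\vec{x}$, $p_1\vec{x}=(b,c,d,a,e,f,g)^T$, $n_4\vec{x}=(e-a,e-b,e-c,e-d,1+e-f,1+e-g,e)^T$. Hamming type. Let $S\in GL(7,\mathbb{R})$ be the matrix with rows $(1,0,0,0,0,0,0)$, $(0,0,1,1,0,0,0)$, $(0,1,0,1,0,0,0)$, $(0,1,1,0,0,0,0)$, $(0,1,1,1,1,0,0)$, $(0,1,1,1,0,1,0)$, $(0,1,1,1,0,0,1)$; $P_{1,6}$ the group of $7\times7$ permutation matrices fixing the first coordinate; $G_K=SP_{1,6}S^{-1}$ (under which $K$ is invariant); $M_K\subset GL(7,\mathbb{R})$ the subgroup generated by $G_K$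 and the permutation matrix $(12)$. For $1\le i<j\le6$, $\varepsilon=\pm1$, let $M_6^{\varepsilon}(i,j)$ be the $6\times6$ permutation matrix of the transposition $(i\,j)$ with its two off-diagonal $1$'s replaced by $\varepsilon$. There is a unique injective homomorphism $\theta:M_K\to GL(6,\mathbb{R})$ with $S(i,i+1)S^{-1}\mapsto M_6^{+}(i-1,i)$ for $2\le i\le6$ and $(12)\mapsto M_6^{-}(2,3)$. With $\omega_0=(1,1,1,1,1,1)^T$, the Hamming distance between $\mu,\nu\in M_K$ is the number of coordinates in which $\theta(\mu)^{-1}\omega_0$ and $\theta(\nu)^{-1}\omega_0$ differ (it depends only on the right cosets $G_K\mu,G_K\nu$). The Hamming type of a triple is the list of its three pairwise Hamming distances in nondecreasing order. *)

theory Defs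
  imports "HOL-Analysis.Analysis" "HOL-Algebra.Generated_Groups" "HOL-Combinatorics.Permutations"
begin

text \<open>
  A vector \<open>(a,b,c,d,e,f,g)\<close> is an element \<open>x\<close> of \<open>complex ^ 7\<close> with \<open>a = x $ 1\<close>, ..., \<open>g = x $ 7\<close>.
  The index types 6 and 7 are residue types, so that \<open>(6::6) = 0\<close> and \<open>(7::7) = 0\<close>; the coordinates
  are nevertheless written \<open>1, ..., n\<close> throughout, in agreement with \<open>vector\<close>, which puts the first
  list entry at index \<open>1\<close> and the last one at index \<open>n\<close>.
\<close>

section \<open>The functions\<close>

definition V :: "(complex ^ 7) set" where
  "V = {x. x$5 + x$6 + x$7 - x$1 - x$2 - x$3 - x$4 = 1}"

definition sin_pi :: "complex \<Rightarrow> complex" where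
  "sin_pi z = sin (of_real pi * z)"

text \<open>\<open>F43_reg A B C D E F G\<close> is the regularised series \<open>4F3(A,B,C,D;E,F,G;1) / (\<Gamma>(E) \<Gamma>(F) \<Gamma>(G))\<close>.
  The library function \<open>rGamma\<close> is the entire function \<open>1/\<Gamma>\<close>.\<close>

definition F43_reg ::
  "complex \<Rightarrow> complex \<Rightarrow> complex \<Rightarrow> complex \<Rightarrow> complex \<Rightarrow> complex \<Rightarrow> complex \<Rightarrow> complex" where
  "F43_reg A B C D E F G =
     (\<Sum>k. pochhammer A k * pochhammer B k * pochhammer C k * pochhammer D k / fact k
          * (rGamma (of_nat k + E) * rGamma (of_nat k + F) * rGamma (of_nat k + G)))"

definition K :: "complex ^ 7 \<Rightarrow> complex" where
  "K x = (let a = x$1; b = x$2; c = x$3; d = x$4; e = x$5; f = x$6; g = x$7 in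
     F43_reg a b c d e f g * (rGamma (1+a-e) * rGamma (1+a-f) * rGamma (1+a-g))
   + F43_reg a (1+a-e) (1+a-f) (1+a-g) (1+a-b) (1+a-c) (1+a-d)
       * (rGamma b * rGamma c * rGamma d))"

definition beta :: "complex ^ 7 \<Rightarrow> complex" where
  "beta x = (let a = x$1; b = x$2; c = x$3; d = x$4; e = x$5; f = x$6; g = x$7 in
     rGamma a * rGamma (1+b-e) * rGamma (f-c) * rGamma (f-d) * rGamma (g-c) * rGamma (g-d))"

definition gamma_generic :: "complex ^ 7 \<Rightarrow> complex" where
  "gamma_generic x = (let a = x$1; b = x$2; c = x$3; e = x$5; f = x$6; g = x$7 in
     sin_pi (e-b) / sin_pi (c-b) *
       (sin_pi (a-c) * sin_pi (e-a-b) * sin_pi (f-b) * sin_pi (g-b)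
      - sin_pi (a-b) * sin_pi (e-a-c) * sin_pi (f-c) * sin_pi (g-c)))"

text \<open>The extension by continuity: on the singular locus the value is the limit, within \<open>V\<close>, along
  the points where the defining formula makes sense.\<close>

definition gamma :: "complex ^ 7 \<Rightarrow> complex" where
  "gamma x =
     (if x$3 - x$2 \<in> \<int>
      then Lim (at x within {y \<in> V. y$3 - y$2 \<notin> \<int>}) gamma_generic
      else gamma_generic x)"

definition \<sigma> :: "complex ^ 7 \<Rightarrow> complex ^ 7" where
  "\<sigma> x = (let a = x$1; b = x$2; c = x$3; d = x$4; e = x$5; f = x$6; g = x$7 in
     vector [1+b-e, b, f-c, g-c, 1+a+b-e, 1+b-c, 1+b+d-e])"


section \<open>The groups\<close>

definition GL :: "(real ^ 'n ^ 'n) monoid" where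
  "GL = \<lparr>carrier = {A. invertible A}, mult = (**), one = mat 1\<rparr>"

definition perm_matrix :: "('n \<Rightarrow> 'n) \<Rightarrow> real ^ 'n ^ 'n" where
  "perm_matrix p = (\<chi> i j. if i = p j then 1 else 0)"

definition S :: "real ^ 7 ^ 7" where
  "S = vector
    [vector [1,0,0,0,0,0,0],
     vector [0,0,1,1,0,0,0],
     vector [0,1,0,1,0,0,0],
     vector [0,1,1,0,0,0,0],
     vector [0,1,1,1,1,0,0],
     vector [0,1,1,1,0,1,0],
     vector [0,1,1,1,0,0,1]]"

definition P16 :: "(real ^ 7 ^ 7) set" where
  "P16 = {perm_matrix p | p. p permutes UNIV \<and> p 1 = 1}"

definition G_K :: "(real ^ 7 ^ 7) set" where
  "G_K = {S ** P ** matrix_inv S | P. P \<in> P16}"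

definition M_K :: "(real ^ 7 ^ 7) set" where
  "M_K = generate GL (G_K \<union> {perm_matrix (Transposition.transpose 1 2)})"

text \<open>The action on \<open>complex ^ 7\<close> of a real matrix, and the function \<open>K_\<mu>\<close>.\<close>

definition act :: "real ^ 7 ^ 7 \<Rightarrow> complex ^ 7 \<Rightarrow> complex ^ 7" where
  "act \<mu> x = map_matrix complex_of_real \<mu> *v x"

definition K_at :: "real ^ 7 ^ 7 \<Rightarrow> complex ^ 7 \<Rightarrow> complex" where
  "K_at \<mu> x = K (act \<mu> x)"

definition p0 :: "real ^ 7 ^ 7" where
  "p0 = mat 1"

definition p1 :: "real ^ 7 ^ 7" where
  "p1 = vector
    [vector [0,1,0,0,0,0,0],
     vector [0,0,1,0,0,0,0],
     vector [0,0,0,1,0,0,0],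
     vector [1,0,0,0,0,0,0],
     vector [0,0,0,0,1,0,0],
     vector [0,0,0,0,0,1,0],
     vector [0,0,0,0,0,0,1]]"

text \<open>The constant in the entries \<open>1+e-f\<close> and \<open>1+e-g\<close> of \<open>n4 x\<close> is the linear form
  \<open>e+f+g-a-b-c-d\<close>, which equals 1 on \<open>V\<close>. Since \<open>V\<close> spans \<open>complex ^ 7\<close>, the matrix is determined
  by its action on \<open>V\<close>.\<close>

definition n4 :: "real ^ 7 ^ 7" where
  "n4 = vector
    [vector [-1,0,0,0,1,0,0],
     vector [0,-1,0,0,1,0,0],
     vector [0,0,-1,0,1,0,0],
     vector [0,0,0,-1,1,0,0],
     vector [-1,-1,-1,-1,2,0,1],
     vector [-1,-1,-1,-1,2,1,0],
     vector [0,0,0,0,1,0,0]]"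

lemma exhaust_7: "i = 1 \<or> i = 2 \<or> i = 3 \<or> i = 4 \<or> i = 5 \<or> i = 6 \<or> i = 7" for i :: 7
proof (induct i)
  case (of_int z)
  then have "z = 0 \<or> z = 1 \<or> z = 2 \<or> z = 3 \<or> z = 4 \<or> z = 5 \<or> z = 6"
    by fastforce
  then show ?case by auto
qed

lemma UNIV_7: "(UNIV :: 7 set) = {1, 2, 3, 4, 5, 6, 7}"
  using exhaust_7 by auto

lemma forall_7: "(\<forall>i::7. P i) \<longleftrightarrow> P 1 \<and> P 2 \<and> P 3 \<and> P 4 \<and> P 5 \<and> P 6 \<and> P 7"
  by (metis exhaust_7)

lemma sum_7: "sum f (UNIV :: 7 set) = f 1 + f 2 + f 3 + f 4 + f 5 + f 6 + f 7"
  unfolding UNIV_7 by (simp add: ac_simps)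

lemma vector_7 [simp]:
  "(vector [a,b,c,d,e,f,g] :: 'a::zero ^ 7) $ 1 = a"
  "(vector [a,b,c,d,e,f,g] :: 'a::zero ^ 7) $ 2 = b"
  "(vector [a,b,c,d,e,f,g] :: 'a::zero ^ 7) $ 3 = c"
  "(vector [a,b,c,d,e,f,g] :: 'a::zero ^ 7) $ 4 = d"
  "(vector [a,b,c,d,e,f,g] :: 'a::zero ^ 7) $ 5 = e"
  "(vector [a,b,c,d,e,f,g] :: 'a::zero ^ 7) $ 6 = f"
  "(vector [a,b,c,d,e,f,g] :: 'a::zero ^ 7) $ 7 = g"
  unfolding vector_def by simp_all

lemma act_p0: "act p0 x = x"
  by (simp add: act_def p0_def matrix_vector_mult_def mat_def vec_eq_iff forall_7 sum_7)

lemma act_p1: "act p1 x = vector [x$2, x$3, x$4, x$1, x$5, x$6, x$7]"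
  by (simp add: act_def p1_def matrix_vector_mult_def vec_eq_iff forall_7 sum_7)

lemma act_n4:
  assumes "x \<in> V"
  shows "act n4 x = vector [x$5 - x$1, x$5 - x$2, x$5 - x$3, x$5 - x$4,
                            1 + x$5 - x$6, 1 + x$5 - x$7, x$5]"
  using assms
  by (simp add: V_def act_def n4_def matrix_vector_mult_def vec_eq_iff forall_7 sum_7)
     (auto simp: algebra_simps)


section \<open>Hamming types\<close>

definition M6 :: "real \<Rightarrow> 6 \<Rightarrow> 6 \<Rightarrow> real ^ 6 ^ 6" where
  "M6 \<epsilon> i j = (\<chi> r s. if r = Transposition.transpose i j s then (if r = s then 1 else \<epsilon>) else 0)"

text \<open>The homomorphism \<open>\<theta>\<close> is only specified on \<open>M_K\<close>; membership in \<open>extensional M_K\<close> fixes the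
  irrelevant values elsewhere, so that the description is unique.\<close>

definition \<theta> :: "real ^ 7 ^ 7 \<Rightarrow> real ^ 6 ^ 6" where
  "\<theta> = (THE h. h \<in> hom (GL\<lparr>carrier := M_K\<rparr>) GL \<and> inj_on h M_K \<and> h \<in> extensional M_K
     \<and> (\<forall>i::nat. 2 \<le> i \<and> i \<le> 6 \<longrightarrow>
          h (S ** perm_matrix (Transposition.transpose (of_nat i) (of_nat (i + 1))) ** matrix_inv S)
            = M6 1 (of_nat (i - 1)) (of_nat i))
     \<and> h (perm_matrix (Transposition.transpose 1 2)) = M6 (-1) 2 3)"

definition \<omega>\<^sub>0 :: "real ^ 6" where
  "\<omega>\<^sub>0 = (\<chi> i. 1)"

definition hamming_distance :: "real ^ 7 ^ 7 \<Rightarrow> real ^ 7 ^ 7 \<Rightarrow> nat" where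
  "hamming_distance \<mu> \<nu> =
     card {i. (matrix_inv (\<theta> \<mu>) *v \<omega>\<^sub>0) $ i \<noteq> (matrix_inv (\<theta> \<nu>) *v \<omega>\<^sub>0) $ i}"

definition hamming_type :: "real ^ 7 ^ 7 \<Rightarrow> real ^ 7 ^ 7 \<Rightarrow> real ^ 7 ^ 7 \<Rightarrow> nat list" where
  "hamming_type \<mu> \<nu> \<rho> =
     sort [hamming_distance \<mu> \<nu>, hamming_distance \<mu> \<rho>, hamming_distance \<nu> \<rho>]"

end

(*
  Expanding a product of two Pochhammer quotients by the Pfaff-Saalschuetz sum turns each of the two series of K
  into a double series. Two applications of the nonterminating Saalschuetz theorem, with an interchange of
  summation between them, show that K(a;b,c,d;e,f,g) = K(a;e-b,e-c,d;e,f-u,g-u) with u = b+c-e. The sum of all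
  residues of a Barnes integrand
    Gamma(a1+t) Gamma(a2+t) Gamma(b1-t) Gamma(b2-t) / (Gamma(c1+t) Gamma(c2+t) Gamma(d1-t) Gamma(d2-t))
  vanishes, which links four 4F3 series. One choice of parameters gives, after Thomae's transformation,
  the nonterminating Saalschuetz theorem; in another the four series are exactly those
  occurring in three values of K, and the resulting three-term relation is brought into the
  required form by the symmetry of K. Everything is entire in the parameters, so generic parameters suffice.
  For the Hamming type, M_K acts by signed permutations in a suitable basis of the kernel of the linear form
  e+f+g-a-b-c-d, which gives theta explicitly.
*)
theory Submission
  imports Defs "HOL-Complex_Analysis.Complex_Analysis" "HOL-Real_Asymp.Real_Asymp"
begin

section \<open>Growth of quotients of Gamma functions\<close>

text \<open>Three values of \<open>K\<close> involve six series. With the Barnes parameters a, b; 0,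
  1 - e; f, g; 1 - c, 1 - d only four different ones remain: two occur in one outer value each, and
  the other two are shared by the middle value with one outer value each. The residue relation
  therefore fixes the outer coefficients and overdetermines the middle one; its two determinations
  agree by a sine identity that rests on the balance e + f + g = 1 + a + b + c + d. Genericity
  serves three purposes: simple poles, finite Gamma values, and real parts large enough for the
  interchanges of summation. It is removed along complex lines inside the balanced hyperplane. There
  consecutive terms of each 4F3 have ratio 1 - 2/k + O(1/k^2), so convergence is locally uniform,
  and identities written with 1/Gamma have entire sides. A single growth estimate, Gamma(a +
  t)/Gamma(c + t) = O(|t|^Re(a - c)) in the right half-plane, controls both the series and the
  Barnes integrand.\<close>

lemma not_nonpos_Ints_norm_Re:
  assumes "norm (t::complex) > 2 * norm a" "Re t \<ge> 0"
  shows "a + t \<notin> \<int>\<^sub>\<le>\<^sub>0"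
proof
  assume "a + t \<in> \<int>\<^sub>\<le>\<^sub>0"
  then obtain n where n: "a + t = - of_nat n" by (elim nonpos_Ints_cases')
  have "Re t = - Re a - real n" using arg_cong[OF n, of Re] by simp
  hence "real n \<le> norm a" using assms(2) abs_Re_le_cmod[of a] by linarith
  moreover have "norm t \<le> real n + norm a"
  proof -
    have "t = - of_nat n - a" using n by (simp add: algebra_simps add_eq_0_iff)
    hence "norm t \<le> norm (- of_nat n :: complex) + norm a" using norm_triangle_ineq4 by metis
    thus ?thesis by simp
  qed
  ultimately show False using assms(1) by simp
qed

text \<open>Euler's limit for 1/Gamma, multiplied by Gamma(z). The Pochhammer symbol in
  \<open>rGamma_series z n\<close> has n + 1 factors, hence \<open>Suc n\<close>.\<close>

lemma Gamma_shift_tendsto: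
  assumes "z \<notin> \<int>\<^sub>\<le>\<^sub>0"
  shows "(\<lambda>n. Gamma (z + of_nat (Suc n)) / (fact n * exp (z * of_real (ln (of_nat n))))) \<longlonglongrightarrow> (1::complex)"
proof -
  have "(\<lambda>n. Gamma z * rGamma_series z n) \<longlonglongrightarrow> Gamma z * rGamma z"
    by (intro tendsto_intros)
  moreover have "Gamma z * rGamma z = 1" using assms by (simp add: rGamma_inverse_Gamma Gamma_eq_zero_iff)
  moreover have "Gamma z * rGamma_series z n = Gamma (z + of_nat (Suc n)) / (fact n * exp (z * of_real (ln (of_nat n))))" for n
    using assms by (simp add: rGamma_series_def pochhammer_Gamma Gamma_eq_zero_iff del: of_nat_Suc)
  ultimately show ?thesis by simp
qed

lemma Ln_shift_tendsto: "(\<lambda>n. Ln (t + of_nat (Suc n)) - of_real (ln (of_nat n))) \<longlonglongrightarrow> 0"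
proof -
  have "(\<lambda>n. Ln (1 + (t + 1) * inverse (of_nat n))) \<longlonglongrightarrow> Ln (1 + (t+1) * 0)"
    by (intro tendsto_intros lim_inverse_n) auto
  hence "(\<lambda>n. Ln (1 + (t + 1) * inverse (of_nat n))) \<longlonglongrightarrow> 0" by simp
  moreover have "eventually (\<lambda>n. Ln (1 + (t + 1) * inverse (of_nat n)) = Ln (t + of_nat (Suc n)) - of_real (ln (of_nat n))) sequentially"
    using eventually_gt_at_top[of "nat \<lceil>norm t\<rceil>"]
  proof eventually_elim
    case (elim n)
    have n: "real n > 0" "real n > norm t" using elim by linarith+
    have nz: "t + of_nat (Suc n) \<noteq> 0"
    proof
      assume "t + of_nat (Suc n) = 0"
      hence "t = - of_nat (Suc n)" by (simp add: add_eq_0_iff2)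
      hence "norm t = real (Suc n)" by (metis norm_minus_cancel norm_of_nat)
      thus False using n by simp
    qed
    define w where "w = 1 + (t + 1) * inverse (of_nat n)"
    have w: "t + of_nat (Suc n) = of_nat n * w"
      using n by (simp add: w_def field_simps)
    hence "w \<noteq> 0" using nz by auto
    hence "Ln (of_nat n * w) = ln (of_nat n) + Ln w" using n by (intro Ln_times_of_nat) auto
    moreover have "n > 0" using n by simp
    ultimately show ?case unfolding w w_def[symmetric] by simp
  qed
  ultimately show ?thesis by (rule Lim_transform_eventually)
qed

text \<open>The ratio of consecutive values of \<open>\<Gamma>(a + t) / \<Gamma>(c + t) * t powr (c - a)\<close> along \<open>t, t + 1, \<dots>\<close> is
  \<open>1 + O(1 / t\<^sup>2)\<close>, and the values tend to 1; this replaces Stirling's formula.\<close>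

lemma Gamma_ratio_step:
  fixes a c t :: complex
  defines "h \<equiv> (\<lambda>t. Gamma (a + t) * rGamma (c + t) * exp ((c - a) * Ln t))"
  assumes t: "Re t \<ge> 0" "norm t \<ge> 2 * (norm a + norm c + 1)"
  shows "norm (h t) \<le> exp (2 * ((norm a)\<^sup>2 + (norm c)\<^sup>2 + norm (c - a)) / (norm t)\<^sup>2) * norm (h (t + 1))"
proof -
  \<comment> \<open>exp L is the quotient h(t) / h(t + 1): the first two logarithms come from the
    factors c + t and a + t of the Gamma recurrences, the last one from the power of t.\<close>
  define L where "L = Ln (1 + c / t) - Ln (1 + a / t) - (c - a) * Ln (1 + 1 / t)"
  have "norm t \<ge> 2" using t(2) norm_ge_zero[of a] norm_ge_zero[of c] by argo
  hence t0: "t \<noteq> 0" "norm t > 0" by auto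
  have na: "norm (a / t) \<le> 1/2" "norm (c / t) \<le> 1/2" "norm (1 / t) \<le> 1/2"
  proof -
    have "norm a * 2 \<le> norm t" "norm c * 2 \<le> norm t" "1 * 2 \<le> norm t"
      using t(2) norm_ge_zero[of a] norm_ge_zero[of c] by argo+
    thus "norm (a / t) \<le> 1/2" "norm (c / t) \<le> 1/2" "norm (1 / t) \<le> 1/2"
      using t0 by (simp_all add: norm_divide divide_le_eq)
  qed
  have app: "norm (Ln (1 + z) - z) \<le> 2 * (norm z)\<^sup>2" if "norm z \<le> 1/2" for z :: complex
  proof -
    have "norm (Ln (1 + z) - z) \<le> (norm z)\<^sup>2 / (1 - norm z)" using that by (intro Ln_approx_linear) auto
    also have "\<dots> \<le> (norm z)\<^sup>2 / (1/2)" using that by (intro divide_left_mono) auto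
    finally show ?thesis by simp
  qed
  have nz: "1 + a / t \<noteq> 0" "1 + c / t \<noteq> 0" "1 + 1 / t \<noteq> 0"
    using na by (auto simp: add_eq_0_iff simp del: norm_divide dest!: arg_cong[of _ "- 1" norm])
  \<comment> \<open>The linear terms c/t - a/t - (c - a)/t add up to 0, so only the quadratic errors
    of Ln remain.\<close>
  have "L = (Ln (1 + c / t) - c / t) - (Ln (1 + a / t) - a / t) - (c - a) * (Ln (1 + 1 / t) - 1 / t)"
    using t0 by (simp add: L_def field_simps)
  also have "norm \<dots> \<le> norm (Ln (1 + c / t) - c / t) + norm (Ln (1 + a / t) - a / t) + norm ((c - a) * (Ln (1 + 1 / t) - 1 / t))"
    by (intro order.trans[OF norm_triangle_ineq4] add_mono norm_triangle_ineq4 order.refl)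
  also have "\<dots> \<le> 2 * (norm (c/t))\<^sup>2 + 2 * (norm (a/t))\<^sup>2 + norm (c - a) * (2 * (norm (1 / t))\<^sup>2)"
    unfolding norm_mult by (intro add_mono mult_left_mono app na) auto
  also have "\<dots> = 2 * ((norm a)\<^sup>2 + (norm c)\<^sup>2 + norm (c - a)) / (norm t)\<^sup>2"
    using t0 by (simp add: norm_divide power_divide field_simps)
  finally have nL: "norm L \<le> 2 * ((norm a)\<^sup>2 + (norm c)\<^sup>2 + norm (c - a)) / (norm t)\<^sup>2" .
  have at: "a + t \<noteq> 0" "c + t \<noteq> 0" "t + 1 \<noteq> 0"
    using nz t0 by (simp_all add: field_simps)
  have Ln1: "Ln (t + 1) = Ln t + Ln (1 + 1 / t)"
  proof -
    have "1 + 1 / t = (t + 1) / t" using t0 by (simp add: field_simps)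
    moreover have "Re t > 0 \<or> (Re t = 0 \<and> Im t \<noteq> 0)" using t t0 by (auto simp: complex_eq_iff)
    moreover have "Ln ((t + 1) / t) = Ln (t + 1) - Ln t"
    \<comment> \<open>In the closed right half-plane the imaginary parts of both logarithms are at
      most pi/2 in absolute value, so their difference stays on the principal branch; strictness for
      t + 1 excludes the value -pi.\<close>
    proof (rule Ln_unique)
      show "exp (Ln (t + 1) - Ln t) = (t + 1) / t" using t0 at by (simp add: exp_diff)
      have "\<bar>Im (Ln (t + 1))\<bar> < pi / 2" using t at by (subst Re_Ln_pos_lt) auto
      moreover have "\<bar>Im (Ln t)\<bar> \<le> pi / 2" using t t0 by (subst Re_Ln_pos_le) auto
      ultimately show "- pi < Im (Ln (t + 1) - Ln t)" "Im (Ln (t + 1) - Ln t) \<le> pi" by auto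
    qed
    ultimately show ?thesis by simp
  qed
  have g1: "Gamma (a + (t + 1)) = (a + t) * Gamma (a + t)"
  proof -
    have "norm t > 2 * norm a" using t norm_ge_zero[of c] by argo
    hence "a + t \<notin> \<int>\<^sub>\<le>\<^sub>0" using t by (intro not_nonpos_Ints_norm_Re)
    from Gamma_plus1[OF this] show ?thesis by (simp add: add.assoc)
  qed
  have g2: "rGamma (c + t) = (c + t) * rGamma (c + (t + 1))"
    using rGamma_plus1[of "c + t"] by (simp add: add.assoc)
  have g3: "exp L * ((a + t) * (exp ((c - a) * Ln (t + 1)))) = (c + t) * exp ((c - a) * Ln t)"
  proof -
    have eL: "exp L = (1 + c/t) / (1 + a/t) * exp ((c - a) * Ln t) / exp ((c - a) * Ln (t + 1))"
    proof -
      have "(c - a) * Ln (t + 1) = (c - a) * Ln t + (c - a) * Ln (1 + 1 / t)" unfolding Ln1 by (rule distrib_left)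
      thus ?thesis using nz unfolding L_def exp_diff by (simp add: exp_add)
    qed
    have eq: "(1 + c/t) / (1 + a/t) * (a + t) = c + t"
    proof -
      have "1 + c/t = (c + t) / t" "1 + a / t = (a + t) / t" using t0 by (auto simp: field_simps)
      thus ?thesis using at t0 by simp
    qed
    have "x * (y * e1) = z * e0" if "x = p / q * e0 / e1" "p / q * y = z" "e1 \<noteq> 0"
      for x y z p q e0 e1 :: complex using that by auto
    from this[OF eL eq exp_not_eq_zero] show ?thesis .
  qed
  have "exp L * h (t + 1) = Gamma (a + t) * rGamma (c + (t + 1)) * (exp L * ((a + t) * exp ((c - a) * Ln (t + 1))))"
    by (simp add: h_def g1)
  also have "\<dots> = h t" unfolding g3 by (simp add: h_def g2)
  finally have "h t = exp L * h (t + 1)" ..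
  hence "norm (h t) = exp (Re L) * norm (h (t + 1))" by (simp add: norm_mult norm_exp_eq_Re)
  also have "exp (Re L) \<le> exp (2 * ((norm a)\<^sup>2 + (norm c)\<^sup>2 + norm (c - a)) / (norm t)\<^sup>2)"
    using nL complex_Re_le_cmod[of L] by simp
  finally show ?thesis by (simp add: mult_right_mono)
qed

text \<open>Iterating \<open>Gamma_ratio_step\<close> along t, t + 1, ... costs at most the factor
  exp(D * suminf s), uniformly in t, because |t + n|^2 >= (n + 1)^2 / 2 as soon as |t| >= 2. Since
  h(t + n) tends to 1, that factor bounds h itself. Replacing the complex power of t by a power of
  |t| costs exp(pi |Im(c - a)|).\<close>

lemma Gamma_ratio_bound:
  fixes a c :: complex
  obtains C R where "C > 0" "R > 0"
    "\<And>t. Re t \<ge> 0 \<Longrightarrow> norm t \<ge> R \<Longrightarrow> norm (Gamma (a + t) * rGamma (c + t)) \<le> C * norm t powr Re (a - c)"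
proof -
  define h where "h = (\<lambda>t. Gamma (a + t) * rGamma (c + t) * exp ((c - a) * Ln t))"
  define R where "R = 2 * (norm a + norm c + 1)"
  define D where "D = 2 * ((norm a)\<^sup>2 + (norm c)\<^sup>2 + norm (c - a))"
  define s where "s = (\<lambda>n. 2 / (real n + 1)\<^sup>2)"
  have D0: "D \<ge> 0" by (simp add: D_def)
  have R: "R \<ge> 2" unfolding R_def by simp
  have sums: "summable s" using inverse_squares_sums summable_mult[of "\<lambda>n. 1 / (real n + 1)\<^sup>2" 2] unfolding s_def by (auto simp: sums_iff add.commute)
  have bnd: "norm (h t) \<le> exp (D * suminf s)" if t: "Re t \<ge> 0" "norm t \<ge> R" for t
  proof -
    have mono: "norm (t + of_nat n) \<ge> norm t" and sq: "(norm (t + of_nat n))\<^sup>2 \<ge> (real n + 1)\<^sup>2 / 2" for n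
    proof -
      have *: "(norm (t + of_nat n))\<^sup>2 = (norm t)\<^sup>2 + 2 * Re t * real n + (real n)\<^sup>2"
        unfolding cmod_power2 by (simp add: power2_eq_square algebra_simps)
      have "(norm t)\<^sup>2 \<le> (norm (t + of_nat n))\<^sup>2" using t unfolding * by simp
      thus "norm (t + of_nat n) \<ge> norm t" by (simp add: power2_le_iff_abs_le)
      have "(norm t)\<^sup>2 \<ge> 2\<^sup>2" using t R by (intro power_mono) auto
      moreover have "Re t * real n \<ge> 0" using t by simp
      moreover have "(real n - 1)\<^sup>2 \<ge> 0" by simp
      ultimately show "(norm (t + of_nat n))\<^sup>2 \<ge> (real n + 1)\<^sup>2 / 2"
        unfolding * by (simp add: power2_eq_square algebra_simps)
    qed
    have ind: "norm (h t) \<le> exp (D * (\<Sum>i<n. s i)) * norm (h (t + of_nat n))" for n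
    proof (induction n)
      case (Suc n)
      have "norm (h (t + of_nat n)) \<le> exp (D / (norm (t + of_nat n))\<^sup>2) * norm (h (t + of_nat n + 1))"
        unfolding h_def D_def by (rule Gamma_ratio_step) (use t mono[of n] in \<open>auto simp: R_def\<close>)
      also have "D / (norm (t + of_nat n))\<^sup>2 \<le> D / ((real n + 1)\<^sup>2 / 2)"
        using mono[of n] t R by (intro divide_left_mono sq D0 mult_pos_pos) auto
      hence "exp (D / (norm (t + of_nat n))\<^sup>2) * norm (h (t + of_nat n + 1)) \<le> exp (D * s n) * norm (h (t + of_nat n + 1))"
        unfolding s_def by (intro mult_right_mono) (auto simp: field_simps)
      finally have "exp (D * (\<Sum>i<n. s i)) * norm (h (t + of_nat n)) \<le> exp (D * (\<Sum>i<n. s i)) * (exp (D * s n) * norm (h (t + of_nat n + 1)))"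
        by (intro mult_left_mono) auto
      also have "\<dots> = exp (D * (\<Sum>i<Suc n. s i)) * norm (h (t + of_nat (Suc n)))"
        by (simp add: exp_add ring_distribs add_ac)
      finally show ?case using Suc by linarith
    qed simp
    have "norm t > 2 * norm a" "norm t > 2 * norm c"
      using t(2) norm_ge_zero[of a] norm_ge_zero[of c] unfolding R_def by argo+
    hence nn: "a + t \<notin> \<int>\<^sub>\<le>\<^sub>0" "c + t \<notin> \<int>\<^sub>\<le>\<^sub>0"
      using t(1) by (intro not_nonpos_Ints_norm_Re; simp)+
    \<comment> \<open>A quotient of two Euler limits: the factorials cancel, and the powers of n
      combine with the last factor to the power with exponent c - a of t + n + 1.\<close>
    have "(\<lambda>n. Gamma (a + t + of_nat (Suc n)) / (fact n * exp ((a + t) * of_real (ln (of_nat n)))) /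
             (Gamma (c + t + of_nat (Suc n)) / (fact n * exp ((c + t) * of_real (ln (of_nat n))))) *
             exp ((c - a) * (Ln (t + of_nat (Suc n)) - of_real (ln (of_nat n))))) \<longlonglongrightarrow> 1 / 1 * exp ((c - a) * 0)"
      by (intro tendsto_intros Gamma_shift_tendsto Ln_shift_tendsto nn) auto
    also have "(\<lambda>n. Gamma (a + t + of_nat (Suc n)) / (fact n * exp ((a + t) * of_real (ln (of_nat n)))) /
             (Gamma (c + t + of_nat (Suc n)) / (fact n * exp ((c + t) * of_real (ln (of_nat n))))) *
             exp ((c - a) * (Ln (t + of_nat (Suc n)) - of_real (ln (of_nat n))))) = (\<lambda>n. h (t + of_nat (Suc n)))"
    proof
      fix n
      have *: "exp ((c - a) * (Ln (t + of_nat (Suc n)) - of_real (ln (of_nat n)))) =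
             exp ((c - a) * Ln (t + of_nat (Suc n))) * exp ((a + t) * of_real (ln (of_nat n))) / exp ((c + t) * of_real (ln (of_nat n)))"
        unfolding exp_diff[symmetric] exp_add[symmetric] by (simp add: algebra_simps)
      show "Gamma (a + t + of_nat (Suc n)) / (fact n * exp ((a + t) * of_real (ln (of_nat n)))) /
             (Gamma (c + t + of_nat (Suc n)) / (fact n * exp ((c + t) * of_real (ln (of_nat n))))) *
             exp ((c - a) * (Ln (t + of_nat (Suc n)) - of_real (ln (of_nat n)))) = h (t + of_nat (Suc n))"
        unfolding * h_def by (simp add: rGamma_inverse_Gamma field_simps add_ac del: of_nat_Suc)
    qed
    finally have lim: "(\<lambda>n. norm (h (t + of_nat (Suc n)))) \<longlonglongrightarrow> 1" using tendsto_norm by fastforce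
    have "(\<lambda>n. exp (D * suminf s) * norm (h (t + of_nat (Suc n)))) \<longlonglongrightarrow> exp (D * suminf s) * 1"
      by (intro tendsto_intros lim)
    moreover have "norm (h t) \<le> exp (D * suminf s) * norm (h (t + of_nat (Suc n)))" for n
    proof -
      have "(\<Sum>i<Suc n. s i) \<le> suminf s" by (intro sum_le_suminf sums) (auto simp: s_def)
      hence "exp (D * (\<Sum>i<Suc n. s i)) \<le> exp (D * suminf s)" using D0 by (simp add: mult_left_mono)
      thus ?thesis using ind[of "Suc n"] by (meson mult_right_mono norm_ge_zero order.trans)
    qed
    ultimately show ?thesis by (intro LIMSEQ_le_const[where X = "\<lambda>n. exp (D * suminf s) * norm (h (t + of_nat (Suc n)))"]) auto
  qed
  show ?thesis
  proof (rule that)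
    show "exp (D * suminf s) * exp (\<bar>Im (c - a)\<bar> * pi) > 0" by simp
    show "R > 0" using R by simp
    fix t :: complex assume t: "Re t \<ge> 0" "norm t \<ge> R"
    have t0: "t \<noteq> 0" using t R by auto
    have "Gamma (a + t) * rGamma (c + t) = h t * exp ((a - c) * Ln t)"
      by (simp add: h_def exp_add[symmetric] ring_distribs[symmetric] mult.assoc)
    hence "norm (Gamma (a + t) * rGamma (c + t)) = norm (h t) * exp (Re ((a - c) * Ln t))"
      by (simp add: norm_mult)
    also have "\<dots> \<le> exp (D * suminf s) * (exp (\<bar>Im (c - a)\<bar> * pi) * norm t powr Re (a - c))"
    proof (intro mult_mono bnd t)
      have "\<bar>Im (Ln t)\<bar> \<le> pi" using mpi_less_Im_Ln[OF t0] Im_Ln_le_pi[OF t0] by simp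
      hence "\<bar>Im (c - a)\<bar> * \<bar>Im (Ln t)\<bar> \<le> \<bar>Im (c - a)\<bar> * pi" by (rule mult_left_mono) simp
      hence "Im (c - a) * Im (Ln t) \<le> \<bar>Im (c - a)\<bar> * pi" unfolding abs_mult[symmetric] by (rule order.trans[OF abs_ge_self])
      moreover have "Re ((a - c) * Ln t) = Re (a - c) * ln (norm t) + Im (c - a) * Im (Ln t)"
        using t0 by (simp add: algebra_simps)
      ultimately have "exp (Re ((a - c) * Ln t)) \<le> exp (Re (a - c) * ln (norm t) + \<bar>Im (c - a)\<bar> * pi)" by simp
      thus "exp (Re ((a - c) * Ln t)) \<le> exp (\<bar>Im (c - a)\<bar> * pi) * norm t powr Re (a - c)"
        using t0 by (simp add: powr_def exp_add mult.commute)
    qed auto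
    finally show "norm (Gamma (a + t) * rGamma (c + t)) \<le> exp (D * suminf s) * exp (\<bar>Im (c - a)\<bar> * pi) * norm t powr Re (a - c)"
      by (simp add: mult_ac)
  qed
qed

section \<open>The summation theorems of Gauss and Saalschuetz\<close>

lemma powr_le_powr_Suc:
  assumes "k > 0"
  shows "real k powr p \<le> 2 powr \<bar>p\<bar> * (real k + 1) powr p"
proof (cases "p \<ge> 0")
  case True
  have "real k powr p \<le> 1 * (real k + 1) powr p" using True by (auto intro: powr_mono2)
  also have "\<dots> \<le> 2 powr \<bar>p\<bar> * (real k + 1) powr p"
    by (intro mult_right_mono) (auto intro: ge_one_powr_ge_zero)
  finally show ?thesis .
next
  case False
  have "real k powr p \<le> ((real k + 1) / 2) powr p"
    using False assms by (intro powr_mono2') auto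
  also have "\<dots> = 2 powr \<bar>p\<bar> * (real k + 1) powr p"
    using False by (simp add: powr_divide powr_minus divide_simps)
  finally show ?thesis .
qed

text \<open>Apart from the constant 1/Gamma(a) this is \<open>Gamma_ratio_bound\<close> at t = k. If
  a is a nonpositive integer, the terms vanish eventually instead. The finitely many initial terms
  are absorbed into the constant, and k + 1 in place of k makes the bound meaningful at k =
  0.\<close>

lemma pochhammer_rGamma_bound:
  fixes a c :: complex
  obtains C where "C > 0"
    "\<And>k. norm (pochhammer a k * rGamma (of_nat k + c)) \<le> C * (real k + 1) powr Re (a - c)"
proof -
  define f where "f = (\<lambda>k. norm (pochhammer a k * rGamma (of_nat k + c)))"
  define p where "p = Re (a - c)"
  have "\<exists>C>0. eventually (\<lambda>k. f k \<le> C * (real k + 1) powr p) sequentially"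
  proof (cases "a \<in> \<int>\<^sub>\<le>\<^sub>0")
    case True
    then obtain n where n: "a = - of_nat n" by (elim nonpos_Ints_cases')
    have "eventually (\<lambda>k. f k \<le> 1 * (real k + 1) powr p) sequentially"
      using eventually_gt_at_top[of n] by eventually_elim (auto simp: f_def n pochhammer_of_nat_eq_0_lemma)
    thus ?thesis by (intro exI[of _ 1]) auto
  next
    case False
    obtain C R where CR: "C > 0" "R > 0"
      "\<And>t. Re t \<ge> 0 \<Longrightarrow> norm t \<ge> R \<Longrightarrow> norm (Gamma (a + t) * rGamma (c + t)) \<le> C * norm t powr Re (a - c)"
      using Gamma_ratio_bound[of a c] by metis
    have ev: "eventually (\<lambda>k. real k \<ge> R) sequentially"
      using eventually_ge_at_top[of "nat \<lceil>R\<rceil>"] by eventually_elim linarith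
    have "eventually (\<lambda>k. f k \<le> (norm (rGamma a) * C * 2 powr \<bar>p\<bar> + 1) * (real k + 1) powr p) sequentially"
      using ev eventually_gt_at_top[of 0]
    proof eventually_elim
      case (elim k)
      have "f k = norm (rGamma a) * norm (Gamma (a + of_nat k) * rGamma (c + of_nat k))"
        using False by (simp add: f_def pochhammer_Gamma norm_mult rGamma_inverse_Gamma norm_divide norm_inverse divide_inverse add_ac mult_ac)
      also have "\<dots> \<le> norm (rGamma a) * (C * real k powr p)"
        using CR(3)[of "of_nat k"] elim by (intro mult_left_mono) (auto simp: p_def)
      also have "\<dots> \<le> norm (rGamma a) * (C * (2 powr \<bar>p\<bar> * (real k + 1) powr p))"
        using elim CR by (intro mult_left_mono powr_le_powr_Suc) auto
      also have "\<dots> \<le> (norm (rGamma a) * C * 2 powr \<bar>p\<bar> + 1) * (real k + 1) powr p" by (simp add: algebra_simps)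
      finally show ?case .
    qed
    moreover have "norm (rGamma a) * C * 2 powr \<bar>p\<bar> + 1 > 0" using CR by (simp add: add_nonneg_pos)
    ultimately show ?thesis by blast
  qed
  then obtain C K where C: "C > 0" "\<And>k. k \<ge> K \<Longrightarrow> f k \<le> C * (real k + 1) powr p"
    by (auto simp: eventually_sequentially)
  define C' where "C' = C + (\<Sum>k<K. f k / (real k + 1) powr p)"
  have f0: "f k / (real k + 1) powr p \<ge> 0" for k by (simp add: f_def)
  have C': "C' \<ge> C" unfolding C'_def using f0 by (simp add: sum_nonneg)
  have "f k \<le> C' * (real k + 1) powr p" for k
  proof (cases "k \<ge> K")
    case True
    thus ?thesis using C(2)[of k] C' by (meson mult_right_mono order.trans powr_ge_zero)
  next
    case False
    have "f k / (real k + 1) powr p \<le> (\<Sum>k<K. f k / (real k + 1) powr p)"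
      using False f0 by (intro member_le_sum) auto
    hence "f k / (real k + 1) powr p \<le> C'" using C by (simp add: C'_def)
    thus ?thesis by (simp add: divide_le_eq add_nonneg_pos)
  qed
  thus ?thesis using that[of C'] C C' unfolding f_def p_def by auto
qed

lemma summable_Suc_powr: "s < -1 \<Longrightarrow> summable (\<lambda>k. (real k + 1) powr s)"
  using summable_Suc_iff[of "\<lambda>k. real k powr s"] by (simp add: summable_real_powr_iff add.commute)

lemma pochhammer_fact_bound:
  fixes b :: complex
  obtains C where "C > 0" "\<And>k. norm (pochhammer b k / fact k) \<le> C * (real k + 1) powr (Re b - 1)"
proof -
  obtain C where "C > 0" "\<And>k. norm (pochhammer b k * rGamma (of_nat k + 1)) \<le> C * (real k + 1) powr Re (b - 1)"
    using pochhammer_rGamma_bound[of b 1] by metis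
  moreover have "rGamma (of_nat k + 1 :: complex) = 1 / fact k" for k
    using Gamma_fact[of k] by (simp add: rGamma_inverse_Gamma add.commute field_simps)
  ultimately show ?thesis using that by auto
qed

lemma Gauss_term_bound:
  fixes A B C :: complex
  obtains M where "M > 0"
    "\<And>k. norm (pochhammer A k * pochhammer B k / fact k * rGamma (of_nat k + C)) \<le> M * (real k + 1) powr (Re (A + B - C) - 1)"
proof -
  obtain M where M: "M > 0" "\<And>k. norm (pochhammer A k * rGamma (of_nat k + C)) \<le> M * (real k + 1) powr Re (A - C)"
    using pochhammer_rGamma_bound[of A C] by metis
  obtain N where N: "N > 0" "\<And>k. norm (pochhammer B k / fact k) \<le> N * (real k + 1) powr (Re B - 1)"
    using pochhammer_fact_bound[of B] by metis
  have "norm (pochhammer A k * pochhammer B k / fact k * rGamma (of_nat k + C)) \<le> (M * N) * (real k + 1) powr (Re (A + B - C) - 1)" for k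
  proof -
    have "norm (pochhammer A k * pochhammer B k / fact k * rGamma (of_nat k + C)) =
       norm (pochhammer A k * rGamma (of_nat k + C)) * norm (pochhammer B k / fact k)"
      by (simp add: norm_mult norm_divide mult_ac)
    also have "\<dots> \<le> (M * (real k + 1) powr Re (A - C)) * (N * (real k + 1) powr (Re B - 1))"
      using M N by (intro mult_mono) auto
    also have "\<dots> = (M * N) * ((real k + 1) powr Re (A - C) * (real k + 1) powr (Re B - 1))" by simp
    also have "(real k + 1) powr Re (A - C) * (real k + 1) powr (Re B - 1) = (real k + 1) powr (Re (A + B - C) - 1)"
      unfolding powr_add[symmetric] by (simp add: algebra_simps)
    finally show ?thesis .
  qed
  thus ?thesis using that[of "M * N"] M N by auto
qed

section \<open>Gauss's theorem for 2F1 at 1\<close>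

lemma summable_Gauss:
  fixes A B C :: complex
  assumes "Re (C - A - B) > 0"
  shows "summable (\<lambda>k. norm (pochhammer A k * pochhammer B k / fact k * rGamma (of_nat k + C)))"
proof -
  obtain M where M: "M > 0"
    "\<And>k. norm (pochhammer A k * pochhammer B k / fact k * rGamma (of_nat k + C)) \<le> M * (real k + 1) powr (Re (A + B - C) - 1)"
    using Gauss_term_bound[of A B C] by metis
  have "summable (\<lambda>k. M * (real k + 1) powr (Re (A + B - C) - 1))"
    by (intro summable_mult summable_Suc_powr) (use assms in auto)
  thus ?thesis by (rule summable_comparison_test') (use M in auto)
qed

text \<open>This is 2F1(A,B;C;1) / Gamma(C), regularised in the same way as
  \<open>F43_reg\<close>.\<close>

definition Gauss_series :: "complex \<Rightarrow> complex \<Rightarrow> complex \<Rightarrow> complex" where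
  "Gauss_series A B C = (\<Sum>k. pochhammer A k * pochhammer B k / fact k * rGamma (of_nat k + C))"

text \<open>With u and v the terms for C and C + 1, both k u_k and (k + 1) u_(k+1) are polynomial
  multiples of v_k. Hence the difference of the two sides is termwise k u_k - (k + 1) u_(k+1) and
  telescopes; the boundary term k u_k tends to 0 exactly because Re(C - A - B) > 0.\<close>

lemma Gauss_contiguous:
  assumes "Re (C - A - B) > 0"
  shows "(C - A - B) * Gauss_series A B C = (C - A) * (C - B) * Gauss_series A B (C + 1)"
proof -
  define u where "u = (\<lambda>k. pochhammer A k * pochhammer B k / fact k * rGamma (of_nat k + C))"
  define v where "v = (\<lambda>k. pochhammer A k * pochhammer B k / fact k * rGamma (of_nat k + (C + 1)))"
  have su: "summable u" "summable v"
    unfolding u_def v_def using assms by (intro summable_norm_cancel[OF summable_Gauss]; simp)+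
  have uv: "u k = (C + of_nat k) * v k" for k
    using rGamma_plus1[of "of_nat k + C"] by (simp add: u_def v_def algebra_simps)
  have u1: "of_nat (Suc k) * u (Suc k) = (A + of_nat k) * (B + of_nat k) * v k" for k
    by (simp add: u_def v_def pochhammer_Suc add_ac divide_simps del: of_nat_Suc) (simp add: algebra_simps)
  obtain M where M: "M > 0" "\<And>k. norm (u k) \<le> M * (real k + 1) powr (Re (A + B - C) - 1)"
    using Gauss_term_bound[of A B C] unfolding u_def by metis
  have lim: "(\<lambda>k. of_nat k * u k) \<longlonglongrightarrow> 0"
  proof (rule Lim_null_comparison)
    show "eventually (\<lambda>k. norm (of_nat k * u k) \<le> M * (real k + 1) powr Re (A + B - C)) sequentially"
    proof (intro always_eventually allI)
      fix k
      have "norm (of_nat k * u k) \<le> (real k + 1) * (M * (real k + 1) powr (Re (A + B - C) - 1))"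
        unfolding norm_mult using M by (intro mult_mono) auto
      also have "\<dots> = M * (real k + 1) powr Re (A + B - C)" by (simp add: powr_diff)
      finally show "norm (of_nat k * u k) \<le> M * (real k + 1) powr Re (A + B - C)" .
    qed
    have "Re (A + B - C) < 0" using assms by simp
    thus "(\<lambda>k. M * (real k + 1) powr Re (A + B - C)) \<longlonglongrightarrow> 0" by real_asymp
  qed
  have "(\<lambda>k. of_nat k * u k - of_nat (Suc k) * u (Suc k)) sums (of_nat 0 * u 0 - 0)"
    by (rule telescope_sums'[OF lim])
  also have "(\<lambda>k. of_nat k * u k - of_nat (Suc k) * u (Suc k)) = (\<lambda>k. (C - A - B) * u k - (C - A) * (C - B) * v k)"
    unfolding u1 unfolding uv by (simp add: fun_eq_iff algebra_simps)
  finally have "(\<lambda>k. (C - A - B) * u k - (C - A) * (C - B) * v k) sums 0" by simp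
  moreover have "(\<lambda>k. (C - A - B) * u k - (C - A) * (C - B) * v k) sums ((C - A - B) * suminf u - (C - A) * (C - B) * suminf v)"
    by (intro sums_diff sums_mult summable_sums su)
  ultimately show ?thesis using sums_unique2 unfolding Gauss_series_def u_def v_def by fastforce
qed

lemma Gauss_contiguous_iterate:
  assumes "Re (C - A - B) > 0"
  shows "pochhammer (C - A - B) n * Gauss_series A B C = pochhammer (C - A) n * pochhammer (C - B) n * Gauss_series A B (C + of_nat n)"
proof (induction n)
  case (Suc n)
  have "(C + of_nat n - A - B) * Gauss_series A B (C + of_nat n) =
     (C + of_nat n - A) * (C + of_nat n - B) * Gauss_series A B (C + of_nat n + 1)"
    using assms by (intro Gauss_contiguous) auto
  hence "(C - A - B + of_nat n) * Gauss_series A B (C + of_nat n) =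
     (C - A + of_nat n) * (C - B + of_nat n) * Gauss_series A B (C + of_nat (Suc n))"
    by (simp add: algebra_simps)
  moreover have "pochhammer (C - A - B) (Suc n) * Gauss_series A B C =
     (C - A - B + of_nat n) * (pochhammer (C - A - B) n * Gauss_series A B C)"
    by (simp add: pochhammer_Suc)
  ultimately show ?case unfolding Suc by (simp add: pochhammer_Suc mult_ac)
qed simp

lemma norm_le_norm_add_of_nat:
  assumes "Re z \<ge> 0"
  shows "norm z \<le> norm (z + of_nat n)"
proof (rule power2_le_imp_le)
  have "(Re z)\<^sup>2 \<le> (Re z + real n)\<^sup>2" using assms by (intro power_mono) auto
  thus "(norm z)\<^sup>2 \<le> (norm (z + of_nat n))\<^sup>2" by (simp add: cmod_power2)
qed simp

lemma norm_pochhammer_le_add_of_nat: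
  fixes z :: complex
  assumes "Re z \<ge> 0"
  shows "norm (pochhammer z k) \<le> norm (pochhammer (z + of_nat n) k)"
proof (induction k)
  case (Suc k)
  have "norm (z + of_nat k) \<le> norm (z + of_nat k + of_nat n)"
    using assms by (intro norm_le_norm_add_of_nat) simp
  thus ?case using Suc unfolding pochhammer_Suc norm_mult
    by (intro mult_mono) (simp_all add: add_ac)
qed simp

text \<open>Only the term k = 0 survives as the denominator parameter goes to infinity; Tannery's
  theorem justifies the termwise limit.\<close>

lemma Gauss_series_shift_tendsto:
  "(\<lambda>n. Gamma (C + of_nat n) * Gauss_series A B (C + of_nat n)) \<longlonglongrightarrow> 1"
proof -
  \<comment> \<open>After a shift by N the parameter D has positive real part, so Pochhammer symbols
    of D + n grow in modulus with n and the terms for n = 0 dominate all the others; the excess Re D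
    > |A| + |B| makes this majorant summable.\<close>
  define N where "N = nat \<lceil>norm A + norm B + norm C\<rceil> + 1"
  have N: "real N > norm A + norm B + norm C" unfolding N_def by linarith
  define D where "D = C + of_nat N"
  have D: "Re D > norm A + norm B"
    using N abs_Re_le_cmod[of C] unfolding D_def by auto
  have D0: "Re D > 0" using D norm_ge_zero[of A] norm_ge_zero[of B] by linarith
  have nn: "D + of_nat n \<notin> \<int>\<^sub>\<le>\<^sub>0" for n using D0 by (auto elim!: nonpos_Ints_cases' simp: complex_eq_iff)
  define t where "t = (\<lambda>n k. pochhammer A k * pochhammer B k / fact k / pochhammer (D + of_nat n) k)"
  have p0': "pochhammer (D + of_nat n) k \<noteq> 0" for n k
    using nn[of n] by (auto simp: pochhammer_eq_0_iff)
  have eq: "Gamma (D + of_nat n) * (pochhammer A k * pochhammer B k / fact k * rGamma (of_nat k + (D + of_nat n))) = t n k" for n k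
    using pochhammer_Gamma[OF nn[of n], of k] nn[of "n + k"] nn[of n] p0'[of n k]
    by (simp add: t_def rGamma_inverse_Gamma Gamma_eq_zero_iff field_simps add_ac)
  have s: "Re (D + of_nat n - A - B) > 0" for n
    using D abs_Re_le_cmod[of A] abs_Re_le_cmod[of B] by simp
  have smn: "summable (\<lambda>k. norm (t n k))" for n
    unfolding eq[symmetric] norm_mult[of "Gamma _"] by (intro summable_mult summable_Gauss s)
  have GS: "Gamma (D + of_nat n) * Gauss_series A B (D + of_nat n) = suminf (t n)" for n
    unfolding Gauss_series_def eq[symmetric] using summable_norm_cancel[OF summable_Gauss[OF s[of n]]]
    by (subst suminf_mult[symmetric]) (auto simp: eq[symmetric] intro!: suminf_cong)
  have le: "norm (pochhammer D k) \<le> norm (pochhammer (D + of_nat n) k)" for n k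
    using D0 by (intro norm_pochhammer_le_add_of_nat) simp
  have p0: "norm (pochhammer D k) > 0" for k
    using nn[of 0] by (auto simp: pochhammer_eq_0_iff)
  have bnd: "norm (t n k) \<le> norm (t 0 k)" for n k
    unfolding t_def norm_divide using le[of k n] p0[of k] by (intro divide_left_mono mult_pos_pos) auto
  have lim: "(\<lambda>n. t n k) \<longlonglongrightarrow> (if k = 0 then 1 else 0)" for k
  proof (cases k)
    case (Suc j)
    have b: "norm (t n k) \<le> norm (pochhammer A k * pochhammer B k / fact k) / norm (pochhammer (D + 1) j) * inverse (real n)" if "n > 0" for n
    proof -
      have "norm (pochhammer (D + 1) j) \<le> norm (pochhammer (D + 1 + of_nat n) j)"
        using D0 by (intro norm_pochhammer_le_add_of_nat) simp
      hence "norm (pochhammer (D + 1) j) \<le> norm (pochhammer (D + of_nat n + 1) j)"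
        by (simp add: add_ac)
      moreover have "real n \<le> norm (D + of_nat n)" using D0 complex_Re_le_cmod[of "D + of_nat n"] by simp
      ultimately have "real n * norm (pochhammer (D + 1) j) \<le> norm (pochhammer (D + of_nat n) k)"
        unfolding Suc pochhammer_rec norm_mult by (intro mult_mono) auto
      moreover have "norm (pochhammer (D + 1) j) > 0"
        using p0[of k] unfolding Suc pochhammer_rec by (auto simp: norm_mult)
      ultimately have "norm (t n k) \<le> norm (pochhammer A k * pochhammer B k / fact k) / (real n * norm (pochhammer (D + 1) j))"
        unfolding t_def norm_divide[of "_ / fact k"] using that p0'[of n k] by (intro divide_left_mono mult_pos_pos) auto
      thus ?thesis by (simp add: field_simps)
    qed
    have "(\<lambda>n. t n k) \<longlonglongrightarrow> 0"
    proof (rule Lim_null_comparison)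
      show "eventually (\<lambda>n. norm (t n k) \<le> norm (pochhammer A k * pochhammer B k / fact k) / norm (pochhammer (D + 1) j) * inverse (real n)) sequentially"
        using eventually_gt_at_top[of 0] by eventually_elim (rule b)
      show "(\<lambda>n. norm (pochhammer A k * pochhammer B k / fact k) / norm (pochhammer (D + 1) j) * inverse (real n)) \<longlonglongrightarrow> 0"
        by (intro tendsto_mult_right_zero lim_inverse_n)
    qed
    thus ?thesis using Suc by simp
  qed (simp add: t_def)
  have "(\<lambda>n. suminf (t n)) \<longlonglongrightarrow> (\<Sum>k. if k = 0 then 1 else 0)"
    using tannerys_theorem[where a = "\<lambda>k n. t n k" and M = "\<lambda>k. norm (t 0 k)" and F = sequentially, OF lim]
    bnd smn[of 0] by (auto intro!: always_eventually)
  also have "(\<Sum>k. if k = 0 then 1 else 0) = (1::complex)" using sums_single[of 0 "\<lambda>_. 1::complex"] by (simp add: sums_iff)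
  finally have "(\<lambda>n. Gamma (D + of_nat n) * Gauss_series A B (D + of_nat n)) \<longlonglongrightarrow> 1" unfolding GS .
  hence "(\<lambda>n. Gamma (C + of_nat (n + N)) * Gauss_series A B (C + of_nat (n + N))) \<longlonglongrightarrow> 1"
    by (simp add: D_def add_ac)
  thus ?thesis by (rule LIMSEQ_offset)
qed

text \<open>\<open>Gauss_contiguous_iterate\<close> moves C to infinity, where the regularised sum
  is known. The Pochhammer quotient left behind is evaluated by four Euler limits, whose powers of n
  cancel since (C - A) + (C - B) = (C - A - B) + C.\<close>

theorem Gauss_summation:
  assumes s: "Re (C - A - B) > 0"
  shows "Gauss_series A B C = Gamma (C - A - B) * rGamma (C - A) * rGamma (C - B)"
proof -
  have ns: "C - A - B \<notin> \<int>\<^sub>\<le>\<^sub>0"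
  proof
    assume "C - A - B \<in> \<int>\<^sub>\<le>\<^sub>0"
    then obtain n where "C - A - B = - of_nat n" by (elim nonpos_Ints_cases')
    from arg_cong[OF this, of Re] s show False by simp
  qed
  define N where "N = nat \<lceil>norm A + norm B + norm C\<rceil> + 1"
  have N: "real N > norm A + norm B + norm C" unfolding N_def by linarith
  define E where "E = (\<lambda>z n. Gamma (z + of_nat (Suc n)) / (fact n * exp (z * of_real (ln (of_nat n)))) :: complex)"
  have pos: "Re z \<ge> - norm A - norm B - norm C \<Longrightarrow> z + of_nat N \<notin> \<int>\<^sub>\<le>\<^sub>0" for z
  proof
    assume z: "Re z \<ge> - norm A - norm B - norm C" "z + of_nat N \<in> \<int>\<^sub>\<le>\<^sub>0"
    then obtain n where "z + of_nat N = - of_nat n" by (elim nonpos_Ints_cases')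
    from arg_cong[OF this, of Re] z(1) N show False by simp
  qed
  have re: "Re C \<ge> - norm C" "Re A \<le> norm A" "Re B \<le> norm B"
    using abs_Re_le_cmod[of C] complex_Re_le_cmod by auto
  have nn: "C - A + of_nat N \<notin> \<int>\<^sub>\<le>\<^sub>0" "C - B + of_nat N \<notin> \<int>\<^sub>\<le>\<^sub>0" "C - A - B + of_nat N \<notin> \<int>\<^sub>\<le>\<^sub>0" "C + of_nat N \<notin> \<int>\<^sub>\<le>\<^sub>0"
  proof -
    have r: "Re C \<ge> - norm A - norm B - norm C" "Re (C - A) \<ge> - norm A - norm B - norm C"
      "Re (C - B) \<ge> - norm A - norm B - norm C" "Re (C - A - B) \<ge> - norm A - norm B - norm C"
      unfolding minus_complex.simps using re norm_ge_zero[of A] norm_ge_zero[of B] by linarith+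
    from pos[OF r(2)] pos[OF r(3)] pos[OF r(4)] pos[OF r(1)]
    show "C - A + of_nat N \<notin> \<int>\<^sub>\<le>\<^sub>0" "C - B + of_nat N \<notin> \<int>\<^sub>\<le>\<^sub>0" "C - A - B + of_nat N \<notin> \<int>\<^sub>\<le>\<^sub>0" "C + of_nat N \<notin> \<int>\<^sub>\<le>\<^sub>0" .
  qed
  have E: "E (z + of_nat N) \<longlonglongrightarrow> 1" if "z + of_nat N \<notin> \<int>\<^sub>\<le>\<^sub>0" for z
    unfolding E_def by (rule Gamma_shift_tendsto[OF that])
  define m where "m = (\<lambda>n. N + Suc n)"
  have nnm: "z + of_nat (m n) \<notin> \<int>\<^sub>\<le>\<^sub>0" if "z + of_nat N \<notin> \<int>\<^sub>\<le>\<^sub>0" for z :: complex and n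
  proof
    assume "z + of_nat (m n) \<in> \<int>\<^sub>\<le>\<^sub>0"
    hence "z + of_nat (m n) - of_nat (Suc n) \<in> \<int>\<^sub>\<le>\<^sub>0" by (intro nonpos_Ints_diff_Nats) auto
    thus False using that by (simp add: m_def algebra_simps)
  qed
  \<comment> \<open>A constant sequence in disguise: the expression equals
    \<open>Gauss_series A B C\<close> for every n, while the limit of each factor is known.\<close>
  have "(\<lambda>n. Gamma (C - A - B) * rGamma (C - A) * rGamma (C - B) *
          (E (C - A + of_nat N) n * E (C - B + of_nat N) n / (E (C - A - B + of_nat N) n * E (C + of_nat N) n)) *
          (Gamma (C + of_nat (m n)) * Gauss_series A B (C + of_nat (m n)))) \<longlonglongrightarrow>
        Gamma (C - A - B) * rGamma (C - A) * rGamma (C - B) * (1 * 1 / (1 * 1)) * 1"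
  proof (intro tendsto_intros E nn)
    have "(\<lambda>n. Gamma (C + of_nat (n + Suc N)) * Gauss_series A B (C + of_nat (n + Suc N))) \<longlonglongrightarrow> 1"
      by (rule LIMSEQ_ignore_initial_segment[OF Gauss_series_shift_tendsto])
    thus "(\<lambda>n. Gamma (C + of_nat (m n)) * Gauss_series A B (C + of_nat (m n))) \<longlonglongrightarrow> 1"
      by (simp add: m_def add_ac)
  qed auto
  moreover have "Gamma (C - A - B) * rGamma (C - A) * rGamma (C - B) *
          (E (C - A + of_nat N) n * E (C - B + of_nat N) n / (E (C - A - B + of_nat N) n * E (C + of_nat N) n)) *
          (Gamma (C + of_nat (m n)) * Gauss_series A B (C + of_nat (m n))) = Gauss_series A B C" for n
  proof -
    define L where "L = (of_real (ln (of_nat n)) :: complex)"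
    define x y u v where "x = Gamma (C - A + of_nat (m n))" and "y = Gamma (C - B + of_nat (m n))"
      and "u = Gamma (C - A - B + of_nat (m n))" and "v = Gamma (C + of_nat (m n))"
    have nz: "x \<noteq> 0" "y \<noteq> 0" "u \<noteq> 0" "v \<noteq> 0"
      using nnm[OF nn(1)] nnm[OF nn(2)] nnm[OF nn(3)] nnm[OF nn(4)] by (auto simp: x_def y_def u_def v_def Gamma_eq_zero_iff)
    have "E (C - A + of_nat N) n * E (C - B + of_nat N) n / (E (C - A - B + of_nat N) n * E (C + of_nat N) n) =
       (x * y) / (u * v) * (exp ((C - A - B + of_nat N) * L) * exp ((C + of_nat N) * L) / (exp ((C - A + of_nat N) * L) * exp ((C - B + of_nat N) * L)))"
      by (simp add: E_def x_def y_def u_def v_def m_def L_def add_ac field_simps)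
    also have "exp ((C - A - B + of_nat N) * L) * exp ((C + of_nat N) * L) / (exp ((C - A + of_nat N) * L) * exp ((C - B + of_nat N) * L)) = 1"
      by (simp add: exp_add[symmetric] exp_diff[symmetric] algebra_simps)
    finally have e: "E (C - A + of_nat N) n * E (C - B + of_nat N) n / (E (C - A - B + of_nat N) n * E (C + of_nat N) n) = (x * y) / (u * v)" by simp
    have "rGamma (C - A) = pochhammer (C - A) (m n) / x" "rGamma (C - B) = pochhammer (C - B) (m n) / y"
      using pochhammer_rGamma[of "C - A" "m n"] pochhammer_rGamma[of "C - B" "m n"]
      by (simp_all add: x_def y_def rGamma_inverse_Gamma divide_inverse)
    moreover have "u = pochhammer (C - A - B) (m n) * Gamma (C - A - B)"
      using pochhammer_Gamma[OF ns, of "m n"] ns by (simp add: u_def Gamma_eq_zero_iff)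
    moreover have "Gauss_series A B (C + of_nat (m n)) * (pochhammer (C - A) (m n) * pochhammer (C - B) (m n)) = pochhammer (C - A - B) (m n) * Gauss_series A B C"
      using Gauss_contiguous_iterate[OF s, of "m n"] by (simp add: mult_ac)
    moreover have "g * rA * rB * (x * y / (u * v)) * (v * S) = T"
      if "rA = P1 / x" "rB = P2 / y" "u = P3 * g" "S * (P1 * P2) = P3 * T" for g rA rB S T P1 P2 P3
    proof -
      have "g * rA * rB * (x * y / (u * v)) * (v * S) = (S * (P1 * P2)) / P3"
        using nz that(1-3) by (auto simp: field_simps)
      thus ?thesis using that nz by auto
    qed
    ultimately show ?thesis unfolding e v_def[symmetric] by blast
  qed
  ultimately show ?thesis using LIMSEQ_const_iff by auto
qed

text \<open>Induction on k by creative telescoping: after multiplication by e + k, each summand of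
  the sum for k + 1, regrouped by Pascal's rule, is (b + k)(c + k) times the summand for k plus a
  difference of the certificate \<open>G\<close>.\<close>

lemma Pfaff_Saalschuetz:
  fixes b c e :: complex
  assumes e: "e \<notin> \<int>\<^sub>\<le>\<^sub>0"
  shows "pochhammer b k * pochhammer c k / pochhammer e k =
    (\<Sum>m\<le>k. of_nat (k choose m) * (pochhammer (e - b) m * pochhammer (e - c) m / pochhammer e m) * pochhammer (b + c - e) (k - m))"
proof (induction k)
  case (Suc k)
  define u where "u = b + c - e"
  define w where "w = (\<lambda>m. pochhammer (e - b) m * pochhammer (e - c) m / pochhammer e m)"
  define T where "T = (\<lambda>k m. of_nat (k choose m) * w m * pochhammer u (k - m))"
  have em: "e + of_nat m \<noteq> 0" for m
  proof
    assume "e + of_nat m = 0"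
    hence "e = - of_nat m" by (simp add: add_eq_0_iff2)
    thus False using e by simp
  qed
  have w_Suc: "w (Suc m) = w m * ((e - b + of_nat m) * (e - c + of_nat m) / (e + of_nat m))" for m
    by (simp add: w_def pochhammer_Suc)
  \<comment> \<open>The certificate: it vanishes at m = 0 through the factor m and at m = k + 1
    through the binomial coefficient, so its differences contribute nothing to the sum.\<close>
  define G where "G = (\<lambda>m. of_nat m * (u + of_nat k - of_nat m) * T k m)"
  have G_Suc: "G (Suc m) = of_nat (k - m) * ((e - b + of_nat m) * (e - c + of_nat m) / (e + of_nat m)) * T k m" if "m \<le> k" for m
  proof (cases "m = k")
    case False
    with that have m: "m < k" by simp
    have "Suc m * (k choose Suc m) = (k - m) * (k choose m)"
      by (metis binomial_absorb_comp binomial_absorption mult.commute)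
    from arg_cong[OF this, of of_nat]
    have bin: "of_nat (Suc m) * of_nat (k choose Suc m) = (of_nat (k - m) * of_nat (k choose m) :: complex)"
      by (simp only: of_nat_mult)
    have "Suc (k - Suc m) = k - m" using m by simp
    hence "pochhammer u (k - m) = pochhammer u (k - Suc m) * (u + of_nat (k - Suc m))"
      by (metis pochhammer_Suc)
    hence po: "pochhammer u (k - m) = pochhammer u (k - Suc m) * (u + of_nat k - of_nat (Suc m))"
      using m by (simp add: of_nat_diff)
    have "G (Suc m) = (of_nat (Suc m) * of_nat (k choose Suc m)) * w (Suc m) * (pochhammer u (k - Suc m) * (u + of_nat k - of_nat (Suc m)))"
      unfolding G_def T_def by (simp only: mult_ac)
    thus ?thesis unfolding bin po[symmetric] w_Suc T_def by (simp only: mult_ac)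
  qed (simp add: G_def T_def)
  define X where "X = (\<lambda>m. (e - b + of_nat m) * (e - c + of_nat m) / (e + of_nat m))"
  have "(\<Sum>m\<le>Suc k. T (Suc k) m) = pochhammer u (Suc k) + (\<Sum>m\<le>k. T (Suc k) (Suc m))"
    by (subst sum.atMost_Suc_shift) (simp add: T_def w_def)
  also have "(\<Sum>m\<le>k. T (Suc k) (Suc m)) = (\<Sum>m\<le>k. of_nat (k choose Suc m) * w (Suc m) * pochhammer u (k - m)) + (\<Sum>m\<le>k. T k m * X m)"
  proof (unfold sum.distrib[symmetric], intro sum.cong refl)
    fix m
    have "w (Suc m) = w m * X m" by (simp add: w_Suc X_def)
    thus "T (Suc k) (Suc m) = of_nat (k choose Suc m) * w (Suc m) * pochhammer u (k - m) + T k m * X m"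
      by (simp add: T_def algebra_simps)
  qed
  also have "pochhammer u (Suc k) + ((\<Sum>m\<le>k. of_nat (k choose Suc m) * w (Suc m) * pochhammer u (k - m)) + (\<Sum>m\<le>k. T k m * X m)) =
     (\<Sum>m\<le>Suc k. of_nat (k choose m) * w m * pochhammer u (Suc k - m)) + (\<Sum>m\<le>k. T k m * X m)"
    by (subst sum.atMost_Suc_shift[where n = k]) (simp add: w_def)
  also have "(\<Sum>m\<le>Suc k. of_nat (k choose m) * w m * pochhammer u (Suc k - m)) = (\<Sum>m\<le>k. (u + of_nat k - of_nat m) * T k m)"
    by (auto intro!: sum.cong simp: T_def Suc_diff_le pochhammer_Suc of_nat_diff algebra_simps)
  finally have "(\<Sum>m\<le>Suc k. T (Suc k) m) = (\<Sum>m\<le>k. T k m * (u + of_nat k - of_nat m + X m))"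
    by (simp add: sum.distrib[symmetric] algebra_simps)
  hence "(e + of_nat k) * (\<Sum>m\<le>Suc k. T (Suc k) m) = (\<Sum>m\<le>k. T k m * ((e + of_nat k) * (u + of_nat k - of_nat m + X m)))"
    by (simp add: sum_distrib_left mult_ac)
  also have "\<dots> = (\<Sum>m\<le>k. (b + of_nat k) * (c + of_nat k) * T k m + (G (Suc m) - G m))"
  proof (intro sum.cong refl)
    fix m assume "m \<in> {..k}"
    hence m: "m \<le> k" by simp
    have *: "(e + of_nat k) * (u + of_nat k - of_nat m + X m) = (b + of_nat k) * (c + of_nat k) + (of_nat k - of_nat m) * X m - of_nat m * (u + of_nat k - of_nat m)"
      using em[of m] unfolding u_def X_def by (simp add: field_simps)
    have "T k m * ((e + of_nat k) * (u + of_nat k - of_nat m + X m)) =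
      (b + of_nat k) * (c + of_nat k) * T k m + (of_nat (k - m) * X m * T k m - G m)"
      unfolding * using m by (simp add: G_def of_nat_diff algebra_simps)
    thus "T k m * ((e + of_nat k) * (u + of_nat k - of_nat m + X m)) = (b + of_nat k) * (c + of_nat k) * T k m + (G (Suc m) - G m)"
      unfolding G_Suc[OF m] X_def .
  qed
  also have "\<dots> = (b + of_nat k) * (c + of_nat k) * (\<Sum>m\<le>k. T k m) + (G (Suc k) - G 0)"
    unfolding sum.distrib sum_distrib_left using sum_lessThan_telescope[of G "Suc k"] by (simp add: lessThan_Suc_atMost)
  also have "G (Suc k) - G 0 = 0" using G_Suc[of k] by (simp add: G_def)
  finally have "(\<Sum>m\<le>Suc k. T (Suc k) m) = (b + of_nat k) * (c + of_nat k) / (e + of_nat k) * (\<Sum>m\<le>k. T k m)"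
    using em[of k] by (simp add: field_simps)
  also have "(\<Sum>m\<le>k. T k m) = pochhammer b k * pochhammer c k / pochhammer e k"
    unfolding Suc T_def w_def u_def ..
  finally show ?case unfolding T_def w_def u_def by (simp add: pochhammer_Suc mult_ac)
qed simp

section \<open>Residues of Barnes integrals\<close>

definition F43_term ::
  "complex \<Rightarrow> complex \<Rightarrow> complex \<Rightarrow> complex \<Rightarrow> complex \<Rightarrow> complex \<Rightarrow> complex \<Rightarrow> nat \<Rightarrow> complex" where
  "F43_term A B C D E F G k = pochhammer A k * pochhammer B k * pochhammer C k * pochhammer D k / fact k
          * (rGamma (of_nat k + E) * rGamma (of_nat k + F) * rGamma (of_nat k + G))"

lemma F43_reg_suminf: "F43_reg A B C D E F G = suminf (F43_term A B C D E F G)"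
  by (simp only: F43_reg_def F43_term_def [abs_def])

lemma summable_F43_term:
  assumes "Re (E + F + G - A - B - C - D) > 0"
  shows "summable (\<lambda>k. norm (F43_term A B C D E F G k))"
proof -
  obtain M1 where M1: "M1 > 0" "\<And>k. norm (pochhammer A k * rGamma (of_nat k + E)) \<le> M1 * (real k + 1) powr Re (A - E)"
    using pochhammer_rGamma_bound[of A E] by metis
  obtain M2 where M2: "M2 > 0" "\<And>k. norm (pochhammer B k * rGamma (of_nat k + F)) \<le> M2 * (real k + 1) powr Re (B - F)"
    using pochhammer_rGamma_bound[of B F] by metis
  obtain M3 where M3: "M3 > 0" "\<And>k. norm (pochhammer C k * rGamma (of_nat k + G)) \<le> M3 * (real k + 1) powr Re (C - G)"
    using pochhammer_rGamma_bound[of C G] by metis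
  obtain M4 where M4: "M4 > 0" "\<And>k. norm (pochhammer D k / fact k) \<le> M4 * (real k + 1) powr (Re D - 1)"
    using pochhammer_fact_bound[of D] by metis
  define p where "p = Re (A - E) + Re (B - F) + Re (C - G) + (Re D - 1)"
  have sm: "summable (\<lambda>k. (M1 * M2 * M3 * M4) * (real k + 1) powr p)"
    by (intro summable_mult summable_Suc_powr) (use assms in \<open>simp add: p_def\<close>)
  have bd: "norm (F43_term A B C D E F G k) \<le> (M1 * M2 * M3 * M4) * (real k + 1) powr p" for k
  proof -
    have "norm (F43_term A B C D E F G k) = norm (pochhammer A k * rGamma (of_nat k + E)) *
       norm (pochhammer B k * rGamma (of_nat k + F)) * norm (pochhammer C k * rGamma (of_nat k + G)) *
       norm (pochhammer D k / fact k)"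
      by (simp add: F43_term_def norm_mult norm_divide mult_ac)
    also have "\<dots> \<le> (M1 * (real k + 1) powr Re (A - E)) * (M2 * (real k + 1) powr Re (B - F)) *
        (M3 * (real k + 1) powr Re (C - G)) * (M4 * (real k + 1) powr (Re D - 1))"
      using M1(1) M2(1) M3(1) M4(1) by (intro mult_mono M1(2) M2(2) M3(2) M4(2)) auto
    also have "\<dots> = (M1 * M2 * M3 * M4) * ((real k + 1) powr Re (A - E) * (real k + 1) powr Re (B - F) *
        (real k + 1) powr Re (C - G) * (real k + 1) powr (Re D - 1))" by (simp only: mult_ac)
    also have "\<dots> = (M1 * M2 * M3 * M4) * (real k + 1) powr p"
      unfolding powr_add[symmetric] p_def ..
    finally show ?thesis .
  qed
  show ?thesis by (rule summable_comparison_test'[OF sm, of 0]) (use bd in simp)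
qed

lemma sums_F43_term:
  assumes "Re (E + F + G - A - B - C - D) > 0"
  shows "F43_term A B C D E F G sums F43_reg A B C D E F G"
  unfolding F43_reg_suminf by (rule summable_sums[OF summable_norm_cancel[OF summable_F43_term[OF assms]]])

section \<open>Sine bounds away from the integers and decay of the Barnes integrand\<close>

lemma norm_sin_ge:
  assumes \<eta>: "0 < \<eta>" "\<eta> \<le> 2" and "\<bar>Im w\<bar> \<ge> 1 \<or> cos (2 * Re w) \<le> 1 - \<eta>"
  shows "norm (sin w) \<ge> sqrt \<eta> / 4 * exp \<bar>Im w\<bar>"
proof (rule power2_le_imp_le)
  \<comment> \<open>The squared modulus of sin w is (E + 1/E - 2 cos(2 Re w)) / 4. For E >= 4 the
    term E dominates. For E < 4 one has |Im w| < 1, because exp 2 >= 4, and then the assumption on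
    the cosine supplies the gap.\<close>
  define E where "E = exp (2 * \<bar>Im w\<bar>)"
  have E1: "E \<ge> 1" by (simp add: E_def)
  have "exp (2 * Im w) + inverse (exp (2 * Im w)) = E + 1 / E"
    by (cases "Im w \<ge> 0") (simp_all add: E_def exp_minus divide_inverse)
  hence sq: "(norm (sin w))\<^sup>2 = (E + 1 / E - 2 * cos (2 * Re w)) / 4"
    unfolding norm_sin_squared by simp
  \<comment> \<open>E + 1/E - 2 = E (1 - 1/E)^2, and 1 - 1/E >= 3/4 here.\<close>
  have big: "E + 1 / E - 2 \<ge> 9 / 16 * E" if "E \<ge> 4"
  proof -
    have "(E - 4) * (7 * E - 4) \<ge> 0" using that by (intro mult_nonneg_nonneg) auto
    moreover have "(E + 1 / E - 2) * (16 * E) = 16 * (E * E) + 16 - 32 * E" using E1 by (simp add: field_simps)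
    ultimately have "(E + 1 / E - 2) * (16 * E) \<ge> 9 / 16 * E * (16 * E)" by (simp add: algebra_simps)
    thus ?thesis using E1 by (simp only: mult_le_cancel_right)
  qed
  have "E + 1 / E - 2 * cos (2 * Re w) \<ge> \<eta> / 4 * E"
  proof (cases "E \<ge> 4")
    case True
    have "\<eta> / 4 * E \<le> 9 / 16 * E" using \<eta> E1 by (intro mult_right_mono) auto
    moreover have "cos (2 * Re w) \<le> 1" by simp
    ultimately show ?thesis using big[OF True] by linarith
  next
    case False
    have "\<not> \<bar>Im w\<bar> \<ge> 1"
    proof
      assume "\<bar>Im w\<bar> \<ge> 1"
      hence "exp 2 \<le> E" by (simp add: E_def)
      moreover have "exp (2::real) = exp 1 * exp 1" by (simp flip: exp_add)
      moreover have "exp (1::real) \<ge> 2" using exp_ge_add_one_self[of 1] by simp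
      moreover have "exp (1::real) * exp 1 \<ge> 2 * 2" using \<open>exp (1::real) \<ge> 2\<close> by (intro mult_mono) auto
      ultimately show False using False by linarith
    qed
    hence c: "cos (2 * Re w) \<le> 1 - \<eta>" using assms(3) by simp
    have "E + 1 / E \<ge> 2"
    proof -
      have "(E - 1)\<^sup>2 \<ge> 0" by simp
      thus ?thesis using E1 by (simp add: field_simps power2_eq_square)
    qed
    moreover have "\<eta> / 4 * E \<le> \<eta> / 4 * 4" using False \<eta> by (intro mult_left_mono) auto
    ultimately show ?thesis using c \<eta> by linarith
  qed
  moreover have "(sqrt \<eta> / 4 * exp \<bar>Im w\<bar>)\<^sup>2 = \<eta> / 16 * E"
    using \<eta> by (simp add: E_def power_mult_distrib power_divide exp_double[symmetric])
  ultimately show "(sqrt \<eta> / 4 * exp \<bar>Im w\<bar>)\<^sup>2 \<le> (norm (sin w))\<^sup>2" unfolding sq by simp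
qed simp

text \<open>A quantitative distance from the integers. The cosine makes it periodic in Re z with
  period 1, so one choice of the margin works for all the contours below.\<close>

definition sin_away :: "real \<Rightarrow> complex \<Rightarrow> bool" where
  "sin_away \<eta> z \<longleftrightarrow> \<bar>Im z\<bar> \<ge> 1 \<or> cos (2 * pi * Re z) \<le> 1 - \<eta>"

lemma sin_away_not_Int:
  assumes "sin_away \<eta> z" "\<eta> > 0"
  shows "z \<notin> \<int>"
proof
  assume "z \<in> \<int>"
  then obtain n where "z = of_int n" by (elim Ints_cases)
  moreover have "cos (2 * pi * real_of_int n) = 1" by (metis cos_int_2pin mult.commute mult.left_commute)
  ultimately show False using assms by (simp add: sin_away_def)
qed

text \<open>The numerator is at most exp(pi |Im(d - t)|) and the denominator at least a constant
  times exp(pi |Im(b - t)|); the imaginary parts differ by the constant Im(d - b), so the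
  exponential growth cancels.\<close>

lemma sin_ratio_bound:
  fixes b d t :: complex
  assumes \<eta>: "0 < \<eta>" "\<eta> \<le> 2" and away: "sin_away \<eta> (b - t)"
  shows "norm (sin (of_real pi * (d - t)) / sin (of_real pi * (b - t))) \<le> 4 / sqrt \<eta> * exp (pi * \<bar>Im (d - b)\<bar>)"
proof -
  define x where "x = pi * \<bar>Im (b - t)\<bar>"
  have "norm (sin (of_real pi * (d - t))) \<le> exp \<bar>Im (of_real pi * (d - t))\<bar>"
    using cmod_sin_le_exp[of 1 "of_real pi * (d - t)"] by simp
  also have "\<bar>Im (of_real pi * (d - t))\<bar> = pi * \<bar>Im (d - t)\<bar>" by (simp add: abs_mult)
  also have "\<dots> \<le> pi * (\<bar>Im (d - b)\<bar> + \<bar>Im (b - t)\<bar>)" by (intro mult_left_mono) auto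
  also have "\<dots> = pi * \<bar>Im (d - b)\<bar> + x" by (simp add: x_def distrib_left)
  finally have 1: "norm (sin (of_real pi * (d - t))) \<le> exp (pi * \<bar>Im (d - b)\<bar>) * exp x"
    by (simp add: exp_add)
  have "\<bar>Im (of_real pi * (b - t))\<bar> \<ge> 1 \<or> cos (2 * Re (of_real pi * (b - t))) \<le> 1 - \<eta>"
  proof (cases "\<bar>Im (b - t)\<bar> \<ge> 1")
    case True
    have "1 * 1 \<le> pi * \<bar>Im (b - t)\<bar>" using True pi_ge_two by (intro mult_mono) auto
    thus ?thesis by (simp add: abs_mult)
  next
    case False
    thus ?thesis using away by (simp add: sin_away_def mult.assoc)
  qed
  from norm_sin_ge[OF \<eta> this] have 2: "norm (sin (of_real pi * (b - t))) \<ge> sqrt \<eta> / 4 * exp x"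
    by (simp add: x_def abs_mult)
  have "norm (sin (of_real pi * (d - t))) / norm (sin (of_real pi * (b - t))) \<le> exp (pi * \<bar>Im (d - b)\<bar>) * exp x / (sqrt \<eta> / 4 * exp x)"
    using 1 2 \<eta> by (intro frac_le) auto
  also have "\<dots> = 4 / sqrt \<eta> * exp (pi * \<bar>Im (d - b)\<bar>)" by simp
  finally show ?thesis by (simp add: norm_divide)
qed

lemma Gamma_eq_reflection:
  fixes z :: complex
  assumes "z \<notin> \<int>"
  shows "Gamma z = of_real pi / sin (of_real pi * z) * rGamma (1 - z)"
proof -
  have "1 - z \<notin> \<int>\<^sub>\<le>\<^sub>0" using assms by (metis Ints_1 Ints_diff diff_diff_eq2 add_diff_cancel_left' nonpos_Ints_Int)
  hence "Gamma (1 - z) \<noteq> 0" by (simp add: Gamma_eq_zero_iff)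
  hence "Gamma z = Gamma z * Gamma (1 - z) * rGamma (1 - z)" by (simp add: rGamma_inverse_Gamma)
  thus ?thesis unfolding Gamma_reflection_complex .
qed

lemma rGamma_eq_reflection:
  fixes z :: complex
  assumes "1 - z \<notin> \<int>\<^sub>\<le>\<^sub>0"
  shows "rGamma z = sin (of_real pi * z) / of_real pi * Gamma (1 - z)"
  using rGamma_reflection_complex[of z] assms by (simp add: rGamma_inverse_Gamma[of "1 - z"] Gamma_eq_zero_iff field_simps)

text \<open>The brackets pair each Gamma with the reciprocal one that compensates its growth; every
  bound treats the four pairs separately.\<close>

definition Barnes_integrand ::
  "complex \<Rightarrow> complex \<Rightarrow> complex \<Rightarrow> complex \<Rightarrow> complex \<Rightarrow> complex \<Rightarrow> complex \<Rightarrow> complex \<Rightarrow> complex \<Rightarrow> complex" where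
  "Barnes_integrand a1 a2 b1 b2 c1 c2 d1 d2 t =
     (Gamma (a1 + t) * rGamma (c1 + t)) * (Gamma (a2 + t) * rGamma (c2 + t)) *
     ((Gamma (b1 - t) * rGamma (d1 - t)) * (Gamma (b2 - t) * rGamma (d2 - t)))"

lemma Barnes_integrand_minus:
  "Barnes_integrand a1 a2 b1 b2 c1 c2 d1 d2 (- t) = Barnes_integrand b1 b2 a1 a2 d1 d2 c1 c2 t"
  by (simp add: Barnes_integrand_def mult_ac)

text \<open>Reflection turns the quotient into a ratio of sines times Gamma(1 - d + t) / Gamma(1 - b
  + t), to which \<open>Gamma_ratio_bound\<close> applies. The poles of Gamma(b - t) lie to the
  right, hence the condition on b - t.\<close>

lemma Gamma_ratio_minus_bound:
  fixes b d :: complex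
  assumes \<eta>: "0 < \<eta>" "\<eta> \<le> 2"
  obtains C R where "C > 0" "R > 0"
    "\<And>t. Re t \<ge> 0 \<Longrightarrow> norm t \<ge> R \<Longrightarrow> sin_away \<eta> (b - t) \<Longrightarrow>
       norm (Gamma (b - t) * rGamma (d - t)) \<le> C * norm t powr Re (b - d)"
proof -
  obtain C R where CR: "C > 0" "R > 0"
    "\<And>t. Re t \<ge> 0 \<Longrightarrow> norm t \<ge> R \<Longrightarrow> norm (Gamma ((1 - d) + t) * rGamma ((1 - b) + t)) \<le> C * norm t powr Re ((1 - d) - (1 - b))"
    using Gamma_ratio_bound[of "1 - d" "1 - b"] by metis
  define Q where "Q = 4 / sqrt \<eta> * exp (pi * \<bar>Im (d - b)\<bar>)"
  define R' where "R' = max R (2 * norm (1 - d) + 1)"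
  show ?thesis
  proof (rule that)
    show "Q * C > 0" using CR \<eta> by (simp add: Q_def)
    show "R' > 0" using CR by (simp add: R'_def)
    fix t assume t: "Re t \<ge> 0" "norm t \<ge> R'" "sin_away \<eta> (b - t)"
    have "b - t \<notin> \<int>" using sin_away_not_Int[OF t(3) \<eta>(1)] .
    from Gamma_eq_reflection[OF this] have 1: "Gamma (b - t) = of_real pi / sin (of_real pi * (b - t)) * rGamma ((1 - b) + t)"
      by (simp add: algebra_simps)
    have "norm t > 2 * norm (1 - d)" using t(2) by (simp add: R'_def)
    hence "(1 - d) + t \<notin> \<int>\<^sub>\<le>\<^sub>0" using t(1) by (rule not_nonpos_Ints_norm_Re)
    hence "1 - (d - t) \<notin> \<int>\<^sub>\<le>\<^sub>0" by (simp add: algebra_simps)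
    from rGamma_eq_reflection[OF this] have 2: "rGamma (d - t) = sin (of_real pi * (d - t)) / of_real pi * Gamma ((1 - d) + t)"
      by (simp add: algebra_simps)
    have "Gamma (b - t) * rGamma (d - t) = (sin (of_real pi * (d - t)) / sin (of_real pi * (b - t))) * (Gamma ((1 - d) + t) * rGamma ((1 - b) + t))"
      unfolding 1 2 by simp
    also have "norm \<dots> \<le> Q * (C * norm t powr Re ((1 - d) - (1 - b)))"
      unfolding norm_mult[of "_ / _"] Q_def
      using t CR(1,2) \<eta> by (intro mult_mono sin_ratio_bound CR(3)) (auto simp: R'_def)
    finally show "norm (Gamma (b - t) * rGamma (d - t)) \<le> Q * C * norm t powr Re (b - d)" by simp
  qed
qed

lemma Barnes_integrand_bound_right:
  fixes a1 a2 b1 b2 c1 c2 d1 d2 :: complex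
  assumes \<eta>: "0 < \<eta>" "\<eta> \<le> 2"
  defines "s \<equiv> Re (c1 + c2 + d1 + d2 - a1 - a2 - b1 - b2)"
  obtains C R where "C > 0" "R > 0"
    "\<And>t. Re t \<ge> 0 \<Longrightarrow> norm t \<ge> R \<Longrightarrow> sin_away \<eta> (b1 - t) \<Longrightarrow> sin_away \<eta> (b2 - t) \<Longrightarrow>
       norm (Barnes_integrand a1 a2 b1 b2 c1 c2 d1 d2 t) \<le> C * norm t powr (- s)"
proof -
  obtain C1 R1 where 1: "C1 > 0" "R1 > 0"
    "\<And>t. Re t \<ge> 0 \<Longrightarrow> norm t \<ge> R1 \<Longrightarrow> norm (Gamma (a1 + t) * rGamma (c1 + t)) \<le> C1 * norm t powr Re (a1 - c1)"
    using Gamma_ratio_bound[of a1 c1] by metis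
  obtain C2 R2 where 2: "C2 > 0" "R2 > 0"
    "\<And>t. Re t \<ge> 0 \<Longrightarrow> norm t \<ge> R2 \<Longrightarrow> norm (Gamma (a2 + t) * rGamma (c2 + t)) \<le> C2 * norm t powr Re (a2 - c2)"
    using Gamma_ratio_bound[of a2 c2] by metis
  obtain C3 R3 where 3: "C3 > 0" "R3 > 0"
    "\<And>t. Re t \<ge> 0 \<Longrightarrow> norm t \<ge> R3 \<Longrightarrow> sin_away \<eta> (b1 - t) \<Longrightarrow> norm (Gamma (b1 - t) * rGamma (d1 - t)) \<le> C3 * norm t powr Re (b1 - d1)"
    using Gamma_ratio_minus_bound[OF \<eta>, of b1 d1] by metis
  obtain C4 R4 where 4: "C4 > 0" "R4 > 0"
    "\<And>t. Re t \<ge> 0 \<Longrightarrow> norm t \<ge> R4 \<Longrightarrow> sin_away \<eta> (b2 - t) \<Longrightarrow> norm (Gamma (b2 - t) * rGamma (d2 - t)) \<le> C4 * norm t powr Re (b2 - d2)"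
    using Gamma_ratio_minus_bound[OF \<eta>, of b2 d2] by metis
  define R where "R = max (max R1 R2) (max R3 R4)"
  show ?thesis
  proof (rule that)
    show "C1 * C2 * (C3 * C4) > 0" using 1 2 3 4 by simp
    show "R > 0" using 1 by (simp add: R_def)
    fix t assume t: "Re t \<ge> 0" "norm t \<ge> R" "sin_away \<eta> (b1 - t)" "sin_away \<eta> (b2 - t)"
    have r: "norm t \<ge> R1" "norm t \<ge> R2" "norm t \<ge> R3" "norm t \<ge> R4" using t(2) by (simp_all add: R_def)
    have "norm (Barnes_integrand a1 a2 b1 b2 c1 c2 d1 d2 t) \<le>
       (C1 * norm t powr Re (a1 - c1)) * (C2 * norm t powr Re (a2 - c2)) * ((C3 * norm t powr Re (b1 - d1)) * (C4 * norm t powr Re (b2 - d2)))"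
      unfolding Barnes_integrand_def norm_mult[of "_ * _" "_ * _"]
      using 1(1) 2(1) 3(1) 4(1) by (intro mult_mono 1(3) 2(3) 3(3) 4(3) t r) auto
    also have "\<dots> = C1 * C2 * (C3 * C4) * (norm t powr Re (a1 - c1) * norm t powr Re (a2 - c2) * norm t powr Re (b1 - d1) * norm t powr Re (b2 - d2))"
      by (simp only: mult_ac)
    also have "\<dots> = C1 * C2 * (C3 * C4) * norm t powr (- s)"
      unfolding powr_add[symmetric] s_def by (simp add: algebra_simps)
    finally show "norm (Barnes_integrand a1 a2 b1 b2 c1 c2 d1 d2 t) \<le> C1 * C2 * (C3 * C4) * norm t powr (- s)" .
  qed
qed

text \<open>The left half-plane reduces to the right one by t -> -t, which exchanges the a, c
  parameters with the b, d parameters and preserves s.\<close>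

lemma Barnes_integrand_bound:
  fixes a1 a2 b1 b2 c1 c2 d1 d2 :: complex
  assumes \<eta>: "0 < \<eta>" "\<eta> \<le> 2"
  defines "s \<equiv> Re (c1 + c2 + d1 + d2 - a1 - a2 - b1 - b2)"
  obtains C R where "C > 0" "R > 0"
    "\<And>t. norm t \<ge> R \<Longrightarrow> sin_away \<eta> (a1 + t) \<Longrightarrow> sin_away \<eta> (a2 + t) \<Longrightarrow> sin_away \<eta> (b1 - t) \<Longrightarrow> sin_away \<eta> (b2 - t) \<Longrightarrow>
       norm (Barnes_integrand a1 a2 b1 b2 c1 c2 d1 d2 t) \<le> C * norm t powr (- s)"
proof -
  obtain C1 R1 where 1: "C1 > 0" "R1 > 0"
    "\<And>t. Re t \<ge> 0 \<Longrightarrow> norm t \<ge> R1 \<Longrightarrow> sin_away \<eta> (b1 - t) \<Longrightarrow> sin_away \<eta> (b2 - t) \<Longrightarrow>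
       norm (Barnes_integrand a1 a2 b1 b2 c1 c2 d1 d2 t) \<le> C1 * norm t powr (- s)"
    using Barnes_integrand_bound_right[OF \<eta>, of b1 b2 a1 a2 c1 c2 d1 d2] unfolding s_def by metis
  obtain C2 R2 where 2: "C2 > 0" "R2 > 0"
    "\<And>t. Re t \<ge> 0 \<Longrightarrow> norm t \<ge> R2 \<Longrightarrow> sin_away \<eta> (a1 - t) \<Longrightarrow> sin_away \<eta> (a2 - t) \<Longrightarrow>
       norm (Barnes_integrand b1 b2 a1 a2 d1 d2 c1 c2 t) \<le> C2 * norm t powr (- Re (d1 + d2 + c1 + c2 - b1 - b2 - a1 - a2))"
    using Barnes_integrand_bound_right[OF \<eta>, of a1 a2 b1 b2 d1 d2 c1 c2] by metis
  have s: "Re (d1 + d2 + c1 + c2 - b1 - b2 - a1 - a2) = s" by (simp add: s_def)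
  show ?thesis
  proof (rule that)
    show "max C1 C2 > 0" "max R1 R2 > 0" using 1 2 by simp_all
    fix t assume t: "norm t \<ge> max R1 R2" "sin_away \<eta> (a1 + t)" "sin_away \<eta> (a2 + t)" "sin_away \<eta> (b1 - t)" "sin_away \<eta> (b2 - t)"
    have "norm (Barnes_integrand a1 a2 b1 b2 c1 c2 d1 d2 t) \<le> C1 * norm t powr (- s) \<or>
          norm (Barnes_integrand a1 a2 b1 b2 c1 c2 d1 d2 t) \<le> C2 * norm t powr (- s)"
    proof (cases "Re t \<ge> 0")
      case True
      thus ?thesis using 1(3)[of t] t by simp
    next
      case False
      thus ?thesis using 2(3)[of "- t"] t unfolding s Barnes_integrand_minus by simp
    qed
    moreover have "C1 * norm t powr (- s) \<le> max C1 C2 * norm t powr (- s)" "C2 * norm t powr (- s) \<le> max C1 C2 * norm t powr (- s)"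
      by (intro mult_right_mono; simp)+
    ultimately show "norm (Barnes_integrand a1 a2 b1 b2 c1 c2 d1 d2 t) \<le> max C1 C2 * norm t powr (- s)" by linarith
  qed
qed

lemma contour_integral_rectpath_bound:
  assumes cont: "continuous_on (path_image (rectpath p q)) f"
    and B: "0 \<le> B" "\<And>z. z \<in> path_image (rectpath p q) \<Longrightarrow> norm (f z) \<le> B"
  shows "norm (contour_integral (rectpath p q) f) \<le> B * (2 * \<bar>Re (q - p)\<bar> + 2 * \<bar>Im (q - p)\<bar>)"
proof -
  define u v where "u = Complex (Re q) (Im p)" and "v = Complex (Re p) (Im q)"
  have im: "path_image (rectpath p q) = closed_segment p u \<union> (closed_segment u q \<union> (closed_segment q v \<union> closed_segment v p))"
    by (simp add: rectpath_def Let_def path_image_join u_def v_def)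
  have int: "f contour_integrable_on linepath x y" if "closed_segment x y \<subseteq> path_image (rectpath p q)" for x y
    by (intro contour_integrable_continuous_linepath continuous_on_subset[OF cont] that)
  have le: "norm (contour_integral (linepath x y) f) \<le> B * norm (y - x)" if "closed_segment x y \<subseteq> path_image (rectpath p q)" for x y
    by (intro contour_integral_bound_linepath int that B) (use that in auto)
  have seg: "closed_segment p u \<subseteq> path_image (rectpath p q)" "closed_segment u q \<subseteq> path_image (rectpath p q)"
    "closed_segment q v \<subseteq> path_image (rectpath p q)" "closed_segment v p \<subseteq> path_image (rectpath p q)"
    unfolding im by auto
  have "contour_integral (rectpath p q) f = contour_integral (linepath p u) f + (contour_integral (linepath u q) f +
     (contour_integral (linepath q v) f + contour_integral (linepath v p) f))"
    unfolding rectpath_def Let_def u_def[symmetric] v_def[symmetric]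
    using int[OF seg(1)] int[OF seg(2)] int[OF seg(3)] int[OF seg(4)]
    by (simp add: contour_integrable_joinI valid_path_join)
  also have "norm \<dots> \<le> B * norm (u - p) + (B * norm (q - u) + (B * norm (v - q) + B * norm (p - v)))"
    by (intro norm_triangle_le add_mono le seg)
  finally have *: "norm (contour_integral (rectpath p q) f) \<le>
    B * norm (u - p) + (B * norm (q - u) + (B * norm (v - q) + B * norm (p - v)))" .
  have sides: "u - p = of_real (Re (q - p))" "q - u = \<i> * of_real (Im (q - p))"
    "v - q = of_real (- Re (q - p))" "p - v = \<i> * of_real (- Im (q - p))"
    by (auto simp: u_def v_def complex_eq_iff)
  show ?thesis using * unfolding sides by (simp only: norm_of_real norm_mult norm_ii abs_minus_cancel) (simp add: algebra_simps)
qed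

section \<open>Residues at the poles of the four Gamma factors\<close>

lemma residue_Gamma_plus_times:
  fixes \<alpha> :: complex
  assumes U: "open U" "- \<alpha> - of_nat k \<in> U" and g: "g holomorphic_on U"
  shows "residue (\<lambda>t. Gamma (\<alpha> + t) * g t) (- \<alpha> - of_nat k) = (-1) ^ k / fact k * g (- \<alpha> - of_nat k)"
proof -
  define p where "p = - \<alpha> - of_nat k"
  \<comment> \<open>The poles of the Gamma factor are spaced by 1, so p is the only one in the open
    unit ball.\<close>
  define U' where "U' = U \<inter> ball p 1"
  have U': "open U'" "p \<in> U'" using U by (auto simp: U'_def p_def)
  have nn: "\<alpha> + t \<notin> \<int>\<^sub>\<le>\<^sub>0" if "t \<in> U' - {p}" for t
  proof
    assume "\<alpha> + t \<in> \<int>\<^sub>\<le>\<^sub>0"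
    then obtain j where "\<alpha> + t = - of_nat j" by (elim nonpos_Ints_cases')
    moreover have "t = (\<alpha> + t) - \<alpha>" by simp
    ultimately have t: "t = - \<alpha> - of_nat j" by simp
    have "dist p t < 1" using that by (simp add: U'_def)
    hence "norm (of_int (int j - int k) :: complex) < 1" by (simp add: dist_norm p_def t)
    hence "j = k" by (subst (asm) norm_of_int) linarith
    thus False using that by (simp add: t p_def)
  qed
  have "residue (\<lambda>t. Gamma (\<alpha> + t) * g t) p = (-1) ^ k / fact k * g p"
  proof (rule residue_simple'[OF U'])
    have "(\<lambda>t. Gamma (\<alpha> + t)) holomorphic_on U' - {p}" "g holomorphic_on U' - {p}"
      by (intro holomorphic_intros nn; simp) (rule holomorphic_on_subset[OF g], auto simp: U'_def)
    thus "(\<lambda>t. Gamma (\<alpha> + t) * g t) holomorphic_on U' - {p}" by (rule holomorphic_on_mult)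
    have "((\<lambda>z. Gamma z * (z + of_nat k)) \<longlongrightarrow> (-1) ^ k / fact k) (at (- of_nat k :: complex))"
      by (rule Gamma_residues)
    moreover have "filterlim (\<lambda>t. \<alpha> + t) (at (- of_nat k)) (at p)"
    proof (rule filterlim_atI)
      have "\<alpha> + t \<noteq> - of_nat k" if "t \<noteq> p" for t
      proof
        assume "\<alpha> + t = - of_nat k"
        hence "t = p" unfolding p_def by algebra
        thus False using that by simp
      qed
      thus "\<forall>\<^sub>F t in at p. \<alpha> + t \<noteq> - of_nat k"
        by (intro eventually_mono[OF eventually_neq_at_within[of p]])
    qed (auto intro!: tendsto_eq_intros simp: p_def)
    ultimately have "((\<lambda>t. Gamma (\<alpha> + t) * (\<alpha> + t + of_nat k)) \<longlongrightarrow> (-1) ^ k / fact k) (at p)"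
      by (rule filterlim_compose)
    moreover have "isCont g p" using g U holomorphic_on_imp_continuous_on[OF g] by (auto simp: p_def continuous_on_eq_continuous_at)
    hence "(g \<longlongrightarrow> g p) (at p)" by (simp add: isCont_def)
    ultimately have "((\<lambda>t. Gamma (\<alpha> + t) * (\<alpha> + t + of_nat k) * g t) \<longlongrightarrow> (-1) ^ k / fact k * g p) (at p)"
      by (intro tendsto_mult)
    thus "((\<lambda>t. Gamma (\<alpha> + t) * g t * (t - p)) \<longlongrightarrow> (-1) ^ k / fact k * g p) (at p)"
      by (simp add: p_def algebra_simps)
  qed
  thus ?thesis by (simp add: p_def)
qed

lemma residue_Gamma_minus_times:
  fixes \<beta> :: complex
  assumes U: "open U" "\<beta> + of_nat k \<in> U" and g: "g holomorphic_on U"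
  shows "residue (\<lambda>t. Gamma (\<beta> - t) * g t) (\<beta> + of_nat k) = - ((-1) ^ k / fact k * g (\<beta> + of_nat k))"
proof -
  define p where "p = \<beta> + of_nat k"
  define U' where "U' = U \<inter> ball p 1"
  have U': "open U'" "p \<in> U'" using U by (auto simp: U'_def p_def)
  have nn: "\<beta> - t \<notin> \<int>\<^sub>\<le>\<^sub>0" if "t \<in> U' - {p}" for t
  proof
    assume "\<beta> - t \<in> \<int>\<^sub>\<le>\<^sub>0"
    then obtain j where "\<beta> - t = - of_nat j" by (elim nonpos_Ints_cases')
    hence t: "t = \<beta> + of_nat j" by (simp add: algebra_simps)
    have "dist p t < 1" using that by (simp add: U'_def)
    hence "norm (of_int (int k - int j) :: complex) < 1" by (simp add: dist_norm p_def t)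
    hence "j = k" by (subst (asm) norm_of_int) linarith
    thus False using that by (simp add: t p_def)
  qed
  have "residue (\<lambda>t. Gamma (\<beta> - t) * g t) p = - ((-1) ^ k / fact k * g p)"
  proof (rule residue_simple'[OF U'])
    have "(\<lambda>t. Gamma (\<beta> - t)) holomorphic_on U' - {p}" "g holomorphic_on U' - {p}"
      by (intro holomorphic_intros nn; simp) (rule holomorphic_on_subset[OF g], auto simp: U'_def)
    thus "(\<lambda>t. Gamma (\<beta> - t) * g t) holomorphic_on U' - {p}" by (rule holomorphic_on_mult)
    have "((\<lambda>z. Gamma z * (z + of_nat k)) \<longlongrightarrow> (-1) ^ k / fact k) (at (- of_nat k :: complex))"
      by (rule Gamma_residues)
    moreover have "filterlim (\<lambda>t. \<beta> - t) (at (- of_nat k)) (at p)"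
      by (rule filterlim_atI) (auto intro!: tendsto_eq_intros simp: p_def eventually_at_filter algebra_simps add_eq_0_iff)
    ultimately have "((\<lambda>t. Gamma (\<beta> - t) * (\<beta> - t + of_nat k)) \<longlongrightarrow> (-1) ^ k / fact k) (at p)"
      by (rule filterlim_compose)
    moreover have "isCont g p" using g U holomorphic_on_imp_continuous_on[OF g] by (auto simp: p_def continuous_on_eq_continuous_at)
    hence "(g \<longlongrightarrow> g p) (at p)" by (simp add: isCont_def)
    ultimately have "((\<lambda>t. - (Gamma (\<beta> - t) * (\<beta> - t + of_nat k) * g t)) \<longlongrightarrow> - ((-1) ^ k / fact k * g p)) (at p)"
      by (intro tendsto_mult tendsto_minus)
    thus "((\<lambda>t. Gamma (\<beta> - t) * g t * (t - p)) \<longlongrightarrow> - ((-1) ^ k / fact k * g p)) (at p)"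
      by (simp add: p_def algebra_simps)
  qed
  thus ?thesis by (simp add: p_def)
qed

text \<open>The factor common to the residues at t = -a1 - k. Gamma(a2 - a1 - k) is split by
  reflection: the sine stays here, and 1/Gamma(1 + a1 - a2 + k) becomes one of the denominator
  factors of the 4F3 term.\<close>

definition Barnes_coeff ::
  "complex \<Rightarrow> complex \<Rightarrow> complex \<Rightarrow> complex \<Rightarrow> complex \<Rightarrow> complex \<Rightarrow> complex" where
  "Barnes_coeff a1 a2 b1 b2 c1 c2 =
     of_real pi / sin (of_real pi * (a2 - a1)) * (Gamma (a1 + b1) * Gamma (a1 + b2)) * (rGamma (c1 - a1) * rGamma (c2 - a1))"

lemma pochhammer_minus_shift: "rGamma (z - of_nat k) = rGamma z * ((-1) ^ k * pochhammer (1 - z) k)" for z :: complex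
proof -
  have "rGamma (z - of_nat k) = pochhammer (z - of_nat k) k * rGamma z"
    using pochhammer_rGamma[of "z - of_nat k" k] by simp
  also have "pochhammer (z - of_nat k) k = (-1) ^ k * pochhammer (1 - z) k"
    using pochhammer_minus[of "z - 1" k] by (simp add: algebra_simps)
  finally show ?thesis by (simp add: mult_ac)
qed

lemma Barnes_residue_term:
  fixes a1 a2 b1 b2 c1 c2 d1 d2 :: complex
  assumes a: "a2 - a1 \<notin> \<int>" and ab: "a1 + b1 \<notin> \<int>\<^sub>\<le>\<^sub>0" "a1 + b2 \<notin> \<int>\<^sub>\<le>\<^sub>0"
  shows "(-1) ^ k / fact k * (Gamma (a2 - a1 - of_nat k) * (Gamma (a1 + b1 + of_nat k) * Gamma (a1 + b2 + of_nat k)) *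
      (rGamma (c1 - a1 - of_nat k) * rGamma (c2 - a1 - of_nat k)) * (rGamma (a1 + d1 + of_nat k) * rGamma (a1 + d2 + of_nat k)))
    = Barnes_coeff a1 a2 b1 b2 c1 c2 *
      F43_term (a1 + b1) (a1 + b2) (1 + a1 - c1) (1 + a1 - c2) (1 + a1 - a2) (a1 + d1) (a1 + d2) k"
proof -
  have "a2 - a1 - of_nat k \<notin> \<int>" using a by (metis Ints_add Ints_of_nat diff_add_cancel)
  from Gamma_eq_reflection[OF this]
  have 1: "Gamma (a2 - a1 - of_nat k) = of_real pi / sin (of_real pi * (a2 - a1 - of_nat k)) * rGamma (of_nat k + (1 + a1 - a2))"
    by (simp add: algebra_simps)
  have "sin (of_real pi * (a2 - a1 - of_nat k)) = sin (of_real pi * (a2 - a1)) * (-1) ^ k"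
  proof -
    have "of_real pi * (a2 - a1 - of_nat k) = of_real pi * (a2 - a1) - of_real (real k * pi)"
      by (simp add: algebra_simps)
    moreover have "sin (of_real (real k * pi) :: complex) = 0" "cos (of_real (real k * pi) :: complex) = (-1) ^ k"
      unfolding sin_of_real cos_of_real by (simp_all add: cos_npi)
    ultimately show ?thesis by (simp add: sin_diff)
  qed
  hence 2: "of_real pi / sin (of_real pi * (a2 - a1 - of_nat k)) = of_real pi / sin (of_real pi * (a2 - a1)) * (-1) ^ k"
    by (cases "even k") auto
  have 3: "Gamma (a1 + b1 + of_nat k) = Gamma (a1 + b1) * pochhammer (a1 + b1) k"
    "Gamma (a1 + b2 + of_nat k) = Gamma (a1 + b2) * pochhammer (a1 + b2) k"
    using ab by (simp_all add: pochhammer_Gamma Gamma_eq_zero_iff)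
  have 4: "rGamma (c1 - a1 - of_nat k) = rGamma (c1 - a1) * ((-1) ^ k * pochhammer (1 + a1 - c1) k)"
    "rGamma (c2 - a1 - of_nat k) = rGamma (c2 - a1) * ((-1) ^ k * pochhammer (1 + a1 - c2) k)"
    using pochhammer_minus_shift[of "c1 - a1" k] pochhammer_minus_shift[of "c2 - a1" k] by (simp_all add: algebra_simps)
  \<comment> \<open>Four signs meet: from the residue of Gamma, from the shifted sine, and from each
    of the two factors 1/Gamma(c_i - a1 - k).\<close>
  have 5: "((-1) ^ k * (-1) ^ k * ((-1) ^ k * (-1) ^ k) :: complex) = 1"
    by (cases "even k") auto
  have "(-1) ^ k / fact k * (Gamma (a2 - a1 - of_nat k) * (Gamma (a1 + b1 + of_nat k) * Gamma (a1 + b2 + of_nat k)) *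
      (rGamma (c1 - a1 - of_nat k) * rGamma (c2 - a1 - of_nat k)) * (rGamma (a1 + d1 + of_nat k) * rGamma (a1 + d2 + of_nat k))) =
      ((-1) ^ k * (-1) ^ k * ((-1) ^ k * (-1) ^ k)) * (Barnes_coeff a1 a2 b1 b2 c1 c2 *
      F43_term (a1 + b1) (a1 + b2) (1 + a1 - c1) (1 + a1 - c2) (1 + a1 - a2) (a1 + d1) (a1 + d2) k)"
    unfolding 1 2 3 4 Barnes_coeff_def F43_term_def by (simp add: add_ac mult_ac)
  thus ?thesis unfolding 5 by simp
qed

lemma Barnes_residue_plus:
  fixes a1 a2 b1 b2 c1 c2 d1 d2 :: complex
  assumes a: "a2 - a1 \<notin> \<int>" and ab: "a1 + b1 \<notin> \<int>\<^sub>\<le>\<^sub>0" "a1 + b2 \<notin> \<int>\<^sub>\<le>\<^sub>0"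
  shows "residue (Barnes_integrand a1 a2 b1 b2 c1 c2 d1 d2) (- a1 - of_nat k) = Barnes_coeff a1 a2 b1 b2 c1 c2 *
      F43_term (a1 + b1) (a1 + b2) (1 + a1 - c1) (1 + a1 - c2) (1 + a1 - a2) (a1 + d1) (a1 + d2) k"
proof -
  define g where "g = (\<lambda>t. Gamma (a2 + t) * (Gamma (b1 - t) * Gamma (b2 - t)) *
      (rGamma (c1 + t) * rGamma (c2 + t)) * (rGamma (d1 - t) * rGamma (d2 - t)))"
  define U where "U = - ((\<lambda>t. a2 + t) -` \<int>\<^sub>\<le>\<^sub>0 \<union> ((\<lambda>t. b1 - t) -` \<int>\<^sub>\<le>\<^sub>0 \<union> (\<lambda>t. b2 - t) -` \<int>\<^sub>\<le>\<^sub>0))"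
  have "open U" unfolding U_def
    by (intro open_Compl closed_Un closed_vimage continuous_intros) auto
  moreover have "- a1 - of_nat k \<in> U"
  proof -
    have "a2 + (- a1 - of_nat k) \<notin> \<int>\<^sub>\<le>\<^sub>0"
    proof
      assume "a2 + (- a1 - of_nat k) \<in> \<int>\<^sub>\<le>\<^sub>0"
      hence "a2 + (- a1 - of_nat k) \<in> \<int>" using nonpos_Ints_subset_Ints by blast
      hence "(a2 + (- a1 - of_nat k)) + of_nat k \<in> \<int>" by (rule Ints_add) simp
      thus False using a by (simp add: algebra_simps)
    qed
    moreover have "b - (- a1 - of_nat k) \<notin> \<int>\<^sub>\<le>\<^sub>0" if b: "a1 + b \<notin> \<int>\<^sub>\<le>\<^sub>0" for b
    proof
      assume "b - (- a1 - of_nat k) \<in> \<int>\<^sub>\<le>\<^sub>0"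
      then obtain j where "b - (- a1 - of_nat k) = - of_nat j" by (elim nonpos_Ints_cases')
      hence "a1 + b = - of_nat (j + k)" by (simp add: algebra_simps)
      thus False using b by (metis minus_of_nat_in_nonpos_Ints)
    qed
    ultimately show ?thesis using ab by (simp add: U_def)
  qed
  moreover have "g holomorphic_on U" unfolding g_def U_def by (intro holomorphic_intros) auto
  ultimately have "residue (\<lambda>t. Gamma (a1 + t) * g t) (- a1 - of_nat k) = (-1) ^ k / fact k * g (- a1 - of_nat k)"
    by (rule residue_Gamma_plus_times)
  also have "(\<lambda>t. Gamma (a1 + t) * g t) = Barnes_integrand a1 a2 b1 b2 c1 c2 d1 d2"
    by (simp add: g_def Barnes_integrand_def fun_eq_iff mult_ac)
  finally show ?thesis
    unfolding Barnes_residue_term[OF assms, symmetric] by (simp add: g_def algebra_simps)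
qed

text \<open>The variable enters as b1 - t, which reverses the sign of the residue; this is why the
  b-series stand on the other side of \<open>Barnes_residue_relation\<close>.\<close>

lemma Barnes_residue_minus:
  fixes a1 a2 b1 b2 c1 c2 d1 d2 :: complex
  assumes b: "b2 - b1 \<notin> \<int>" and ab: "b1 + a1 \<notin> \<int>\<^sub>\<le>\<^sub>0" "b1 + a2 \<notin> \<int>\<^sub>\<le>\<^sub>0"
  shows "residue (Barnes_integrand a1 a2 b1 b2 c1 c2 d1 d2) (b1 + of_nat k) = - (Barnes_coeff b1 b2 a1 a2 d1 d2 *
      F43_term (b1 + a1) (b1 + a2) (1 + b1 - d1) (1 + b1 - d2) (1 + b1 - b2) (b1 + c1) (b1 + c2) k)"
proof -
  define g where "g = (\<lambda>t. Gamma (b2 - t) * (Gamma (a1 + t) * Gamma (a2 + t)) *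
      (rGamma (d1 - t) * rGamma (d2 - t)) * (rGamma (c1 + t) * rGamma (c2 + t)))"
  define U where "U = - ((\<lambda>t. b2 - t) -` \<int>\<^sub>\<le>\<^sub>0 \<union> ((\<lambda>t. a1 + t) -` \<int>\<^sub>\<le>\<^sub>0 \<union> (\<lambda>t. a2 + t) -` \<int>\<^sub>\<le>\<^sub>0))"
  have "open U" unfolding U_def
    by (intro open_Compl closed_Un closed_vimage continuous_intros) auto
  moreover have "b1 + of_nat k \<in> U"
  proof -
    have "b2 - (b1 + of_nat k) \<notin> \<int>\<^sub>\<le>\<^sub>0"
    proof
      assume "b2 - (b1 + of_nat k) \<in> \<int>\<^sub>\<le>\<^sub>0"
      hence "b2 - (b1 + of_nat k) \<in> \<int>" using nonpos_Ints_subset_Ints by blast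
      hence "(b2 - (b1 + of_nat k)) + of_nat k \<in> \<int>" by (rule Ints_add) simp
      thus False using b by (simp add: algebra_simps)
    qed
    moreover have "a + (b1 + of_nat k) \<notin> \<int>\<^sub>\<le>\<^sub>0" if a: "b1 + a \<notin> \<int>\<^sub>\<le>\<^sub>0" for a
    proof
      assume "a + (b1 + of_nat k) \<in> \<int>\<^sub>\<le>\<^sub>0"
      then obtain j where "a + (b1 + of_nat k) = - of_nat j" by (elim nonpos_Ints_cases')
      hence "b1 + a = - of_nat (j + k)" by (simp add: algebra_simps add_eq_0_iff)
      thus False using a by (metis minus_of_nat_in_nonpos_Ints)
    qed
    ultimately show ?thesis using ab by (simp add: U_def)
  qed
  moreover have "g holomorphic_on U" unfolding g_def U_def by (intro holomorphic_intros) auto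
  ultimately have "residue (\<lambda>t. Gamma (b1 - t) * g t) (b1 + of_nat k) = - ((-1) ^ k / fact k * g (b1 + of_nat k))"
    by (rule residue_Gamma_minus_times)
  also have "(\<lambda>t. Gamma (b1 - t) * g t) = Barnes_integrand a1 a2 b1 b2 c1 c2 d1 d2"
    by (simp add: g_def Barnes_integrand_def fun_eq_iff mult_ac)
  finally show ?thesis
    unfolding Barnes_residue_term[OF assms, symmetric] by (simp add: g_def algebra_simps)
qed

lemma Barnes_integrand_swap_a: "Barnes_integrand a1 a2 b1 b2 c1 c2 d1 d2 = Barnes_integrand a2 a1 b1 b2 c1 c2 d1 d2"
  by (simp add: Barnes_integrand_def fun_eq_iff mult_ac)

lemma Barnes_integrand_swap_b: "Barnes_integrand a1 a2 b1 b2 c1 c2 d1 d2 = Barnes_integrand a1 a2 b2 b1 c1 c2 d1 d2"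
  by (simp add: Barnes_integrand_def fun_eq_iff mult_ac)

lemma convergent_box_sum:
  fixes f :: "complex \<Rightarrow> complex"
  assumes f: "(f has_sum T) P"
    and fin: "\<And>n. finite (P \<inter> B n)"
    and ev: "\<And>p. p \<in> P \<Longrightarrow> eventually (\<lambda>n. p \<in> B n) sequentially"
  shows "(\<lambda>n. sum f (P \<inter> B n)) \<longlonglongrightarrow> T"
proof -
  have "filterlim (\<lambda>n. P \<inter> B n) (finite_subsets_at_top P) sequentially"
    unfolding filterlim_iff eventually_finite_subsets_at_top
  proof (intro allI impI)
    fix Q assume "\<exists>X. finite X \<and> X \<subseteq> P \<and> (\<forall>Y. finite Y \<and> X \<subseteq> Y \<and> Y \<subseteq> P \<longrightarrow> Q Y)"
    then obtain X where "finite X \<and> X \<subseteq> P \<and> (\<forall>Y. finite Y \<and> X \<subseteq> Y \<and> Y \<subseteq> P \<longrightarrow> Q Y)" ..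
    hence X: "finite X" "X \<subseteq> P" "\<And>Y. finite Y \<Longrightarrow> X \<subseteq> Y \<Longrightarrow> Y \<subseteq> P \<Longrightarrow> Q Y" by simp_all
    have "eventually (\<lambda>n. \<forall>p\<in>X. p \<in> B n) sequentially"
      using X(1,2) ev by (intro eventually_ball_finite) auto
    thus "eventually (\<lambda>n. Q (P \<inter> B n)) sequentially"
    proof eventually_elim
      case (elim n)
      have "X \<subseteq> P \<inter> B n" using elim X(2) by blast
      thus ?case by (intro X(3) fin) auto
    qed
  qed
  with f show ?thesis unfolding has_sum_def by (rule filterlim_compose)
qed

text \<open>The values of the offset to be avoided form a countable set, since they are determined
  by an integer and an element of Z; finiteness of Z then gives one margin for all its elements.
  Both signs are required because the vertical sides of the contours lie at Re t = n + \<delta> and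
  at Re t = -(n + \<delta>).\<close>

lemma generic_offset:
  fixes Z :: "complex set"
  assumes Z: "finite Z"
  obtains \<delta> \<eta> :: real where "0 < \<delta>" "\<delta> < 1" "0 < \<eta>" "\<eta> \<le> 2"
    "\<And>z. z \<in> Z \<Longrightarrow> cos (2 * pi * (Re z + \<delta>)) \<le> 1 - \<eta> \<and> cos (2 * pi * (Re z - \<delta>)) \<le> 1 - \<eta>"
proof -
  define Bad where "Bad = (\<Union>z\<in>Z. range (\<lambda>n. real_of_int n - Re z) \<union> range (\<lambda>n. Re z - real_of_int n))"
  have "countable Bad" unfolding Bad_def using countable_finite[OF Z] by (intro countable_UN countable_Un countable_image) auto
  moreover have "uncountable {0<..<(1::real)}" by (rule uncountable_open_interval[THEN iffD2]) simp
  ultimately have "\<not> {0<..<(1::real)} \<subseteq> Bad" using countable_subset by blast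
  then obtain \<delta> where "\<delta> \<in> {0<..<1}" "\<delta> \<notin> Bad" by blast
  hence \<delta>: "0 < \<delta>" "\<delta> < 1" "\<delta> \<notin> Bad" by simp_all
  have lt1: "cos (2 * pi * x) < 1" if "\<And>n. x \<noteq> real_of_int n" for x
  proof -
    have "cos (2 * pi * x) \<noteq> 1"
    proof
      assume "cos (2 * pi * x) = 1"
      then obtain n :: int where "2 * pi * x = real_of_int n * 2 * pi" unfolding cos_one_2pi_int by blast
      hence "x = real_of_int n" by simp
      thus False using that by blast
    qed
    thus ?thesis using cos_le_one[of "2 * pi * x"] by linarith
  qed
  have c: "cos (2 * pi * (Re z + \<delta>)) < 1" "cos (2 * pi * (Re z - \<delta>)) < 1" if z: "z \<in> Z" for z
  proof -
    have "Re z + \<delta> \<noteq> real_of_int n" for n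
    proof
      assume "Re z + \<delta> = real_of_int n"
      hence "\<delta> = real_of_int n - Re z" by simp
      thus False using \<delta>(3) z unfolding Bad_def by blast
    qed
    thus "cos (2 * pi * (Re z + \<delta>)) < 1" by (rule lt1)
    have "Re z - \<delta> \<noteq> real_of_int n" for n
    proof
      assume "Re z - \<delta> = real_of_int n"
      hence "\<delta> = Re z - real_of_int n" by simp
      thus False using \<delta>(3) z unfolding Bad_def by blast
    qed
    thus "cos (2 * pi * (Re z - \<delta>)) < 1" by (rule lt1)
  qed
  define X where "X = insert 2 ((\<lambda>z. 1 - cos (2 * pi * (Re z + \<delta>))) ` Z \<union> (\<lambda>z. 1 - cos (2 * pi * (Re z - \<delta>))) ` Z)"
  have X: "finite X" "X \<noteq> {}" using Z by (auto simp: X_def)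
  show ?thesis
  proof (rule that[OF \<delta>(1,2)])
    show "0 < Min X" using X c by (subst Min_gr_iff) (auto simp: X_def)
    show "Min X \<le> 2" using X by (intro Min_le) (auto simp: X_def)
    fix z assume z: "z \<in> Z"
    have "Min X \<le> 1 - cos (2 * pi * (Re z + \<delta>))" "Min X \<le> 1 - cos (2 * pi * (Re z - \<delta>))"
      using z X by (auto intro!: Min_le simp: X_def)
    thus "cos (2 * pi * (Re z + \<delta>)) \<le> 1 - Min X \<and> cos (2 * pi * (Re z - \<delta>)) \<le> 1 - Min X" by simp
  qed
qed

text \<open>Integration over squares with corners (n + \<delta>)(1 + i) and its negative. The
  integrand is O(|t|^(-s)) on them, whereas the perimeter is 8(n + \<delta>), so s > 1 makes the
  integrals tend to 0. The integrality conditions keep all poles simple and the four families of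
  poles disjoint.\<close>

theorem Barnes_residue_relation:
  fixes a1 a2 b1 b2 c1 c2 d1 d2 :: complex
  assumes a: "a1 - a2 \<notin> \<int>" and b: "b1 - b2 \<notin> \<int>"
    and ab: "a1 + b1 \<notin> \<int>" "a1 + b2 \<notin> \<int>" "a2 + b1 \<notin> \<int>" "a2 + b2 \<notin> \<int>"
    and s: "Re (c1 + c2 + d1 + d2 - a1 - a2 - b1 - b2) > 1"
  shows "Barnes_coeff a1 a2 b1 b2 c1 c2 *
           F43_reg (a1 + b1) (a1 + b2) (1 + a1 - c1) (1 + a1 - c2) (1 + a1 - a2) (a1 + d1) (a1 + d2) +
         Barnes_coeff a2 a1 b1 b2 c1 c2 *
           F43_reg (a2 + b1) (a2 + b2) (1 + a2 - c1) (1 + a2 - c2) (1 + a2 - a1) (a2 + d1) (a2 + d2) =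
         Barnes_coeff b1 b2 a1 a2 d1 d2 *
           F43_reg (b1 + a1) (b1 + a2) (1 + b1 - d1) (1 + b1 - d2) (1 + b1 - b2) (b1 + c1) (b1 + c2) +
         Barnes_coeff b2 b1 a1 a2 d1 d2 *
           F43_reg (b2 + a1) (b2 + a2) (1 + b2 - d1) (1 + b2 - d2) (1 + b2 - b1) (b2 + c1) (b2 + c2)"
    (is "?A1 + ?A2 = ?B1 + ?B2")
proof -
  define f where "f = Barnes_integrand a1 a2 b1 b2 c1 c2 d1 d2"
  define PA where "PA = (\<lambda>\<alpha>::complex. range (\<lambda>k. - \<alpha> - of_nat k))"
  define PB where "PB = (\<lambda>\<beta>::complex. range (\<lambda>k. \<beta> + of_nat k))"
  define P where "P = (PA a1 \<union> PA a2) \<union> (PB b1 \<union> PB b2)"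
  have a': "a2 - a1 \<notin> \<int>" "b2 - b1 \<notin> \<int>" using a b by (metis Ints_minus minus_diff_eq)+
  have ab': "a1 + b1 \<notin> \<int>\<^sub>\<le>\<^sub>0" "a1 + b2 \<notin> \<int>\<^sub>\<le>\<^sub>0" "a2 + b1 \<notin> \<int>\<^sub>\<le>\<^sub>0" "a2 + b2 \<notin> \<int>\<^sub>\<le>\<^sub>0"
     "b1 + a1 \<notin> \<int>\<^sub>\<le>\<^sub>0" "b2 + a1 \<notin> \<int>\<^sub>\<le>\<^sub>0" "b1 + a2 \<notin> \<int>\<^sub>\<le>\<^sub>0" "b2 + a2 \<notin> \<int>\<^sub>\<le>\<^sub>0"
    using ab nonpos_Ints_subset_Ints by (auto simp: add.commute)
  have sumsA: "((residue f) has_sum (Barnes_coeff \<alpha> \<alpha>' b1 b2 c1 c2 *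
           F43_reg (\<alpha> + b1) (\<alpha> + b2) (1 + \<alpha> - c1) (1 + \<alpha> - c2) (1 + \<alpha> - \<alpha>') (\<alpha> + d1) (\<alpha> + d2))) (PA \<alpha>)"
    if f: "f = Barnes_integrand \<alpha> \<alpha>' b1 b2 c1 c2 d1 d2"
      and *: "\<alpha>' - \<alpha> \<notin> \<int>" "\<alpha> + b1 \<notin> \<int>\<^sub>\<le>\<^sub>0" "\<alpha> + b2 \<notin> \<int>\<^sub>\<le>\<^sub>0" "\<alpha> + \<alpha>' = a1 + a2" for \<alpha> \<alpha>'
  proof -
    \<comment> \<open>The parametric excess of each of the four series is s - 1; the condition s > 1
      thus provides convergence of the series as well as decay of the integrals.\<close>
    have re: "Re ((1 + \<alpha> - \<alpha>') + (\<alpha> + d1) + (\<alpha> + d2) - (\<alpha> + b1) - (\<alpha> + b2) - (1 + \<alpha> - c1) - (1 + \<alpha> - c2)) > 0"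
      using s arg_cong[OF *(4), of Re] by simp
    have "((\<lambda>k. Barnes_coeff \<alpha> \<alpha>' b1 b2 c1 c2 * F43_term (\<alpha> + b1) (\<alpha> + b2) (1 + \<alpha> - c1) (1 + \<alpha> - c2) (1 + \<alpha> - \<alpha>') (\<alpha> + d1) (\<alpha> + d2) k)
       has_sum (Barnes_coeff \<alpha> \<alpha>' b1 b2 c1 c2 * F43_reg (\<alpha> + b1) (\<alpha> + b2) (1 + \<alpha> - c1) (1 + \<alpha> - c2) (1 + \<alpha> - \<alpha>') (\<alpha> + d1) (\<alpha> + d2))) UNIV"
      by (rule has_sum_cmult_right[OF norm_summable_imp_has_sum[OF summable_F43_term[OF re] sums_F43_term[OF re]]])
    also have "(\<lambda>k. Barnes_coeff \<alpha> \<alpha>' b1 b2 c1 c2 * F43_term (\<alpha> + b1) (\<alpha> + b2) (1 + \<alpha> - c1) (1 + \<alpha> - c2) (1 + \<alpha> - \<alpha>') (\<alpha> + d1) (\<alpha> + d2) k)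
       = residue f \<circ> (\<lambda>k. - \<alpha> - of_nat k)"
      unfolding f by (simp add: fun_eq_iff Barnes_residue_plus[OF *(1-3)])
    finally show ?thesis unfolding PA_def by (subst has_sum_reindex) (auto simp: inj_on_def o_def)
  qed
  have sumsB: "((residue f) has_sum (- (Barnes_coeff \<beta> \<beta>' a1 a2 d1 d2 *
           F43_reg (\<beta> + a1) (\<beta> + a2) (1 + \<beta> - d1) (1 + \<beta> - d2) (1 + \<beta> - \<beta>') (\<beta> + c1) (\<beta> + c2)))) (PB \<beta>)"
    if f: "f = Barnes_integrand a1 a2 \<beta> \<beta>' c1 c2 d1 d2"
      and *: "\<beta>' - \<beta> \<notin> \<int>" "\<beta> + a1 \<notin> \<int>\<^sub>\<le>\<^sub>0" "\<beta> + a2 \<notin> \<int>\<^sub>\<le>\<^sub>0" "\<beta> + \<beta>' = b1 + b2" for \<beta> \<beta>'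
  proof -
    have re: "Re ((1 + \<beta> - \<beta>') + (\<beta> + c1) + (\<beta> + c2) - (\<beta> + a1) - (\<beta> + a2) - (1 + \<beta> - d1) - (1 + \<beta> - d2)) > 0"
      using s arg_cong[OF *(4), of Re] by simp
    have "((\<lambda>k. Barnes_coeff \<beta> \<beta>' a1 a2 d1 d2 * F43_term (\<beta> + a1) (\<beta> + a2) (1 + \<beta> - d1) (1 + \<beta> - d2) (1 + \<beta> - \<beta>') (\<beta> + c1) (\<beta> + c2) k)
       has_sum (Barnes_coeff \<beta> \<beta>' a1 a2 d1 d2 * F43_reg (\<beta> + a1) (\<beta> + a2) (1 + \<beta> - d1) (1 + \<beta> - d2) (1 + \<beta> - \<beta>') (\<beta> + c1) (\<beta> + c2))) UNIV"
      by (rule has_sum_cmult_right[OF norm_summable_imp_has_sum[OF summable_F43_term[OF re] sums_F43_term[OF re]]])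
    hence "((\<lambda>k. - (Barnes_coeff \<beta> \<beta>' a1 a2 d1 d2 * F43_term (\<beta> + a1) (\<beta> + a2) (1 + \<beta> - d1) (1 + \<beta> - d2) (1 + \<beta> - \<beta>') (\<beta> + c1) (\<beta> + c2) k))
       has_sum (- (Barnes_coeff \<beta> \<beta>' a1 a2 d1 d2 * F43_reg (\<beta> + a1) (\<beta> + a2) (1 + \<beta> - d1) (1 + \<beta> - d2) (1 + \<beta> - \<beta>') (\<beta> + c1) (\<beta> + c2)))) UNIV"
      by (simp add: has_sum_uminus)
    also have "(\<lambda>k. - (Barnes_coeff \<beta> \<beta>' a1 a2 d1 d2 * F43_term (\<beta> + a1) (\<beta> + a2) (1 + \<beta> - d1) (1 + \<beta> - d2) (1 + \<beta> - \<beta>') (\<beta> + c1) (\<beta> + c2) k))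
       = residue f \<circ> (\<lambda>k. \<beta> + of_nat k)"
      unfolding f by (simp add: fun_eq_iff Barnes_residue_minus[OF *(1-3)])
    finally show ?thesis unfolding PB_def by (subst has_sum_reindex) (auto simp: inj_on_def o_def)
  qed
  have disjA: "PA a1 \<inter> PA a2 = {}"
  proof -
    have False if "- a1 - of_nat j = - a2 - of_nat k" for j k
    proof -
      have "a1 - a2 = of_int (int k - int j)" using that by (simp add: algebra_simps add_eq_0_iff)
      thus False using a by (metis Ints_of_int)
    qed
    thus ?thesis unfolding PA_def by blast
  qed
  have disjB: "PB b1 \<inter> PB b2 = {}"
  proof -
    have False if "b1 + of_nat j = b2 + of_nat k" for j k
    proof -
      have "b1 - b2 = of_int (int k - int j)" using that by (simp add: algebra_simps)
      thus False using b by (metis Ints_of_int)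
    qed
    thus ?thesis unfolding PB_def by blast
  qed
  have disjAB: "PA \<alpha> \<inter> PB \<beta> = {}" if "\<alpha> + \<beta> \<notin> \<int>" for \<alpha> \<beta>
  proof -
    have False if "- \<alpha> - of_nat j = \<beta> + of_nat k" for j k
    proof -
      have "\<alpha> + \<beta> = - of_nat k - of_nat j" using that by algebra
      hence "\<alpha> + \<beta> = of_int (- int k - int j)" by simp
      thus False using \<open>\<alpha> + \<beta> \<notin> \<int>\<close> by (metis Ints_of_int)
    qed
    thus ?thesis unfolding PA_def PB_def by blast
  qed
  have total: "(residue f has_sum (?A1 + ?A2 + (- ?B1 + - ?B2))) P"
    unfolding P_def
  proof (intro has_sum_Un_disjoint sumsA sumsB disjA disjB ab' a')
    show "f = Barnes_integrand a1 a2 b1 b2 c1 c2 d1 d2" "f = Barnes_integrand a1 a2 b1 b2 c1 c2 d1 d2" by (fact f_def)+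
    show "f = Barnes_integrand a2 a1 b1 b2 c1 c2 d1 d2" unfolding f_def by (rule Barnes_integrand_swap_a)
    show "f = Barnes_integrand a1 a2 b2 b1 c1 c2 d1 d2" unfolding f_def by (rule Barnes_integrand_swap_b)
    show "(PA a1 \<union> PA a2) \<inter> (PB b1 \<union> PB b2) = {}" using ab by (auto dest: disjAB)
  qed (use a b in \<open>simp_all add: add.commute\<close>)
  define Z where "Z = {a1, a2, - b1, - b2}"
  obtain \<delta> \<eta> :: real where \<delta>: "0 < \<delta>" "\<delta> < 1" and \<eta>: "0 < \<eta>" "\<eta> \<le> 2"
    and cosZ: "\<And>z. z \<in> Z \<Longrightarrow> cos (2 * pi * (Re z + \<delta>)) \<le> 1 - \<eta> \<and> cos (2 * pi * (Re z - \<delta>)) \<le> 1 - \<eta>"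
    using generic_offset[of Z] by (auto simp: Z_def)
  define r where "r = (\<lambda>n. real n + \<delta>)"
  define q where "q = (\<lambda>n. Complex (r n) (r n))"
  define B where "B = (\<lambda>n. box (- q n) (q n))"
  define W where "W = {t. a1 + t \<notin> \<int>\<^sub>\<le>\<^sub>0 \<and> a2 + t \<notin> \<int>\<^sub>\<le>\<^sub>0 \<and> b1 - t \<notin> \<int>\<^sub>\<le>\<^sub>0 \<and> b2 - t \<notin> \<int>\<^sub>\<le>\<^sub>0}"
  have holo: "f holomorphic_on W"
    unfolding f_def W_def Barnes_integrand_def [abs_def] by (intro holomorphic_intros) auto
  have PW: "- P \<subseteq> W"
  proof -
    have pA: "t \<in> PA \<alpha>" if "\<alpha> + t \<in> \<int>\<^sub>\<le>\<^sub>0" for \<alpha> t :: complex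
    proof -
      obtain k where "\<alpha> + t = - of_nat k" using \<open>\<alpha> + t \<in> \<int>\<^sub>\<le>\<^sub>0\<close> by (elim nonpos_Ints_cases')
      hence "t = - \<alpha> - of_nat k" by algebra
      thus ?thesis by (simp add: PA_def)
    qed
    have pB: "t \<in> PB \<beta>" if "\<beta> - t \<in> \<int>\<^sub>\<le>\<^sub>0" for \<beta> t :: complex
    proof -
      obtain k where "\<beta> - t = - of_nat k" using \<open>\<beta> - t \<in> \<int>\<^sub>\<le>\<^sub>0\<close> by (elim nonpos_Ints_cases')
      hence "t = \<beta> + of_nat k" by algebra
      thus ?thesis by (simp add: PB_def)
    qed
    show ?thesis
    proof
      fix t assume "t \<in> - P"
      hence "t \<notin> PA a1" "t \<notin> PA a2" "t \<notin> PB b1" "t \<notin> PB b2" by (simp_all add: P_def)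
      thus "t \<in> W" using pA pB unfolding W_def by fast
    qed
  qed
  have finA: "finite (PA \<alpha> \<inter> box (Complex u v) w)" for \<alpha> u v w
  proof (rule finite_subset)
    show "PA \<alpha> \<inter> box (Complex u v) w \<subseteq> (\<lambda>k. - \<alpha> - of_nat k) ` {..nat \<lceil>- u - Re \<alpha>\<rceil>}"
    proof
      fix x assume x: "x \<in> PA \<alpha> \<inter> box (Complex u v) w"
      then obtain k where k: "x = - \<alpha> - of_nat k" by (auto simp: PA_def)
      have "real k \<le> - u - Re \<alpha>" using x by (simp add: k in_box_complex_iff)
      hence "k \<le> nat \<lceil>- u - Re \<alpha>\<rceil>" by linarith
      thus "x \<in> (\<lambda>k. - \<alpha> - of_nat k) ` {..nat \<lceil>- u - Re \<alpha>\<rceil>}" unfolding k by blast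
    qed
  qed auto
  have finB: "finite (PB \<beta> \<inter> box w (Complex u v))" for \<beta> u v w
  proof (rule finite_subset)
    show "PB \<beta> \<inter> box w (Complex u v) \<subseteq> (\<lambda>k. \<beta> + of_nat k) ` {..nat \<lceil>u - Re \<beta>\<rceil>}"
    proof
      fix x assume x: "x \<in> PB \<beta> \<inter> box w (Complex u v)"
      then obtain k where k: "x = \<beta> + of_nat k" by (auto simp: PB_def)
      have "real k \<le> u - Re \<beta>" using x by (simp add: k in_box_complex_iff)
      hence "k \<le> nat \<lceil>u - Re \<beta>\<rceil>" by linarith
      thus "x \<in> (\<lambda>k. \<beta> + of_nat k) ` {..nat \<lceil>u - Re \<beta>\<rceil>}" unfolding k by blast
    qed
  qed auto
  have fin: "finite (P \<inter> box (Complex u v) (Complex u' v'))" for u v u' v'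
    unfolding P_def Int_Un_distrib2 by (intro finite_UnI finA finB)
  have finPB: "finite (P \<inter> B n)" for n
  proof -
    have "- q n = Complex (- r n) (- r n)" by (simp add: q_def complex_eq_iff)
    thus ?thesis using fin[of "- r n" "- r n" "r n" "r n"] unfolding B_def by (simp only: q_def)
  qed
  \<comment> \<open>A box cuts the four families of poles at unrelated indices, so the convergence
    of its residue sums is drawn from unconditional summability, not from the order of the
    series.\<close>
  have lim1: "(\<lambda>n. sum (residue f) (P \<inter> B n)) \<longlonglongrightarrow> ?A1 + ?A2 + (- ?B1 + - ?B2)"
  proof (rule convergent_box_sum[OF total finPB])
    fix p
    show "eventually (\<lambda>n. p \<in> B n) sequentially"
      using eventually_ge_at_top[of "nat \<lceil>norm p\<rceil>"]
    proof eventually_elim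
      case (elim n)
      have "norm p \<le> real n" using elim by linarith
      moreover have "\<bar>Re p\<bar> \<le> norm p" "\<bar>Im p\<bar> \<le> norm p" by (rule abs_Re_le_cmod abs_Im_le_cmod)+
      ultimately show ?case using \<delta> by (auto simp: B_def q_def r_def in_box_complex_iff)
    qed
  qed
  obtain C R where CR: "C > 0" "R > 0"
    "\<And>t. norm t \<ge> R \<Longrightarrow> sin_away \<eta> (a1 + t) \<Longrightarrow> sin_away \<eta> (a2 + t) \<Longrightarrow> sin_away \<eta> (b1 - t) \<Longrightarrow> sin_away \<eta> (b2 - t) \<Longrightarrow>
       norm (f t) \<le> C * norm t powr (- Re (c1 + c2 + d1 + d2 - a1 - a2 - b1 - b2))"
    using Barnes_integrand_bound[OF \<eta>, of a1 a2 b1 b2 c1 c2 d1 d2] unfolding f_def by metis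
  define s where "s = Re (c1 + c2 + d1 + d2 - a1 - a2 - b1 - b2)"
  have s1: "s > 1" using s by (simp add: s_def)
  \<comment> \<open>For n >= M the horizontal sides are so far out that |Im(z + t)| >= 1 for every z
    in Z; only the vertical sides then depend on the offset.\<close>
  define M where "M = norm a1 + norm a2 + norm b1 + norm b2 + 1"
  have path: "path_image (rectpath (- q n) (q n)) = {t. (\<bar>Re t\<bar> = r n \<and> \<bar>Im t\<bar> \<le> r n) \<or> (\<bar>Im t\<bar> = r n \<and> \<bar>Re t\<bar> \<le> r n)}" for n
  proof -
    have rn: "r n > 0" using \<delta> by (simp add: r_def)
    hence pth: "path_image (rectpath (- q n) (q n)) = cbox (- q n) (q n) - box (- q n) (q n)"
      by (intro path_image_rectpath_cbox_minus_box) (simp_all add: q_def)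
    have "(((- w \<le> x \<and> x \<le> w) \<and> - w \<le> y \<and> y \<le> w) \<and> \<not> ((- w < x \<and> x < w) \<and> - w < y \<and> y < w)) \<longleftrightarrow>
      (\<bar>x\<bar> = w \<and> \<bar>y\<bar> \<le> w) \<or> (\<bar>y\<bar> = w \<and> \<bar>x\<bar> \<le> w)" if "w > 0" for x y w :: real
      using that by (smt (verit))
    from this[OF rn] show ?thesis unfolding pth
      by (simp add: set_eq_iff in_box_complex_iff in_cbox_complex_iff q_def)
  qed
  have away: "sin_away \<eta> (z + t)" if z: "z \<in> Z" and t: "t \<in> path_image (rectpath (- q n) (q n))" and n: "real n \<ge> M" for z t n
  proof (cases "\<bar>Im t\<bar> = r n")
    case True
    have "norm z \<le> norm a1 + norm a2 + norm b1 + norm b2" using z by (auto simp: Z_def)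
    hence "\<bar>Im z\<bar> + 1 \<le> M" using abs_Im_le_cmod[of z] by (simp add: M_def)
    thus ?thesis using True n \<delta> by (auto simp: sin_away_def r_def)
  next
    case False
    hence "\<bar>Re t\<bar> = r n" using t by (auto simp: path)
    have per: "cos (real n * (2 * pi)) = 1" "sin (real n * (2 * pi)) = 0"
      using cos_2npi[of n] sin_2npi[of n] by (simp_all add: mult_ac)
    have "Re t = real n + \<delta> \<or> Re t = - \<delta> - real n" using \<open>\<bar>Re t\<bar> = r n\<close> by (auto simp: r_def)
    thus ?thesis
    proof
      assume *: "Re t = real n + \<delta>"
      have "cos (2 * pi * Re (z + t)) = cos (2 * pi * (Re z + \<delta>) + 2 * pi * real n)"
        by (simp add: * algebra_simps)
      also have "\<dots> = cos (2 * pi * (Re z + \<delta>))" by (simp add: cos_add mult.commute[of _ "real n"] per)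
      finally show ?thesis using cosZ[OF z] by (simp add: sin_away_def)
    next
      assume *: "Re t = - \<delta> - real n"
      have "cos (2 * pi * Re (z + t)) = cos (2 * pi * (Re z - \<delta>) - 2 * pi * real n)"
        by (simp add: * algebra_simps)
      also have "\<dots> = cos (2 * pi * (Re z - \<delta>))" by (simp add: cos_diff mult.commute[of _ "real n"] per)
      finally show ?thesis using cosZ[OF z] by (simp add: sin_away_def)
    qed
  qed
  have away': "sin_away \<eta> (a1 + t) \<and> sin_away \<eta> (a2 + t) \<and> sin_away \<eta> (b1 - t) \<and> sin_away \<eta> (b2 - t)"
    if t: "t \<in> path_image (rectpath (- q n) (q n))" "real n \<ge> M" for t n
  proof -
    have "sin_away \<eta> (b - t) = sin_away \<eta> (- b + t)" for b
    proof -
      have "cos (2 * pi * (Re b - Re t)) = cos (- (2 * pi * (Re b - Re t)))" by (rule cos_minus[symmetric])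
      also have "- (2 * pi * (Re b - Re t)) = 2 * pi * (- Re b + Re t)" by (simp add: algebra_simps)
      finally show ?thesis by (simp add: sin_away_def abs_minus_commute)
    qed
    thus ?thesis using away[OF _ t, of a1] away[OF _ t, of a2] away[OF _ t, of "- b1"] away[OF _ t, of "- b2"]
      by (auto simp: Z_def)
  qed
  have pathW: "path_image (rectpath (- q n) (q n)) \<subseteq> W" and pathP: "path_image (rectpath (- q n) (q n)) \<inter> P = {}" if n: "real n \<ge> M" for n
  proof -
    have nI: "a1 + t \<notin> \<int> \<and> a2 + t \<notin> \<int> \<and> b1 - t \<notin> \<int> \<and> b2 - t \<notin> \<int>" if "t \<in> path_image (rectpath (- q n) (q n))" for t
      using away'[OF that n] sin_away_not_Int \<eta>(1) by blast
    thus "path_image (rectpath (- q n) (q n)) \<subseteq> W" using nonpos_Ints_subset_Ints unfolding W_def by blast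
    have "t \<notin> P" if t: "t \<in> path_image (rectpath (- q n) (q n))" for t
    proof
      assume "t \<in> P"
      then consider k where "t = - a1 - of_nat k" | k where "t = - a2 - of_nat k" | k where "t = b1 + of_nat k" | k where "t = b2 + of_nat k"
        unfolding P_def PA_def PB_def by blast
      thus False using nI[OF t] by cases auto
    qed
    thus "path_image (rectpath (- q n) (q n)) \<inter> P = {}" by blast
  qed
  have residues: "contour_integral (rectpath (- q n) (q n)) f = 2 * pi * \<i> * sum (residue f) (P \<inter> B n)" if n: "real n \<ge> M" for n
  proof -
    have rn: "r n > 0" using \<delta> by (simp add: r_def)
    \<comment> \<open>A slightly larger open box: it contains the closed square and still only
      finitely many poles. Those between the square and its boundary have winding number 0.\<close>
    define U where "U = box (Complex (- r n - 1) (- r n - 1)) (Complex (r n + 1) (r n + 1))"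
    have cU: "cbox (- q n) (q n) \<subseteq> U" by (auto simp: U_def q_def in_box_complex_iff in_cbox_complex_iff)
    have pc: "path_image (rectpath (- q n) (q n)) \<subseteq> cbox (- q n) (q n)"
      using rn by (intro path_image_rectpath_subset_cbox) (auto simp: q_def)
    have "contour_integral (rectpath (- q n) (q n)) f =
       2 * pi * \<i> * (\<Sum>p\<in>P \<inter> U. winding_number (rectpath (- q n) (q n)) p * residue f p)"
    proof (rule Residue_theorem)
      show "open U" "connected U" by (simp_all add: U_def open_box convex_connected convex_box)
      show "finite (P \<inter> U)" unfolding U_def by (rule fin)
      show "f holomorphic_on U - P \<inter> U" by (rule holomorphic_on_subset[OF holo]) (use PW in blast)
      show "path_image (rectpath (- q n) (q n)) \<subseteq> U - P \<inter> U" using pathP[OF n] pc cU by blast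
      show "\<forall>z. z \<notin> U \<longrightarrow> winding_number (rectpath (- q n) (q n)) z = 0"
        using rn cU by (auto intro!: winding_number_rectpath_outside simp: q_def)
    qed auto
    also have "(\<Sum>p\<in>P \<inter> U. winding_number (rectpath (- q n) (q n)) p * residue f p) = (\<Sum>p\<in>P \<inter> B n. residue f p)"
    proof (rule sum.mono_neutral_cong_right)
      show "finite (P \<inter> U)" unfolding U_def by (rule fin)
      show "P \<inter> B n \<subseteq> P \<inter> U" using cU box_subset_cbox unfolding B_def by blast
      show "\<forall>p\<in>P \<inter> U - P \<inter> B n. winding_number (rectpath (- q n) (q n)) p * residue f p = 0"
      proof
        fix p assume p: "p \<in> P \<inter> U - P \<inter> B n"
        have "path_image (rectpath (- q n) (q n)) = cbox (- q n) (q n) - box (- q n) (q n)"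
          using rn by (intro path_image_rectpath_cbox_minus_box) (simp_all add: q_def)
        hence "p \<notin> cbox (- q n) (q n)" using p pathP[OF n] unfolding B_def by blast
        hence "winding_number (rectpath (- q n) (q n)) p = 0"
          using rn by (intro winding_number_rectpath_outside) (auto simp: q_def)
        thus "winding_number (rectpath (- q n) (q n)) p * residue f p = 0" by simp
      qed
      fix p assume "p \<in> P \<inter> B n"
      hence "winding_number (rectpath (- q n) (q n)) p = 1"
        by (intro winding_number_rectpath) (simp add: B_def)
      thus "winding_number (rectpath (- q n) (q n)) p * residue f p = residue f p" by simp
    qed
    finally show ?thesis .
  qed
  have bound: "norm (contour_integral (rectpath (- q n) (q n)) f) \<le> 8 * C * r n powr (1 - s)" if n: "real n \<ge> M" "real n \<ge> R" for n
  proof -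
    have rn: "r n > 0" "r n \<ge> R" using \<delta> n by (simp_all add: r_def)
    have "norm (contour_integral (rectpath (- q n) (q n)) f) \<le> (C * r n powr (- s)) * (2 * \<bar>Re (q n - - q n)\<bar> + 2 * \<bar>Im (q n - - q n)\<bar>)"
    proof (rule contour_integral_rectpath_bound)
      show "continuous_on (path_image (rectpath (- q n) (q n))) f"
        by (rule continuous_on_subset[OF holomorphic_on_imp_continuous_on[OF holo] pathW[OF n(1)]])
      show "0 \<le> C * r n powr (- s)" using CR by simp
      fix t assume t: "t \<in> path_image (rectpath (- q n) (q n))"
      have nt: "norm t \<ge> r n" using t abs_Re_le_cmod[of t] abs_Im_le_cmod[of t] unfolding path by auto
      have "norm (f t) \<le> C * norm t powr (- s)"
        unfolding s_def using away'[OF t n(1)] nt rn by (intro CR(3)) auto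
      also have "\<dots> \<le> C * r n powr (- s)"
        using nt rn s1 CR by (intro mult_left_mono powr_mono2') auto
      finally show "norm (f t) \<le> C * r n powr (- s)" .
    qed
    also have "\<dots> = 8 * C * (r n powr (- s) * r n)" using rn by (simp add: q_def)
    also have "r n powr (- s) * r n = r n powr (1 - s)" using rn powr_add[of "r n" "- s" 1] by (simp add: add.commute)
    finally show ?thesis .
  qed
  have lim2: "(\<lambda>n. contour_integral (rectpath (- q n) (q n)) f) \<longlonglongrightarrow> 0"
  proof (rule Lim_null_comparison)
    show "eventually (\<lambda>n. norm (contour_integral (rectpath (- q n) (q n)) f) \<le> 8 * C * r n powr (1 - s)) sequentially"
      using eventually_ge_at_top[of "nat \<lceil>max M R\<rceil>"]
    proof eventually_elim
      case (elim n)
      hence "real n \<ge> max M R" by linarith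
      thus ?case by (intro bound) auto
    qed
    have "1 - s < 0" using s1 by simp
    thus "(\<lambda>n. 8 * C * r n powr (1 - s)) \<longlonglongrightarrow> 0" unfolding r_def by real_asymp
  qed
  have "(\<lambda>n. 2 * pi * \<i> * sum (residue f) (P \<inter> B n)) \<longlonglongrightarrow> 0"
  proof (rule Lim_transform_eventually[OF lim2])
    show "eventually (\<lambda>n. contour_integral (rectpath (- q n) (q n)) f = 2 * pi * \<i> * sum (residue f) (P \<inter> B n)) sequentially"
      using eventually_ge_at_top[of "nat \<lceil>M\<rceil>"]
    proof eventually_elim
      case (elim n)
      hence "real n \<ge> M" by linarith
      thus ?case by (rule residues)
    qed
  qed
  moreover have "(\<lambda>n. 2 * pi * \<i> * sum (residue f) (P \<inter> B n)) \<longlonglongrightarrow> 2 * pi * \<i> * (?A1 + ?A2 + (- ?B1 + - ?B2))"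
    by (intro tendsto_intros lim1)
  ultimately have "2 * pi * \<i> * (?A1 + ?A2 + (- ?B1 + - ?B2)) = 0" using LIMSEQ_unique by blast
  hence "?A1 + ?A2 + (- ?B1 + - ?B2) = 0" by simp
  thus ?thesis by (simp add: algebra_simps add_eq_0_iff)
qed

section \<open>The nonterminating Saalschuetz theorem\<close>

lemma double_series_summable:
  fixes u :: "nat \<Rightarrow> nat \<Rightarrow> complex"
  assumes bound: "\<And>m j. norm (u m j) \<le> C * ((real m + 1) powr p * (real j + 1) powr q)"
    and pq: "p < -1" "q < -1"
  obtains T where "((\<lambda>(m, j). u m j) has_sum T) (UNIV \<times> UNIV)"
proof -
  define P where "P = (\<lambda>m. (real m + 1) powr p)"
  define Q where "Q = (\<lambda>j. (real j + 1) powr q)"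
  have P: "P summable_on UNIV" and Q: "Q summable_on UNIV"
    unfolding P_def Q_def by (rule summable_nonneg_imp_summable_on[OF summable_Suc_powr]; use pq in simp)+
  have "(\<lambda>(m, j). P m * Q j) summable_on (UNIV \<times> UNIV)"
  proof (rule summable_on_SigmaI)
    show "((\<lambda>j. case (m, j) of (m, j) \<Rightarrow> P m * Q j) has_sum (P m * infsum Q UNIV)) UNIV" for m
      using has_sum_cmult_right[OF has_sum_infsum[OF Q], of "P m"] by simp
    show "(\<lambda>m. P m * infsum Q UNIV) summable_on UNIV"
      by (rule summable_on_cmult_left[OF P])
    show "0 \<le> (case (m, j) of (m, j) \<Rightarrow> P m * Q j)" for m j by (simp add: P_def Q_def)
  qed
  hence "(\<lambda>x. C * (case x of (m, j) \<Rightarrow> P m * Q j)) summable_on (UNIV \<times> UNIV)"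
    by (rule summable_on_cmult_right)
  hence "(\<lambda>x. norm (case x of (m, j) \<Rightarrow> u m j)) summable_on (UNIV \<times> UNIV)"
    by (rule Infinite_Sum.abs_summable_on_comparison_test') (use bound in \<open>auto simp: P_def Q_def\<close>)
  hence "(\<lambda>(m, j). u m j) summable_on (UNIV \<times> UNIV)" by (rule Infinite_Sum.abs_summable_summable)
  thus ?thesis using that by (auto simp: summable_on_def)
qed

lemma double_series_row_summable:
  fixes u :: "nat \<Rightarrow> complex"
  assumes "\<And>j. norm (u j) \<le> C * (P * (real j + 1) powr q)" "q < -1"
  shows "summable (\<lambda>j. norm (u j))"
proof -
  have "summable (\<lambda>j. (C * P) * (real j + 1) powr q)"
    by (intro summable_mult summable_Suc_powr assms)
  thus ?thesis by (rule summable_comparison_test'[of _ 0]) (use assms(1) in \<open>simp add: mult.assoc\<close>)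
qed

lemma double_series_rows:
  fixes u :: "nat \<Rightarrow> nat \<Rightarrow> complex"
  assumes T: "((\<lambda>(m, j). u m j) has_sum T) (UNIV \<times> UNIV)"
    and bound: "\<And>m j. norm (u m j) \<le> C * ((real m + 1) powr p * (real j + 1) powr q)" "q < -1"
  shows "(\<lambda>m. \<Sum>j. u m j) sums T"
proof -
  have "((\<lambda>m. \<Sum>j. u m j) has_sum T) UNIV"
  proof (rule has_sum_Sigma'[OF T])
    fix m
    have "summable (\<lambda>j. norm (u m j))" by (rule double_series_row_summable[OF bound])
    thus "((\<lambda>j. case (m, j) of (m, j) \<Rightarrow> u m j) has_sum (\<Sum>j. u m j)) UNIV"
      using summable_norm_cancel by (auto intro!: norm_summable_imp_has_sum)
  qed
  thus ?thesis by (rule has_sum_imp_sums)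
qed

lemma double_series_cols:
  fixes u :: "nat \<Rightarrow> nat \<Rightarrow> complex"
  assumes T: "((\<lambda>(m, j). u m j) has_sum T) (UNIV \<times> UNIV)"
    and bound: "\<And>m j. norm (u m j) \<le> C * ((real m + 1) powr p * (real j + 1) powr q)" "p < -1"
  shows "(\<lambda>j. \<Sum>m. u m j) sums T"
proof (rule double_series_rows[where p = q and q = p and C = C])
  show "((\<lambda>(m, j). u j m) has_sum T) (UNIV \<times> UNIV)"
    using T by (subst (asm) has_sum_swap) simp
  show "norm (u j m) \<le> C * ((real m + 1) powr q * (real j + 1) powr p)" for m j
    using bound(1)[of j m] by (simp only: mult_ac)
qed (fact bound(2))

lemma double_series_diagonals:
  fixes u :: "nat \<Rightarrow> nat \<Rightarrow> complex"
  assumes T: "((\<lambda>(m, j). u m j) has_sum T) (UNIV \<times> UNIV)"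
  shows "(\<lambda>k. \<Sum>m\<le>k. u m (k - m)) sums T"
proof -
  have bij: "bij_betw (\<lambda>(k, m). (m, k - m)) (Sigma UNIV (\<lambda>k. {..k})) (UNIV \<times> UNIV :: (nat \<times> nat) set)"
    by (rule bij_betwI[where g = "\<lambda>(m, j). (m + j, m)"]) auto
  have "((\<lambda>x. (case (case x of (k, m) \<Rightarrow> (m, k - m)) of (m, j) \<Rightarrow> u m j)) has_sum T) (Sigma UNIV (\<lambda>k. {..k}))"
    using has_sum_reindex_bij_betw[OF bij] T by blast
  hence "((\<lambda>k. \<Sum>m\<le>k. u m (k - m)) has_sum T) UNIV"
    by (rule has_sum_Sigma') (auto intro: has_sum_finite)
  thus ?thesis by (rule has_sum_imp_sums)
qed

text \<open>\<open>Pfaff_Saalschuetz\<close> makes the single series the diagonal sums of a double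
  series, which is then summed by rows. The weight W is abstract so that it can carry the remaining
  parameters of a 3F2 or a 4F3. The assumed decay of W beats the growth of (u)_j / j! and leaves the
  exponent -2 in j; the exponent in m is -Re u - 1, whence Re u > 0.\<close>

lemma Saalschuetz_expansion:
  fixes b c e u :: complex and W :: "nat \<Rightarrow> complex"
  defines "u \<equiv> b + c - e"
  assumes e: "e \<notin> \<int>\<^sub>\<le>\<^sub>0" and u: "Re u > 0"
    and W: "\<And>k. norm (W k) \<le> M * (real k + 1) powr (- Re u - 1)"
  obtains L where
    "(\<lambda>k. pochhammer b k * pochhammer c k / fact k * rGamma (of_nat k + e) * W k) sums L"
    "(\<lambda>m. pochhammer (e - b) m * pochhammer (e - c) m / fact m * rGamma (of_nat m + e) *
       (\<Sum>j. pochhammer u j / fact j * W (m + j))) sums L"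
proof -
  define P where "P = (\<lambda>m. pochhammer (e - b) m * pochhammer (e - c) m / fact m * rGamma (of_nat m + e))"
  define Q where "Q = (\<lambda>j. pochhammer u j / fact j)"
  have M: "M \<ge> 0" using order.trans[OF norm_ge_zero W[of 0]] by simp
  obtain C1 where C1: "C1 > 0" "\<And>m. norm (P m) \<le> C1 * (real m + 1) powr (Re ((e - b) + (e - c) - e) - 1)"
    unfolding P_def using Gauss_term_bound[of "e - b" "e - c" e] by metis
  obtain C2 where C2: "C2 > 0" "\<And>j. norm (Q j) \<le> C2 * (real j + 1) powr (Re u - 1)"
    unfolding Q_def using pochhammer_fact_bound[of u] by metis
  have re: "Re ((e - b) + (e - c) - e) - 1 = - Re u - 1" by (simp add: u_def)
  have bound: "norm (P m * (Q j * W (m + j))) \<le> (C1 * C2 * M) * ((real m + 1) powr (- Re u - 1) * (real j + 1) powr (-2))" for m j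
  proof -
    have "norm (W (m + j)) \<le> M * (real (m + j) + 1) powr (- Re u - 1)" by (rule W)
    also have "\<dots> \<le> M * (real j + 1) powr (- Re u - 1)"
      using u M by (intro mult_left_mono powr_mono2') auto
    finally have "norm (P m * (Q j * W (m + j))) \<le> (C1 * (real m + 1) powr (- Re u - 1)) *
       ((C2 * (real j + 1) powr (Re u - 1)) * (M * (real j + 1) powr (- Re u - 1)))"
      unfolding norm_mult using C1(2)[of m] C2(2)[of j] C1(1) C2(1) M unfolding re by (intro mult_mono) auto
    also have "\<dots> = (C1 * C2 * M) * ((real m + 1) powr (- Re u - 1) * ((real j + 1) powr (Re u - 1) * (real j + 1) powr (- Re u - 1)))"
      by (simp only: mult_ac)
    also have "(real j + 1) powr (Re u - 1) * (real j + 1) powr (- Re u - 1) = (real j + 1) powr (-2)"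
      unfolding powr_add[symmetric] by simp
    finally show ?thesis .
  qed
  have neg: "- Re u - 1 < -1" using u by simp
  obtain T where T: "((\<lambda>(m, j). P m * (Q j * W (m + j))) has_sum T) (UNIV \<times> UNIV)"
    by (rule double_series_summable[OF bound neg]) simp_all
  have rows: "(\<lambda>m. P m * (\<Sum>j. Q j * W (m + j))) sums T"
  proof -
    have "(\<lambda>m. \<Sum>j. P m * (Q j * W (m + j))) sums T"
      by (rule double_series_rows[OF T bound]) simp
    moreover have "(\<Sum>j. P m * (Q j * W (m + j))) = P m * (\<Sum>j. Q j * W (m + j))" for m
    proof (rule suminf_mult)
      have "norm (Q j * W (m + j)) \<le> (C2 * M) * (1 * (real j + 1) powr (-2))" for j
      proof -
        have "norm (W (m + j)) \<le> M * (real (m + j) + 1) powr (- Re u - 1)" by (rule W)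
        also have "\<dots> \<le> M * (real j + 1) powr (- Re u - 1)"
          using u M by (intro mult_left_mono powr_mono2') auto
        finally have "norm (Q j * W (m + j)) \<le> (C2 * (real j + 1) powr (Re u - 1)) * (M * (real j + 1) powr (- Re u - 1))"
          unfolding norm_mult using C2(2)[of j] C2(1) M by (intro mult_mono) auto
        also have "\<dots> = (C2 * M) * ((real j + 1) powr (Re u - 1) * (real j + 1) powr (- Re u - 1))"
          by (simp only: mult_ac)
        also have "(real j + 1) powr (Re u - 1) * (real j + 1) powr (- Re u - 1) = (real j + 1) powr (-2)"
          unfolding powr_add[symmetric] by simp
        finally show ?thesis by simp
      qed
      thus "summable (\<lambda>j. Q j * W (m + j))"
        by (intro summable_norm_cancel[OF double_series_row_summable[where C = "C2 * M" and P = 1 and q = "-2"]]) auto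
    qed
    ultimately show ?thesis by simp
  qed
  have diag: "(\<Sum>m\<le>k. P m * (Q (k - m) * W (m + (k - m)))) =
       pochhammer b k * pochhammer c k / fact k * rGamma (of_nat k + e) * W k" for k
  proof -
    have pe: "pochhammer e m \<noteq> 0" for m using e by (auto simp: pochhammer_eq_0_iff)
    have rG: "rGamma (of_nat m + e) = rGamma e / pochhammer e m" for m
      using pochhammer_rGamma[of e m] pe[of m] by (simp add: add.commute field_simps)
    have "pochhammer b k * pochhammer c k / fact k * rGamma (of_nat k + e) * W k =
       rGamma e * W k / fact k * (pochhammer b k * pochhammer c k / pochhammer e k)"
      unfolding rG by simp
    also have "\<dots> = (\<Sum>m\<le>k. rGamma e * W k / fact k * (of_nat (k choose m) * (pochhammer (e - b) m * pochhammer (e - c) m / pochhammer e m) * pochhammer u (k - m)))"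
      unfolding Pfaff_Saalschuetz[OF e, where b = b and c = c and k = k] sum_distrib_left u_def ..
    also have "\<dots> = (\<Sum>m\<le>k. P m * (Q (k - m) * W (m + (k - m))))"
    proof (intro sum.cong refl)
      fix m assume "m \<in> {..k}"
      hence m: "m \<le> k" by simp
      have "of_nat (k choose m) = (fact k / (fact m * fact (k - m)) :: complex)" by (rule binomial_fact[OF m])
      thus "rGamma e * W k / fact k * (of_nat (k choose m) * (pochhammer (e - b) m * pochhammer (e - c) m / pochhammer e m) * pochhammer u (k - m)) =
        P m * (Q (k - m) * W (m + (k - m)))"
        unfolding P_def Q_def rG using m by (simp add: mult_ac)
    qed
    finally show ?thesis ..
  qed
  have "(\<lambda>k. pochhammer b k * pochhammer c k / fact k * rGamma (of_nat k + e) * W k) sums T"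
    using double_series_diagonals[OF T] unfolding diag .
  with rows show ?thesis using that unfolding P_def Q_def by blast
qed

section \<open>Balanced 3F2 series\<close>

definition F32_reg :: "complex \<Rightarrow> complex \<Rightarrow> complex \<Rightarrow> complex \<Rightarrow> complex \<Rightarrow> complex" where
  "F32_reg A B C E F =
     (\<Sum>k. pochhammer A k * pochhammer B k * pochhammer C k / fact k * (rGamma (of_nat k + E) * rGamma (of_nat k + F)))"

lemma pochhammer_times_rGamma: "pochhammer z k * rGamma (of_nat k + z) = rGamma z" for z :: complex
  using pochhammer_rGamma[of z k] by (simp add: add.commute)

text \<open>The 4F3 case with the additional pair 1; 1, whose contribution (1)_k / Gamma(k + 1)
  equals 1.\<close>

lemma summable_F32:
  assumes "Re (E + F - A - B - C) > 0"
  shows "summable (\<lambda>k. pochhammer A k * pochhammer B k * pochhammer C k / fact k * (rGamma (of_nat k + E) * rGamma (of_nat k + F)))"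
proof -
  have "summable (F43_term A B C 1 E F 1)"
    by (rule summable_norm_cancel[OF summable_F43_term]) (use assms in simp)
  moreover have "F43_term A B C 1 E F 1 = (\<lambda>k. pochhammer A k * pochhammer B k * pochhammer C k / fact k * (rGamma (of_nat k + E) * rGamma (of_nat k + F)))"
    using pochhammer_times_rGamma[of 1] by (simp add: F43_term_def fun_eq_iff mult_ac)
  ultimately show ?thesis by simp
qed

lemma F43_reg_cancel: "F43_reg A B C D E F D = rGamma D * F32_reg A B C E F"
  if "Re (E + F - A - B - C) > 0"
proof -
  have "F43_term A B C D E F D = (\<lambda>k. rGamma D * (pochhammer A k * pochhammer B k * pochhammer C k / fact k * (rGamma (of_nat k + E) * rGamma (of_nat k + F))))"
  proof
    fix k
    show "F43_term A B C D E F D k = rGamma D * (pochhammer A k * pochhammer B k * pochhammer C k / fact k * (rGamma (of_nat k + E) * rGamma (of_nat k + F)))"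
      unfolding pochhammer_times_rGamma[of D k, symmetric] by (simp add: F43_term_def)
  qed
  thus ?thesis unfolding F43_reg_suminf F32_reg_def using suminf_mult[OF summable_F32[OF that], of "rGamma D"] by simp
qed

lemma F43_reg_commute: "F43_reg A B C D E F G = F43_reg B A C D E F G"
  unfolding F43_reg_def by (simp only: mult_ac)

lemma F32_reg_perm: "F32_reg A B C E F = F32_reg A C B E F" "F32_reg A B C E F = F32_reg A B C F E"
  unfolding F32_reg_def by (simp_all only: mult_ac)

lemma F43_reg_zero: "F43_reg A B C 0 E F G = rGamma E * rGamma F * rGamma G"
proof -
  have "F43_term A B C 0 E F G k = (if k = 0 then rGamma E * rGamma F * rGamma G else 0)" for k
    by (cases k) (simp_all add: F43_term_def pochhammer_rec)
  hence "F43_term A B C 0 E F G = (\<lambda>k. if k = 0 then rGamma E * rGamma F * rGamma G else 0)" by blast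
  thus ?thesis unfolding F43_reg_suminf using sums_single[of 0 "\<lambda>_. rGamma E * rGamma F * rGamma G"] by (simp add: sums_iff)
qed

text \<open>\<open>Saalschuetz_expansion\<close> with the weight (c)_k / Gamma(k + f): its inner
  sums are Gauss series. Balance gives f - u = c + 1, so the Gamma factor of Gauss's theorem is
  Gamma(1), and the new series contains the pair c; c + 1 that is exploited below.\<close>

lemma Thomae_balanced:
  fixes a b c e f :: complex
  assumes bal: "e + f = a + b + c + 1" and e: "e \<notin> \<int>\<^sub>\<le>\<^sub>0" and re: "Re (a + b - e) > 0"
  shows "F32_reg a b c e f = rGamma (f - c) * F32_reg (e - a) (e - b) c e (c + 1)"
proof -
  define u where "u = a + b - e"
  define W where "W = (\<lambda>k. pochhammer c k * rGamma (of_nat k + f))"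
  have cf: "c - f = - u - 1" and fu: "f - u = c + 1" using bal by (simp_all add: u_def algebra_simps)
  obtain M where M: "M > 0" "\<And>k. norm (W k) \<le> M * (real k + 1) powr Re (c - f)"
    unfolding W_def using pochhammer_rGamma_bound[of c f] by metis
  have WM: "norm (W k) \<le> M * (real k + 1) powr (- Re u - 1)" for k using M(2)[of k] by (simp add: cf)
  have inner: "(\<Sum>j. pochhammer u j / fact j * W (m + j)) = rGamma (f - c) * (pochhammer c m * rGamma (of_nat m + (c + 1)))" for m
  proof -
    have pm: "W (m + j) = pochhammer c m * (pochhammer (c + of_nat m) j * rGamma (of_nat j + (f + of_nat m)))" for j
      unfolding W_def pochhammer_product'[of c m j] by (simp add: add_ac)
    have "Re (f + of_nat m - (c + of_nat m) - u) > 0" using cf by (simp add: complex_eq_iff algebra_simps)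
    note g = this
    have eq: "pochhammer u j / fact j * W (m + j) = pochhammer c m * (pochhammer (c + of_nat m) j * pochhammer u j / fact j * rGamma (of_nat j + (f + of_nat m)))" for j
      unfolding pm by simp
    have "(\<Sum>j. pochhammer u j / fact j * W (m + j)) = pochhammer c m * Gauss_series (c + of_nat m) u (f + of_nat m)"
      unfolding eq Gauss_series_def by (rule suminf_mult[OF summable_norm_cancel[OF summable_Gauss[OF g]]])
    also have "Gauss_series (c + of_nat m) u (f + of_nat m) = Gamma (f - c - u) * rGamma (f - c) * rGamma (f + of_nat m - u)"
      unfolding Gauss_summation[OF g] by (simp add: algebra_simps)
    also have "f - c - u = 1" using fu by (simp add: algebra_simps)
    also have "f + of_nat m - u = of_nat m + (c + 1)" using fu by (simp add: algebra_simps)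
    finally show ?thesis by (simp add: mult_ac)
  qed
  have WM': "norm (W k) \<le> M * (real k + 1) powr (- Re (a + b - e) - 1)" for k
    using WM[of k] unfolding u_def .
  obtain L where L: "(\<lambda>k. pochhammer a k * pochhammer b k / fact k * rGamma (of_nat k + e) * W k) sums L"
    "(\<lambda>m. pochhammer (e - a) m * pochhammer (e - b) m / fact m * rGamma (of_nat m + e) *
       (\<Sum>j. pochhammer (a + b - e) j / fact j * W (m + j))) sums L"
    by (rule Saalschuetz_expansion[OF e re WM'])
  have "F32_reg a b c e f = L" using sums_unique[OF L(1)] unfolding F32_reg_def W_def by (simp add: mult_ac)
  also have "L = (\<Sum>m. rGamma (f - c) * (pochhammer (e - a) m * pochhammer (e - b) m * pochhammer c m / fact m * (rGamma (of_nat m + e) * rGamma (of_nat m + (c + 1)))))"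
    using sums_unique[OF L(2)] unfolding u_def[symmetric] inner by (simp add: mult_ac)
  also have "\<dots> = rGamma (f - c) * F32_reg (e - a) (e - b) c e (c + 1)"
  proof -
    have "Re (e + (c + 1) + 1 - (e - a) - (e - b) - c - 1) > 0" using re by simp
    hence "summable (F43_term (e - a) (e - b) c 1 e (c + 1) 1)"
      by (intro summable_norm_cancel[OF summable_F43_term])
    moreover have "F43_term (e - a) (e - b) c 1 e (c + 1) 1 = (\<lambda>m. pochhammer (e - a) m * pochhammer (e - b) m * pochhammer c m / fact m * (rGamma (of_nat m + e) * rGamma (of_nat m + (c + 1))))"
      using pochhammer_times_rGamma[of 1] by (simp add: F43_term_def fun_eq_iff mult_ac)
    ultimately show ?thesis unfolding F32_reg_def by (intro suminf_mult) simp
  qed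
  finally show ?thesis .
qed

lemma Gamma_times_rGamma:
  assumes "z \<notin> \<int>"
  shows "Gamma z * rGamma z = (1 :: complex)"
proof -
  have "z \<notin> \<int>\<^sub>\<le>\<^sub>0" using assms nonpos_Ints_Int by blast
  hence "Gamma z \<noteq> 0" by (simp add: Gamma_eq_zero_iff)
  thus ?thesis by (simp add: rGamma_inverse_Gamma)
qed

lemma sin_pi_neq_0:
  assumes "z \<notin> \<int>"
  shows "sin_pi z \<noteq> 0"
proof
  assume "sin_pi z = 0"
  then obtain n :: int where "of_real pi * z = of_real (real_of_int n * pi)"
    unfolding sin_pi_def sin_eq_0 by blast
  hence "z = of_int n" by simp
  thus False using assms by simp
qed

lemma generic_shift:
  assumes "finite (Z :: complex set)"
  obtains \<delta> :: complex where "\<delta> \<notin> \<int>" "\<And>z. z \<in> Z \<Longrightarrow> z + \<delta> \<notin> \<int>"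
proof -
  obtain \<delta> \<eta> :: real where d: "0 < \<eta>" "\<And>z. z \<in> insert 0 Z \<Longrightarrow> cos (2 * pi * (Re z + \<delta>)) \<le> 1 - \<eta>"
    using generic_offset[of "insert 0 Z"] assms by (metis finite.insertI)
  have "z + of_real \<delta> \<notin> \<int>" if "z \<in> insert 0 Z" for z
    using d that by (intro sin_away_not_Int[of \<eta>]) (simp_all add: sin_away_def)
  from this[of 0] this show ?thesis by (intro that[of "of_real \<delta>"]) auto
qed

text \<open>After \<open>Thomae_balanced\<close> both series are sums of residues of a single Barnes integrand whose remaining
  pole, at \<open>- c\<close>, gives the right-hand side. The parameter \<open>\<delta>\<close> cancels between numerator and denominator; it turns
  the four-series relation \<open>Barnes_residue_relation\<close> into this three-term one.\<close>

theorem nonterminating_Saalschuetz: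
  fixes a b c e f :: complex
  assumes bal: "e + f = a + b + c + 1" and re: "Re (a + b - e) > 0"
    and nz: "e \<notin> \<int>\<^sub>\<le>\<^sub>0" "1 + a - b \<notin> \<int>\<^sub>\<le>\<^sub>0" "e - b - c \<notin> \<int>" "e - b \<notin> \<int>" "c \<notin> \<int>"
  shows "F32_reg a b c e f * (rGamma (1 + a - e) * rGamma (1 + a - f)) +
         F32_reg a (1 + a - e) (1 + a - f) (1 + a - b) (1 + a - c) * (rGamma b * rGamma c) =
         rGamma (e - b) * rGamma (e - c) * rGamma (f - b) * rGamma (f - c)"
proof -
  obtain \<delta> where \<delta>: "\<delta> \<notin> \<int>" "\<And>z. z \<in> {e - b, c} \<Longrightarrow> z + \<delta> \<notin> \<int>"
    using generic_shift[of "{e - b, c}"] by auto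
  have \<delta>': "\<delta> + e - b \<notin> \<int>" "\<delta> + c \<notin> \<int>"
    using \<delta>(2)[of "e - b"] \<delta>(2)[of c] by (simp_all add: algebra_simps)
  have f: "f = 1 + a + b + c - e" using bal by (simp add: algebra_simps)
  define X where "X = F32_reg (e - a) (e - b) c e (c + 1)"
  define Y where "Y = F32_reg (1 - b) (e - b) (e - b - c) (1 + a - b) (1 + e - b - c)"
  have X: "F32_reg a b c e f = rGamma (f - c) * X"
    unfolding X_def by (rule Thomae_balanced[OF bal nz(1) re])
  have Y: "F32_reg a (1 + a - e) (1 + a - f) (1 + a - b) (1 + a - c) = rGamma (f - c) * Y"
  proof -
    have "F32_reg a (1 + a - e) (1 + a - f) (1 + a - b) (1 + a - c) =
        rGamma ((1 + a - c) - (1 + a - f)) * F32_reg ((1 + a - b) - a) ((1 + a - b) - (1 + a - e)) (1 + a - f) (1 + a - b) ((1 + a - f) + 1)"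
      using re nz by (intro Thomae_balanced) (simp_all add: f)
    thus ?thesis by (simp add: Y_def f algebra_simps)
  qed
  have sG: "Re (e + (c + 1) + (1 + a - e) + \<delta> - (e - b) - c - 0 - \<delta>) > 1" using re by simp
  \<comment> \<open>After cancellation the integrand is Gamma(e - b + t) Gamma(-t) / (Gamma(e + t)
    Gamma(1 + a - e - t) (c + t)). The poles of the first Gamma give Y, those of Gamma(-t) give
    X.\<close>
  have rel: "Barnes_coeff (e - b) c 0 \<delta> e (c + 1) *
      F43_reg ((e - b) + 0) ((e - b) + \<delta>) (1 + (e - b) - e) (1 + (e - b) - (c + 1)) (1 + (e - b) - c) ((e - b) + (1 + a - e)) ((e - b) + \<delta>) +
    Barnes_coeff c (e - b) 0 \<delta> e (c + 1) *
      F43_reg (c + 0) (c + \<delta>) (1 + c - e) (1 + c - (c + 1)) (1 + c - (e - b)) (c + (1 + a - e)) (c + \<delta>) =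
    Barnes_coeff 0 \<delta> (e - b) c (1 + a - e) \<delta> *
      F43_reg (0 + (e - b)) (0 + c) (1 + 0 - (1 + a - e)) (1 + 0 - \<delta>) (1 + 0 - \<delta>) (0 + e) (0 + (c + 1)) +
    Barnes_coeff \<delta> 0 (e - b) c (1 + a - e) \<delta> *
      F43_reg (\<delta> + (e - b)) (\<delta> + c) (1 + \<delta> - (1 + a - e)) (1 + \<delta> - \<delta>) (1 + \<delta> - 0) (\<delta> + e) (\<delta> + (c + 1))"
    by (rule Barnes_residue_relation[OF _ _ _ _ _ _ sG]) (use nz \<delta>(1) \<delta>' minus_in_Ints_iff[of \<delta>] in \<open>simp_all add: algebra_simps\<close>)
  have F1: "F43_reg ((e - b) + 0) ((e - b) + \<delta>) (1 + (e - b) - e) (1 + (e - b) - (c + 1)) (1 + (e - b) - c) ((e - b) + (1 + a - e)) ((e - b) + \<delta>) = rGamma (e - b + \<delta>) * Y"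
  proof -
    have "F43_reg ((e - b) + 0) ((e - b) + \<delta>) (1 + (e - b) - e) (1 + (e - b) - (c + 1)) (1 + (e - b) - c) ((e - b) + (1 + a - e)) ((e - b) + \<delta>)
       = F43_reg (1 - b) (e - b) (e - b - c) (e - b + \<delta>) (1 + a - b) (1 + e - b - c) (e - b + \<delta>)"
      unfolding F43_reg_def by (simp add: algebra_simps)
    also have "\<dots> = rGamma (e - b + \<delta>) * Y"
      unfolding Y_def by (rule F43_reg_cancel) (use re in simp)
    finally show ?thesis .
  qed
  have F2: "F43_reg (c + 0) (c + \<delta>) (1 + c - e) (1 + c - (c + 1)) (1 + c - (e - b)) (c + (1 + a - e)) (c + \<delta>) = rGamma (1 + b + c - e) * rGamma (f - b) * rGamma (c + \<delta>)"
  proof -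
    \<comment> \<open>Gamma(c + t) / Gamma(c + 1 + t) = 1/(c + t) has a single pole, so this series
      stops after its first term.\<close>
    have 0: "1 + c - (c + 1) = 0" by simp
    show ?thesis unfolding 0 F43_reg_zero by (simp add: f algebra_simps)
  qed
  have F3: "F43_reg (0 + (e - b)) (0 + c) (1 + 0 - (1 + a - e)) (1 + 0 - \<delta>) (1 + 0 - \<delta>) (0 + e) (0 + (c + 1)) = rGamma (1 - \<delta>) * X"
  proof -
    have "F43_reg (0 + (e - b)) (0 + c) (1 + 0 - (1 + a - e)) (1 + 0 - \<delta>) (1 + 0 - \<delta>) (0 + e) (0 + (c + 1))
       = F43_reg (e - a) (e - b) c (1 - \<delta>) e (c + 1) (1 - \<delta>)"
      unfolding F43_reg_def by (simp add: algebra_simps)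
    also have "\<dots> = rGamma (1 - \<delta>) * X"
      unfolding X_def by (rule F43_reg_cancel) (use re in simp)
    finally show ?thesis .
  qed
  define z where "z = e - b - c"
  have zn: "z \<notin> \<int>" "- z \<notin> \<int>" using nz(3) minus_in_Ints_iff[of z] by (simp_all add: z_def)
  have Gz: "of_real pi / sin (of_real pi * (- z)) * rGamma (1 + b + c - e) = - Gamma z"
  proof -
    have *: "1 + b + c - e = 1 - z" by (simp add: z_def)
    have "sin (of_real pi * (- z)) = - sin (of_real pi * z)" by simp
    thus ?thesis unfolding * using Gamma_eq_reflection[OF zn(1)] by simp
  qed
  have e1: "c - (e - b) = - z" "e - (e - b) = b" "c + 1 - (e - b) = 1 + b + c - e" "e - b + 0 = e - b"
    and e2: "e - b - c = z" "c + 0 = c" "c + 1 - c = 1"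
    and e3: "\<delta> - 0 = \<delta>" "0 + (e - b) = e - b" "0 + c = c" "1 + a - e - 0 = 1 + a - e"
    by (simp_all add: z_def)
  have c1: "Barnes_coeff (e - b) c 0 \<delta> e (c + 1) * rGamma (e - b + \<delta>) = - (Gamma z * Gamma (e - b) * rGamma b)"
  proof -
    have "Gamma (e - b + \<delta>) * rGamma (e - b + \<delta>) = 1"
      using \<delta>(2)[of "e - b"] by (intro Gamma_times_rGamma) simp
    moreover have "Barnes_coeff (e - b) c 0 \<delta> e (c + 1) * rGamma (e - b + \<delta>) =
       (of_real pi / sin (of_real pi * (- z)) * rGamma (1 + b + c - e)) * Gamma (e - b) * rGamma b * (Gamma (e - b + \<delta>) * rGamma (e - b + \<delta>))"
      unfolding Barnes_coeff_def e1 by simp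
    ultimately show ?thesis unfolding Gz by simp
  qed
  have c2: "Barnes_coeff c (e - b) 0 \<delta> e (c + 1) * (rGamma (1 + b + c - e) * rGamma (f - b) * rGamma (c + \<delta>)) = Gamma z * Gamma c * rGamma (e - c) * rGamma (f - b)"
  proof -
    have "Gamma (c + \<delta>) * rGamma (c + \<delta>) = 1"
      using \<delta>(2)[of c] by (intro Gamma_times_rGamma) simp
    moreover have "Barnes_coeff c (e - b) 0 \<delta> e (c + 1) * (rGamma (1 + b + c - e) * rGamma (f - b) * rGamma (c + \<delta>)) =
       - (of_real pi / sin (of_real pi * (- z)) * rGamma (1 + b + c - e)) * Gamma c * rGamma (e - c) * rGamma (f - b) * (Gamma (c + \<delta>) * rGamma (c + \<delta>))"
      unfolding Barnes_coeff_def e2 by simp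
    ultimately show ?thesis unfolding Gz by simp
  qed
  have c3: "Barnes_coeff 0 \<delta> (e - b) c (1 + a - e) \<delta> * rGamma (1 - \<delta>) = Gamma (e - b) * Gamma c * rGamma (1 + a - e)"
  proof -
    have "sin (of_real pi * \<delta>) \<noteq> 0" using sin_pi_neq_0[OF \<delta>(1)] by (simp add: sin_pi_def)
    hence "of_real pi / sin (of_real pi * \<delta>) * (rGamma \<delta> * rGamma (1 - \<delta>)) = 1"
      unfolding rGamma_reflection_complex by simp
    moreover have "Barnes_coeff 0 \<delta> (e - b) c (1 + a - e) \<delta> * rGamma (1 - \<delta>) =
        Gamma (e - b) * Gamma c * rGamma (1 + a - e) * (of_real pi / sin (of_real pi * \<delta>) * (rGamma \<delta> * rGamma (1 - \<delta>)))"
      unfolding Barnes_coeff_def e3 by simp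
    ultimately show ?thesis by simp
  qed
  \<comment> \<open>The factor 1/Gamma(\<delta> - \<delta>) is 0: the cancelled pair of Gammas has
    no poles.\<close>
  have c4: "Barnes_coeff \<delta> 0 (e - b) c (1 + a - e) \<delta> = 0" by (simp add: Barnes_coeff_def)
  have "- (Gamma z * Gamma (e - b) * rGamma b) * Y + Gamma z * Gamma c * rGamma (e - c) * rGamma (f - b) = Gamma (e - b) * Gamma c * rGamma (1 + a - e) * X"
    using rel unfolding F1 F2 F3 c4 c2 unfolding mult.assoc[symmetric, of _ "rGamma _" X] mult.assoc[symmetric, of _ "rGamma _" Y] c1 c3
    by simp
  hence "rGamma z * rGamma (e - b) * rGamma c * (- (Gamma z * Gamma (e - b) * rGamma b) * Y + Gamma z * Gamma c * rGamma (e - c) * rGamma (f - b)) =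
     rGamma z * rGamma (e - b) * rGamma c * (Gamma (e - b) * Gamma c * rGamma (1 + a - e) * X)" by simp
  moreover note Gamma_times_rGamma[OF zn(1)] Gamma_times_rGamma[OF nz(4)] Gamma_times_rGamma[OF nz(5)]
  ultimately have "rGamma (e - b) * rGamma (e - c) * rGamma (f - b) - rGamma c * rGamma b * Y = rGamma z * rGamma (1 + a - e) * X"
    by algebra
  moreover have "1 + a - f = z" by (simp add: f z_def)
  ultimately show ?thesis unfolding X Y by algebra
qed

section \<open>The two-term transformation of \<open>K\<close>\<close>

text \<open>The splitting (A)_(m+j) = (A)_m (A + m)_j turns a weight evaluated at m + j into a
  series with parameters shifted by m. Two Pochhammer symbols are shifted here, one in the companion
  lemma.\<close>

lemma F32_reg_inner2:
  assumes "Re (E + F - A - B - C) > 0"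
  shows "(\<Sum>j. pochhammer C j / fact j * (pochhammer A (m + j) * pochhammer B (m + j) * (rGamma (of_nat (m + j) + E) * rGamma (of_nat (m + j) + F)))) =
     pochhammer A m * pochhammer B m * F32_reg (A + of_nat m) (B + of_nat m) C (E + of_nat m) (F + of_nat m)"
proof -
  have s: "Re ((E + of_nat m) + (F + of_nat m) - (A + of_nat m) - (B + of_nat m) - C) > 0" using assms by simp
  have eq: "pochhammer C j / fact j * (pochhammer A (m + j) * pochhammer B (m + j) * (rGamma (of_nat (m + j) + E) * rGamma (of_nat (m + j) + F))) =
    pochhammer A m * pochhammer B m * (pochhammer (A + of_nat m) j * pochhammer (B + of_nat m) j * pochhammer C j / fact j *
      (rGamma (of_nat j + (E + of_nat m)) * rGamma (of_nat j + (F + of_nat m))))" for j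
    unfolding pochhammer_product'[of _ m j] by (simp add: add_ac)
  show ?thesis unfolding F32_reg_def eq by (rule suminf_mult[OF summable_F32[OF s]])
qed

lemma F32_reg_inner1:
  assumes "Re (E + F - A - B - C) > 0"
  shows "(\<Sum>j. pochhammer B j * pochhammer C j / fact j * rGamma (of_nat j + E) * (pochhammer A (m + j) * rGamma (of_nat (m + j) + F))) =
     pochhammer A m * F32_reg (A + of_nat m) B C E (F + of_nat m)"
proof -
  have s: "Re (E + (F + of_nat m) - (A + of_nat m) - B - C) > 0" using assms by simp
  have eq: "pochhammer B j * pochhammer C j / fact j * rGamma (of_nat j + E) * (pochhammer A (m + j) * rGamma (of_nat (m + j) + F)) =
    pochhammer A m * (pochhammer (A + of_nat m) j * pochhammer B j * pochhammer C j / fact j *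
      (rGamma (of_nat j + E) * rGamma (of_nat j + (F + of_nat m))))" for j
    unfolding pochhammer_product'[of _ m j] by (simp add: add_ac)
  show ?thesis unfolding F32_reg_def eq by (rule suminf_mult[OF summable_F32[OF s]])
qed

lemma pochhammer_pair_bound:
  fixes A B E F :: complex
  obtains M where "M > 0"
    "\<And>k. norm (pochhammer A k * pochhammer B k * (rGamma (of_nat k + E) * rGamma (of_nat k + F))) \<le> M * (real k + 1) powr Re (A + B - E - F)"
proof -
  obtain M1 where M1: "M1 > 0" "\<And>k. norm (pochhammer A k * rGamma (of_nat k + E)) \<le> M1 * (real k + 1) powr Re (A - E)"
    using pochhammer_rGamma_bound[of A E] by metis
  obtain M2 where M2: "M2 > 0" "\<And>k. norm (pochhammer B k * rGamma (of_nat k + F)) \<le> M2 * (real k + 1) powr Re (B - F)"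
    using pochhammer_rGamma_bound[of B F] by metis
  have "norm (pochhammer A k * pochhammer B k * (rGamma (of_nat k + E) * rGamma (of_nat k + F))) \<le> (M1 * M2) * (real k + 1) powr Re (A + B - E - F)" for k
  proof -
    have "norm (pochhammer A k * pochhammer B k * (rGamma (of_nat k + E) * rGamma (of_nat k + F))) =
       norm (pochhammer A k * rGamma (of_nat k + E)) * norm (pochhammer B k * rGamma (of_nat k + F))"
      by (simp add: norm_mult mult_ac)
    also have "\<dots> \<le> (M1 * (real k + 1) powr Re (A - E)) * (M2 * (real k + 1) powr Re (B - F))"
      using M1(1) by (intro mult_mono M1(2) M2(2)) auto
    also have "\<dots> = (M1 * M2) * ((real k + 1) powr Re (A - E) * (real k + 1) powr Re (B - F))" by (simp only: mult_ac)
    also have "(real k + 1) powr Re (A - E) * (real k + 1) powr Re (B - F) = (real k + 1) powr Re (A + B - E - F)"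
      unfolding powr_add[symmetric] by (simp add: algebra_simps)
    finally show ?thesis .
  qed
  thus ?thesis using that[of "M1 * M2"] M1(1) M2(1) by simp
qed

text \<open>m + j + 1 <= (m + 1)(j + 1). The nonnegative exponent t covers weights that may grow or
  decay.\<close>

lemma powr_Suc_add_le:
  assumes "t \<ge> 0" "p \<le> t"
  shows "(real (m + j) + 1) powr p \<le> (real m + 1) powr t * (real j + 1) powr t"
proof -
  have "(real (m + j) + 1) powr p \<le> (real (m + j) + 1) powr t" using assms by (intro powr_mono) auto
  also have "\<dots> \<le> ((real m + 1) * (real j + 1)) powr t" using assms by (intro powr_mono2) (auto simp: algebra_simps)
  also have "\<dots> = (real m + 1) powr t * (real j + 1) powr t" by (simp add: powr_mult)
  finally show ?thesis .
qed

text \<open>\<open>K\<close> on scalars, as recorded in \<open>K_eq_K7\<close>; in this form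
  identities can be stated under the balance condition and restricted to complex lines.\<close>

definition K7 ::
  "complex \<Rightarrow> complex \<Rightarrow> complex \<Rightarrow> complex \<Rightarrow> complex \<Rightarrow> complex \<Rightarrow> complex \<Rightarrow> complex" where
  "K7 a b c d e f g =
     F43_reg a b c d e f g * (rGamma (1+a-e) * rGamma (1+a-f) * rGamma (1+a-g))
   + F43_reg a (1+a-e) (1+a-f) (1+a-g) (1+a-b) (1+a-c) (1+a-d) * (rGamma b * rGamma c * rGamma d)"

text \<open>Both series of \<open>K\<close> are expanded by \<open>Saalschuetz_expansion\<close>; two applications of
  \<open>nonterminating_Saalschuetz\<close>, separated by an interchange of the order of summation, lead from one
  to the other.\<close>

lemma K7_transform_generic:
  fixes a b c d e f g u :: complex
  defines "u \<equiv> b + c - e"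
  assumes bal: "e + f + g = 1 + a + b + c + d"
    and re: "Re u > 0" "Re c > 1" "Re (g - u) > 1"
    and nz: "e \<notin> \<int>" "f \<notin> \<int>" "a - d \<notin> \<int>" "f - d - u \<notin> \<int>" "f - d \<notin> \<int>" "u \<notin> \<int>"
      "a - u \<notin> \<int>" "a + b - e \<notin> \<int>" "a - e \<notin> \<int>" "a - c \<notin> \<int>" "e - c \<notin> \<int>"
  shows "K7 a b c d e f g = K7 a (e - b) (e - c) d e (f - u) (g - u)"
proof -
  have g: "g = 1 + a + d + u - f" using bal by (simp add: u_def algebra_simps)
  have shift: "z + of_nat n \<notin> \<int>" "1 + z + of_nat n \<notin> \<int>" "1 + z \<notin> \<int>" if "z \<notin> \<int>" for z :: complex and n
  proof -
    show "z + of_nat n \<notin> \<int>" using that by (metis Ints_diff Ints_of_nat add_diff_cancel_right')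
    show "1 + z \<notin> \<int>" using that by (metis Ints_diff Ints_1 add_diff_cancel_left')
    hence *: "1 + z \<notin> \<int>" .
    show "1 + z + of_nat n \<notin> \<int>" using * by (metis Ints_diff Ints_of_nat add_diff_cancel_right')
  qed
  have np: "z \<notin> \<int>\<^sub>\<le>\<^sub>0" if "z \<notin> \<int>" for z :: complex using that nonpos_Ints_Int by blast
  \<comment> \<open>T will be the double sum of \<open>P m * Q j * Z (m + j)\<close>. Its rows carry
    the companions of the inner series of the expanded A0, its columns those of the expanded
    B0'.\<close>
  define P where "P = (\<lambda>m. pochhammer (e - b) m * pochhammer (e - c) m / fact m * rGamma (of_nat m + e))"
  define Q where "Q = (\<lambda>j. pochhammer (1 + a - g) j * pochhammer (1 + a - f) j / fact j * rGamma (of_nat j + (1 + a - d)))"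
  define Z where "Z = (\<lambda>k. pochhammer a k * rGamma (of_nat k + (1 + a - u)))"
  define R where "R = (\<lambda>m. F32_reg (a + of_nat m) (1 + a - g) (1 + a - f) (1 + a - d) (1 + a - u + of_nat m))"
  define A0 where "A0 = F43_reg a b c d e f g"
  define A0' where "A0' = F43_reg a (e - b) (e - c) d e (f - u) (g - u)"
  define B0 where "B0 = F43_reg a (1+a-e) (1+a-f) (1+a-g) (1+a-b) (1+a-c) (1+a-d)"
  define B0' where "B0' = F43_reg a (1+a-e) (1+a-(f-u)) (1+a-(g-u)) (1+a-(e-b)) (1+a-(e-c)) (1+a-d)"

  have sumA: "(\<lambda>m. P m * (pochhammer a m * pochhammer d m * F32_reg (a + of_nat m) (d + of_nat m) u (f + of_nat m) (g + of_nat m))) sums A0"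
  proof -
    define W where "W = (\<lambda>k. pochhammer a k * pochhammer d k * (rGamma (of_nat k + f) * rGamma (of_nat k + g)))"
    obtain M where M: "M > 0" "\<And>k. norm (W k) \<le> M * (real k + 1) powr Re (a + d - f - g)"
      unfolding W_def using pochhammer_pair_bound[of a d f g] by metis
    have ex: "Re (a + d - f - g) = - Re (b + c - e) - 1" by (simp add: g u_def)
    obtain L where L: "(\<lambda>k. pochhammer b k * pochhammer c k / fact k * rGamma (of_nat k + e) * W k) sums L"
      "(\<lambda>m. pochhammer (e - b) m * pochhammer (e - c) m / fact m * rGamma (of_nat m + e) *
         (\<Sum>j. pochhammer (b + c - e) j / fact j * W (m + j))) sums L"
      by (rule Saalschuetz_expansion[OF np[OF nz(1)] re(1)[unfolded u_def] M(2)[unfolded ex]])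
    have "A0 = L" unfolding A0_def F43_reg_def using sums_unique[OF L(1)] by (simp add: W_def mult_ac)
    moreover have "(\<Sum>j. pochhammer u j / fact j * W (m + j)) = pochhammer a m * pochhammer d m * F32_reg (a + of_nat m) (d + of_nat m) u (f + of_nat m) (g + of_nat m)" for m
      unfolding W_def by (rule F32_reg_inner2) (simp add: g)
    ultimately show ?thesis using L(2) unfolding u_def[symmetric] P_def by simp
  qed
  \<comment> \<open>The product on the right-hand side supplies the denominators Gamma(m + f - u)
    and Gamma(m + g - u) of A0', so summation over m relates A0, T and A0'.\<close>
  have NS1: "F32_reg (a + of_nat m) (d + of_nat m) u (f + of_nat m) (g + of_nat m) * (rGamma (1 + a - f) * rGamma (1 + a - g)) +
     R m * (rGamma (d + of_nat m) * rGamma u) = rGamma (f - d) * rGamma (g - d) * (rGamma (of_nat m + (f - u)) * rGamma (of_nat m + (g - u)))" for m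
  proof -
    have "F32_reg (a + of_nat m) (d + of_nat m) u (f + of_nat m) (g + of_nat m) *
        (rGamma (1 + (a + of_nat m) - (f + of_nat m)) * rGamma (1 + (a + of_nat m) - (g + of_nat m))) +
      F32_reg (a + of_nat m) (1 + (a + of_nat m) - (f + of_nat m)) (1 + (a + of_nat m) - (g + of_nat m)) (1 + (a + of_nat m) - (d + of_nat m)) (1 + (a + of_nat m) - u) *
        (rGamma (d + of_nat m) * rGamma u) =
      rGamma ((f + of_nat m) - (d + of_nat m)) * rGamma ((f + of_nat m) - u) * rGamma ((g + of_nat m) - (d + of_nat m)) * rGamma ((g + of_nat m) - u)"
    proof (rule nonterminating_Saalschuetz)
      show "f + of_nat m + (g + of_nat m) = a + of_nat m + (d + of_nat m) + u + 1" by (simp add: g)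
      show "Re (a + of_nat m + (d + of_nat m) - (f + of_nat m)) > 0" using re(3) by (simp add: g)
      show "f + of_nat m \<notin> \<int>\<^sub>\<le>\<^sub>0" by (rule np[OF shift(1)[OF nz(2)]])
      show "1 + (a + of_nat m) - (d + of_nat m) \<notin> \<int>\<^sub>\<le>\<^sub>0" using np[OF shift(3)[OF nz(3)]] by (simp add: algebra_simps)
      show "f + of_nat m - (d + of_nat m) - u \<notin> \<int>" "f + of_nat m - (d + of_nat m) \<notin> \<int>" "u \<notin> \<int>"
        using nz by (simp_all add: algebra_simps)
    qed
    moreover have "1 + (a + of_nat m) - (f + of_nat m) = 1 + a - f" "1 + (a + of_nat m) - (g + of_nat m) = 1 + a - g"
      "1 + (a + of_nat m) - (d + of_nat m) = 1 + a - d" "1 + (a + of_nat m) - u = 1 + a - u + of_nat m"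
      "f + of_nat m - (d + of_nat m) = f - d" "g + of_nat m - (d + of_nat m) = g - d"
      "f + of_nat m - u = of_nat m + (f - u)" "g + of_nat m - u = of_nat m + (g - u)" by simp_all
    ultimately show ?thesis unfolding R_def F32_reg_perm(1)[of _ "1 + a - g"] by (simp only: mult_ac)
  qed

  obtain C1 where C1: "C1 > 0" "\<And>m. norm (P m) \<le> C1 * (real m + 1) powr (Re ((e - b) + (e - c) - e) - 1)"
    unfolding P_def using Gauss_term_bound[of "e - b" "e - c" e] by metis
  obtain C2 where C2: "C2 > 0" "\<And>j. norm (Q j) \<le> C2 * (real j + 1) powr (Re ((1 + a - g) + (1 + a - f) - (1 + a - d)) - 1)"
    unfolding Q_def using Gauss_term_bound[of "1 + a - g" "1 + a - f" "1 + a - d"] by metis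
  obtain C3 where C3: "C3 > 0" "\<And>k. norm (Z k) \<le> C3 * (real k + 1) powr Re (a - (1 + a - u))"
    unfolding Z_def using pochhammer_rGamma_bound[of a "1 + a - u"] by metis
  have ex1: "Re ((e - b) + (e - c) - e) - 1 = - Re u - 1" by (simp add: u_def)
  have ex2: "Re ((1 + a - g) + (1 + a - f) - (1 + a - d)) - 1 = - Re u - 1" by (simp add: g)
  have ex3: "Re (a - (1 + a - u)) = Re u - 1" by simp
  \<comment> \<open>P and Q have order -Re u - 1 and Z has order Re u - 1. Splitting the growth of Z
    between m and j leaves the exponent -2 or -Re u - 1 in each index, according to whether Re u >=
    1.\<close>
  define t where "t = max (Re u - 1) 0"
  have t: "t \<ge> 0" "Re u - 1 \<le> t" "- Re u - 1 + t < -1" using re(1) by (auto simp: t_def)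
  define v where "v = (\<lambda>m j. P m * (Q j * Z (m + j)))"
  have vb: "norm (v m j) \<le> (C1 * C2 * C3) * ((real m + 1) powr (- Re u - 1 + t) * (real j + 1) powr (- Re u - 1 + t))" for m j
  proof -
    have "norm (Z (m + j)) \<le> C3 * (real (m + j) + 1) powr (Re u - 1)" using C3(2)[of "m + j"] unfolding ex3 .
    also have "\<dots> \<le> C3 * ((real m + 1) powr t * (real j + 1) powr t)"
      using C3(1) t by (intro mult_left_mono powr_Suc_add_le) auto
    finally have "norm (v m j) \<le> (C1 * (real m + 1) powr (- Re u - 1)) * ((C2 * (real j + 1) powr (- Re u - 1)) * (C3 * ((real m + 1) powr t * (real j + 1) powr t)))"
      unfolding v_def norm_mult using C1(2)[of m] C2(2)[of j] C1(1) C2(1) C3(1) unfolding ex1 ex2 by (intro mult_mono) auto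
    also have "\<dots> = (C1 * C2 * C3) * (((real m + 1) powr (- Re u - 1) * (real m + 1) powr t) * ((real j + 1) powr (- Re u - 1) * (real j + 1) powr t))"
      by (simp only: mult_ac)
    finally show ?thesis unfolding powr_add[symmetric] .
  qed
  obtain T where T: "((\<lambda>(m, j). v m j) has_sum T) (UNIV \<times> UNIV)"
    by (rule double_series_summable[OF vb t(3) t(3)])
  have sm: "summable (v m)" "summable (\<lambda>m. v m j)" for m j
  proof -
    show "summable (v m)" by (rule summable_norm_cancel[OF double_series_row_summable[OF vb t(3)]])
    have "norm (v m j) \<le> (C1 * C2 * C3) * ((real j + 1) powr (- Re u - 1 + t) * (real m + 1) powr (- Re u - 1 + t))" for m
      using vb[of m j] by (simp only: mult_ac)
    thus "summable (\<lambda>m. v m j)" by (intro summable_norm_cancel[OF double_series_row_summable[OF _ t(3)]])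
  qed
  have rows: "(\<lambda>m. P m * (pochhammer a m * R m)) sums T"
  proof -
    have "(\<Sum>j. Q j * Z (m + j)) = pochhammer a m * R m" for m
      unfolding Q_def Z_def R_def by (rule F32_reg_inner1) (use re(1) in \<open>simp add: g\<close>)
    moreover have "(\<Sum>j. v m j) = P m * (\<Sum>j. Q j * Z (m + j))" for m
    proof (cases "P m = 0")
      case False
      thus ?thesis using sm(1)[of m] unfolding v_def by (intro suminf_mult) (simp add: summable_cmult_iff)
    qed (simp add: v_def)
    ultimately show ?thesis using double_series_rows[OF T vb t(3)] by simp
  qed
  have cols: "(\<lambda>j. Q j * (pochhammer a j * F32_reg (a + of_nat j) (e - b) (e - c) (1 + a - u + of_nat j) e)) sums T"
  proof -
    have inner: "(\<Sum>m. P m * Z (j + m)) = pochhammer a j * F32_reg (a + of_nat j) (e - b) (e - c) (1 + a - u + of_nat j) e" for j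
      unfolding P_def Z_def F32_reg_perm(2)[of _ _ _ "1 + a - u + of_nat j"]
      by (rule F32_reg_inner1) (use re(1) in \<open>simp add: u_def\<close>)
    have v: "v m j = Q j * (P m * Z (j + m))" for m j by (simp add: v_def add.commute mult_ac)
    have "(\<Sum>m. v m j) = Q j * (\<Sum>m. P m * Z (j + m))" for j
    proof (cases "Q j = 0")
      case False
      thus ?thesis using sm(2)[of j] unfolding v by (intro suminf_mult) (simp add: summable_cmult_iff)
    qed (simp add: v)
    thus ?thesis using double_series_cols[OF T vb t(3)] inner by simp
  qed
  have sumB': "(\<lambda>j. Q j * (pochhammer a j * pochhammer (1 + a - e) j *
      F32_reg (a + of_nat j) (1 + a - e + of_nat j) u (1 + a - (e - b) + of_nat j) (1 + a - (e - c) + of_nat j))) sums B0'"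
  proof -
    define W where "W = (\<lambda>k. pochhammer a k * pochhammer (1 + a - e) k * (rGamma (of_nat k + (1 + a - (e - b))) * rGamma (of_nat k + (1 + a - (e - c)))))"
    obtain M where M: "M > 0" "\<And>k. norm (W k) \<le> M * (real k + 1) powr Re (a + (1 + a - e) - (1 + a - (e - b)) - (1 + a - (e - c)))"
      unfolding W_def using pochhammer_pair_bound[of a "1 + a - e" "1 + a - (e - b)" "1 + a - (e - c)"] by metis
    have u': "1 + a - (f - u) + (1 + a - (g - u)) - (1 + a - d) = u" by (simp add: g)
    have ex: "Re (a + (1 + a - e) - (1 + a - (e - b)) - (1 + a - (e - c))) = - Re (1 + a - (f - u) + (1 + a - (g - u)) - (1 + a - d)) - 1"
      unfolding u' by (simp add: u_def)
    have re': "Re (1 + a - (f - u) + (1 + a - (g - u)) - (1 + a - d)) > 0" unfolding u' by (rule re)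
    have nz': "1 + a - d \<notin> \<int>\<^sub>\<le>\<^sub>0" using np[OF shift(3)[OF nz(3)]] by (simp add: algebra_simps)
    obtain L where L: "(\<lambda>k. pochhammer (1 + a - (f - u)) k * pochhammer (1 + a - (g - u)) k / fact k * rGamma (of_nat k + (1 + a - d)) * W k) sums L"
      "(\<lambda>m. pochhammer ((1 + a - d) - (1 + a - (f - u))) m * pochhammer ((1 + a - d) - (1 + a - (g - u))) m / fact m * rGamma (of_nat m + (1 + a - d)) *
         (\<Sum>j. pochhammer (1 + a - (f - u) + (1 + a - (g - u)) - (1 + a - d)) j / fact j * W (m + j))) sums L"
      by (rule Saalschuetz_expansion[OF nz' re' M(2)[unfolded ex]])
    have "B0' = L" unfolding B0'_def F43_reg_def using sums_unique[OF L(1)] by (simp add: W_def mult_ac)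
    moreover have "(\<Sum>j. pochhammer u j / fact j * W (m + j)) = pochhammer a m * pochhammer (1 + a - e) m *
       F32_reg (a + of_nat m) (1 + a - e + of_nat m) u (1 + a - (e - b) + of_nat m) (1 + a - (e - c) + of_nat m)" for m
      unfolding W_def by (rule F32_reg_inner2) (simp add: u_def)
    moreover have "(1 + a - d) - (1 + a - (f - u)) = 1 + a - g" "(1 + a - d) - (1 + a - (g - u)) = 1 + a - f" by (simp_all add: g)
    ultimately show ?thesis using L(2) unfolding u' Q_def by simp
  qed
  \<comment> \<open>Now the product on the right-hand side supplies the denominators Gamma(j + 1 + a
    - b) and Gamma(j + 1 + a - c) of B0, so summation over j relates T, B0' and B0.\<close>
  have NS2: "F32_reg (a + of_nat j) (e - b) (e - c) (1 + a - u + of_nat j) e * (rGamma u * rGamma (of_nat j + (1 + a - e))) +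
     F32_reg (a + of_nat j) (1 + a - e + of_nat j) u (1 + a - (e - b) + of_nat j) (1 + a - (e - c) + of_nat j) * (rGamma (e - b) * rGamma (e - c)) =
     rGamma b * rGamma c * (rGamma (of_nat j + (1 + a - b)) * rGamma (of_nat j + (1 + a - c)))" for j
  proof -
    have "F32_reg (a + of_nat j) (e - b) (e - c) (1 + a - u + of_nat j) e *
        (rGamma (1 + (a + of_nat j) - (1 + a - u + of_nat j)) * rGamma (1 + (a + of_nat j) - e)) +
      F32_reg (a + of_nat j) (1 + (a + of_nat j) - (1 + a - u + of_nat j)) (1 + (a + of_nat j) - e) (1 + (a + of_nat j) - (e - b)) (1 + (a + of_nat j) - (e - c)) *
        (rGamma (e - b) * rGamma (e - c)) =
      rGamma ((1 + a - u + of_nat j) - (e - b)) * rGamma ((1 + a - u + of_nat j) - (e - c)) * rGamma (e - (e - b)) * rGamma (e - (e - c))"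
    proof (rule nonterminating_Saalschuetz)
      show "1 + a - u + of_nat j + e = a + of_nat j + (e - b) + (e - c) + 1" by (simp add: u_def)
      show "Re (a + of_nat j + (e - b) - (1 + a - u + of_nat j)) > 0" using re(2) by (simp add: u_def)
      show "1 + a - u + of_nat j \<notin> \<int>\<^sub>\<le>\<^sub>0" using np[OF shift(2)[OF nz(7), of j]] by (simp add: algebra_simps)
      show "1 + (a + of_nat j) - (e - b) \<notin> \<int>\<^sub>\<le>\<^sub>0" using np[OF shift(2)[OF nz(8), of j]] by (simp add: algebra_simps)
      show "1 + a - u + of_nat j - (e - b) - (e - c) \<notin> \<int>" using shift(2)[OF nz(9), of j] by (simp add: u_def algebra_simps)
      show "1 + a - u + of_nat j - (e - b) \<notin> \<int>" using shift(2)[OF nz(10), of j] by (simp add: u_def algebra_simps)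
      show "e - c \<notin> \<int>" by (rule nz)
    qed
    moreover have "1 + (a + of_nat j) - (1 + a - u + of_nat j) = u" "1 + (a + of_nat j) - e = of_nat j + (1 + a - e)"
      "1 + (a + of_nat j) - (e - b) = 1 + a - (e - b) + of_nat j" "1 + (a + of_nat j) - (e - c) = 1 + a - (e - c) + of_nat j"
      "1 + a - u + of_nat j - (e - b) = of_nat j + (1 + a - c)" "1 + a - u + of_nat j - (e - c) = of_nat j + (1 + a - b)"
      "e - (e - b) = b" "e - (e - c) = c" by (simp_all add: u_def)
    ultimately show ?thesis unfolding F32_reg_perm(1)[of _ "1 + a - e + of_nat j" u] by (simp only: mult_ac add.commute[of "1 + a - e"])
  qed
  have sumA': "(\<lambda>m. P m * (pochhammer a m * pochhammer d m * (rGamma (of_nat m + (f - u)) * rGamma (of_nat m + (g - u))))) sums A0'"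
  proof -
    have "F43_term a (e - b) (e - c) d e (f - u) (g - u) sums A0'"
      unfolding A0'_def by (rule sums_F43_term) (simp add: g u_def)
    moreover have "F43_term a (e - b) (e - c) d e (f - u) (g - u) = (\<lambda>m. P m * (pochhammer a m * pochhammer d m * (rGamma (of_nat m + (f - u)) * rGamma (of_nat m + (g - u)))))"
      by (simp add: F43_term_def P_def fun_eq_iff mult_ac)
    ultimately show ?thesis by simp
  qed
  have sumB: "(\<lambda>j. Q j * (pochhammer a j * pochhammer (1 + a - e) j * (rGamma (of_nat j + (1 + a - b)) * rGamma (of_nat j + (1 + a - c))))) sums B0"
  proof -
    have "F43_term a (1+a-e) (1+a-f) (1+a-g) (1+a-b) (1+a-c) (1+a-d) sums B0"
      unfolding B0_def by (rule sums_F43_term) (simp add: g u_def)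
    moreover have "F43_term a (1+a-e) (1+a-f) (1+a-g) (1+a-b) (1+a-c) (1+a-d) = (\<lambda>j. Q j * (pochhammer a j * pochhammer (1 + a - e) j * (rGamma (of_nat j + (1 + a - b)) * rGamma (of_nat j + (1 + a - c)))))"
      by (simp add: F43_term_def Q_def fun_eq_iff mult_ac)
    ultimately show ?thesis by simp
  qed
  have eq1: "A0 * (rGamma (1 + a - f) * rGamma (1 + a - g)) + T * (rGamma d * rGamma u) = A0' * (rGamma (f - d) * rGamma (g - d))"
  proof -
    have pd: "pochhammer d m * rGamma (d + of_nat m) = rGamma d" for m using pochhammer_times_rGamma[of d m] by (simp add: add.commute)
    have "P m * (pochhammer a m * pochhammer d m * F32_reg (a + of_nat m) (d + of_nat m) u (f + of_nat m) (g + of_nat m)) * (rGamma (1 + a - f) * rGamma (1 + a - g)) +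
        P m * (pochhammer a m * R m) * (rGamma d * rGamma u) =
      P m * (pochhammer a m * pochhammer d m * (rGamma (of_nat m + (f - u)) * rGamma (of_nat m + (g - u)))) * (rGamma (f - d) * rGamma (g - d))" for m
      using NS1[of m] pd[of m] by algebra
    moreover have "(\<lambda>m. P m * (pochhammer a m * pochhammer d m * F32_reg (a + of_nat m) (d + of_nat m) u (f + of_nat m) (g + of_nat m)) * (rGamma (1 + a - f) * rGamma (1 + a - g)) +
        P m * (pochhammer a m * R m) * (rGamma d * rGamma u)) sums (A0 * (rGamma (1 + a - f) * rGamma (1 + a - g)) + T * (rGamma d * rGamma u))"
      by (intro sums_add sums_mult2 sumA rows)
    ultimately show ?thesis using sums_mult2[OF sumA', of "rGamma (f - d) * rGamma (g - d)"] sums_unique2 by simp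
  qed
  have eq2: "T * (rGamma u * rGamma (1 + a - e)) + B0' * (rGamma (e - b) * rGamma (e - c)) = B0 * (rGamma b * rGamma c)"
  proof -
    have pe: "pochhammer (1 + a - e) j * rGamma (of_nat j + (1 + a - e)) = rGamma (1 + a - e)" for j by (rule pochhammer_times_rGamma)
    have "Q j * (pochhammer a j * F32_reg (a + of_nat j) (e - b) (e - c) (1 + a - u + of_nat j) e) * (rGamma u * rGamma (1 + a - e)) +
        Q j * (pochhammer a j * pochhammer (1 + a - e) j *
      F32_reg (a + of_nat j) (1 + a - e + of_nat j) u (1 + a - (e - b) + of_nat j) (1 + a - (e - c) + of_nat j)) * (rGamma (e - b) * rGamma (e - c)) =
      Q j * (pochhammer a j * pochhammer (1 + a - e) j * (rGamma (of_nat j + (1 + a - b)) * rGamma (of_nat j + (1 + a - c)))) * (rGamma b * rGamma c)" for j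
      using NS2[of j] pe[of j] by algebra
    moreover have "(\<lambda>j. Q j * (pochhammer a j * F32_reg (a + of_nat j) (e - b) (e - c) (1 + a - u + of_nat j) e) * (rGamma u * rGamma (1 + a - e)) +
        Q j * (pochhammer a j * pochhammer (1 + a - e) j *
      F32_reg (a + of_nat j) (1 + a - e + of_nat j) u (1 + a - (e - b) + of_nat j) (1 + a - (e - c) + of_nat j)) * (rGamma (e - b) * rGamma (e - c)))
      sums (T * (rGamma u * rGamma (1 + a - e)) + B0' * (rGamma (e - b) * rGamma (e - c)))"
      by (intro sums_add sums_mult2 sumB' cols)
    ultimately show ?thesis using sums_mult2[OF sumB, of "rGamma b * rGamma c"] sums_unique2 by simp
  qed
  have "1 + a - (f - u) = g - d" "1 + a - (g - u) = f - d" by (simp_all add: g)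
  hence "K7 a (e - b) (e - c) d e (f - u) (g - u) = A0' * (rGamma (1 + a - e) * rGamma (g - d) * rGamma (f - d)) + B0' * (rGamma (e - b) * rGamma (e - c) * rGamma d)"
    unfolding K7_def A0'_def B0'_def by simp
  moreover have "K7 a b c d e f g = A0 * (rGamma (1+a-e) * rGamma (1+a-f) * rGamma (1+a-g)) + B0 * (rGamma b * rGamma c * rGamma d)"
    unfolding K7_def A0_def B0_def ..
  \<comment> \<open>The first equation is multiplied by 1/Gamma(1 + a - e), the second by
    1/Gamma(d); T then occurs in both with the same coefficient and cancels.\<close>
  ultimately show ?thesis using eq1 eq2 by algebra
qed

section \<open>Locally uniform convergence and holomorphy of the balanced series\<close>

lemma quartic_ratio_bound:
  fixes e1 e2 e3 e4 f1 f2 f3 f4 :: complex and k P :: real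
  defines "N \<equiv> of_real k ^ 4 + e1 * of_real k ^ 3 + e2 * of_real k ^ 2 + e3 * of_real k + e4"
    and "D \<equiv> of_real k ^ 4 + f1 * of_real k ^ 3 + f2 * of_real k ^ 2 + f3 * of_real k + f4"
  assumes f1: "f1 = e1 + 2" and k: "k \<ge> 2" "k \<ge> 16 * P"
    and P: "norm (e2 - f2 + 2 * f1) + norm (e3 - f3 + 2 * f2) + norm (e4 - f4 + 2 * f3) + norm (2 * f4) \<le> P"
    and D: "norm D \<ge> k ^ 4 / 8"
  shows "norm N \<le> (1 - 3 / 2 / k) * norm D"
proof -
  \<comment> \<open>The coefficient of k^4 in the remainder vanishes by \<open>f1 = e1 + 2\<close>.
    What is left is at most P k^3 <= k^4 / 16 <= |D| / 2, which reduces the gain 2/k to 3/2/k, still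
    enough for a convergent majorant.\<close>
  have "of_real k * N = (of_real k - 2) * D + ((e2 - f2 + 2 * f1) * of_real k ^ 3 + (e3 - f3 + 2 * f2) * of_real k ^ 2 + (e4 - f4 + 2 * f3) * of_real k + 2 * f4)"
    unfolding N_def D_def f1 by algebra
  hence "norm (of_real k * N) \<le> norm ((of_real k - 2) * D) + (norm ((e2 - f2 + 2 * f1) * of_real k ^ 3) + norm ((e3 - f3 + 2 * f2) * of_real k ^ 2) + norm ((e4 - f4 + 2 * f3) * of_real k) + norm (2 * f4))"
    by (smt (verit) norm_triangle_ineq)
  also have "norm ((of_real k - 2) * D) = (k - 2) * norm D"
  proof -
    have "of_real k - 2 = (of_real (k - 2) :: complex)" by simp
    hence "norm (of_real k - 2 :: complex) = k - 2" using k by (simp only: norm_of_real)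
    thus ?thesis by (simp add: norm_mult)
  qed
  also have "norm ((e2 - f2 + 2 * f1) * of_real k ^ 3) + norm ((e3 - f3 + 2 * f2) * of_real k ^ 2) + norm ((e4 - f4 + 2 * f3) * of_real k) + norm (2 * f4) \<le> P * k ^ 3"
  proof -
    have kp: "k ^ 2 \<le> k ^ 3" "k \<le> k ^ 3" "1 \<le> k ^ 3"
      using k power_increasing[of 2 3 k] power_increasing[of 1 3 k] one_le_power[of k 3] by simp_all
    have "norm ((e2 - f2 + 2 * f1) * of_real k ^ 3) + norm ((e3 - f3 + 2 * f2) * of_real k ^ 2) + norm ((e4 - f4 + 2 * f3) * of_real k) + norm (2 * f4) =
      norm (e2 - f2 + 2 * f1) * k ^ 3 + norm (e3 - f3 + 2 * f2) * k ^ 2 + norm (e4 - f4 + 2 * f3) * k + norm (2 * f4) * 1"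
      using k by (simp add: norm_mult norm_power)
    also have "\<dots> \<le> norm (e2 - f2 + 2 * f1) * k ^ 3 + norm (e3 - f3 + 2 * f2) * k ^ 3 + norm (e4 - f4 + 2 * f3) * k ^ 3 + norm (2 * f4) * k ^ 3"
      by (intro add_mono mult_left_mono kp) auto
    also have "\<dots> = (norm (e2 - f2 + 2 * f1) + norm (e3 - f3 + 2 * f2) + norm (e4 - f4 + 2 * f3) + norm (2 * f4)) * k ^ 3" by (simp add: algebra_simps)
    also have "\<dots> \<le> P * k ^ 3" using P k by (intro mult_right_mono) auto
    finally show ?thesis .
  qed
  also have "P * k ^ 3 \<le> 1 / 2 * norm D"
  proof -
    have "16 * P * k ^ 3 \<le> k * k ^ 3" using k by (intro mult_right_mono) auto
    also have "k * k ^ 3 = k ^ 4" by (simp add: power_numeral_reduce)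
    finally show ?thesis using D by simp
  qed
  finally have "k * norm N \<le> (k - 3 / 2) * norm D" using k by (simp add: norm_mult algebra_simps)
  hence "norm N \<le> (k - 3 / 2) * norm D / k" using k by (simp add: field_simps)
  also have "\<dots> = (1 - 3 / 2 / k) * norm D" using k by (simp add: field_simps)
  finally show ?thesis .
qed

text \<open>In this form the ratio bounds telescope, and the terms are bounded by a multiple of
  k^(-3/2).\<close>

lemma one_minus_le_powr_ratio:
  assumes "k > (0::real)"
  shows "1 - 3 / 2 / k \<le> (k / (k + 1)) powr (3 / 2)"
proof -
  have "1 - 3 / 2 / k \<le> exp (- (3 / 2 / k))" using exp_ge_add_one_self[of "- (3 / 2 / k)"] by simp
  also have "ln (1 + 1 / k) \<le> 1 / k" using assms by (intro ln_add_one_self_le_self) auto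
  hence "exp (- (3 / 2 / k)) \<le> exp (- (3 / 2) * ln (1 + 1 / k))" by simp
  also have "\<dots> = (k / (k + 1)) powr (3 / 2)"
  proof -
    have "ln (k / (k + 1)) = - ln (1 + 1 / k)"
      using assms by (simp add: ln_div[symmetric] ln_inverse[symmetric] field_simps flip: ln_inverse)
    thus ?thesis using assms by (simp add: powr_def)
  qed
  finally show ?thesis .
qed

lemma F43_term_Suc:
  assumes "E + of_nat k \<noteq> 0" "F + of_nat k \<noteq> 0" "G + of_nat k \<noteq> 0"
  shows "F43_term A B C D E F G (Suc k) =
    F43_term A B C D E F G k * ((A + of_nat k) * (B + of_nat k) * (C + of_nat k) * (D + of_nat k)) /
      ((1 + of_nat k) * (E + of_nat k) * (F + of_nat k) * (G + of_nat k))"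
proof -
  have r: "rGamma (of_nat (Suc k) + X) = rGamma (of_nat k + X) / (X + of_nat k)" if "X + of_nat k \<noteq> 0" for X :: complex
    using rGamma_plus1[of "of_nat k + X"] that by (simp add: field_simps add_ac)
  show ?thesis unfolding F43_term_def r[OF assms(1)] r[OF assms(2)] r[OF assms(3)]
    by (simp add: pochhammer_Suc mult_ac)
qed

text \<open>\<open>pochhammer_rGamma_bound\<close> has constants that are not controlled in the
  parameters. A uniform majorant on closed unit discs comes instead from the ratio of consecutive
  terms, a quotient of two monic quartics in k whose cubic coefficients differ by exactly 2 because
  of the balance.\<close>

lemma F43_reg_holomorphic:
  fixes A B C D E F G :: "complex \<Rightarrow> complex"
  assumes hol: "A holomorphic_on UNIV" "B holomorphic_on UNIV" "C holomorphic_on UNIV" "D holomorphic_on UNIV"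
      "E holomorphic_on UNIV" "F holomorphic_on UNIV" "G holomorphic_on UNIV"
    and bal: "\<And>z. E z + F z + G z - A z - B z - C z - D z = 1"
  shows "(\<lambda>z. F43_reg (A z) (B z) (C z) (D z) (E z) (F z) (G z)) holomorphic_on UNIV"
proof (rule holomorphic_uniform_sequence)
  define t where "t = (\<lambda>k z. F43_term (A z) (B z) (C z) (D z) (E z) (F z) (G z) k)"
  have term_hol: "t k holomorphic_on UNIV" for k
    unfolding t_def F43_term_def [abs_def] pochhammer_prod
    by (intro holomorphic_intros hol holomorphic_rGamma') auto
  show "open (UNIV :: complex set)" by simp
  show "(\<lambda>z. \<Sum>k<n. t k z) holomorphic_on UNIV" for n by (intro holomorphic_on_sum term_hol)
  fix x :: complex
  have bounded: "\<exists>M. \<forall>z\<in>cball x 1. norm (h z) \<le> M" if "h holomorphic_on UNIV" for h :: "complex \<Rightarrow> complex"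
  proof -
    have "continuous_on (cball x 1) h"
      using holomorphic_on_imp_continuous_on[OF that] continuous_on_subset by blast
    hence "bounded (h ` cball x 1)" by (intro compact_imp_bounded compact_continuous_image) auto
    thus ?thesis unfolding bounded_iff by blast
  qed
  \<comment> \<open>Elementary symmetric functions of A, B, C, D and of 1, E, F, G: the coefficients
    of the numerator and of the denominator of the term ratio.\<close>
  define e1 e2 e3 e4 f1 f2 f3 f4 where
    "e1 = (\<lambda>z. A z + B z + C z + D z)" and
    "e2 = (\<lambda>z. A z * B z + A z * C z + A z * D z + B z * C z + B z * D z + C z * D z)" and
    "e3 = (\<lambda>z. A z * B z * C z + A z * B z * D z + A z * C z * D z + B z * C z * D z)" and
    "e4 = (\<lambda>z. A z * B z * C z * D z)" and
    "f1 = (\<lambda>z. 1 + E z + F z + G z)" and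
    "f2 = (\<lambda>z. E z + F z + G z + E z * F z + E z * G z + F z * G z)" and
    "f3 = (\<lambda>z. E z * F z + E z * G z + F z * G z + E z * F z * G z)" and
    "f4 = (\<lambda>z. E z * F z * G z)"
  have h: "(\<lambda>z. e2 z - f2 z + 2 * f1 z) holomorphic_on UNIV" "(\<lambda>z. e3 z - f3 z + 2 * f2 z) holomorphic_on UNIV"
    "(\<lambda>z. e4 z - f4 z + 2 * f3 z) holomorphic_on UNIV" "(\<lambda>z. 2 * f4 z) holomorphic_on UNIV"
    unfolding e2_def e3_def e4_def f1_def f2_def f3_def f4_def by (intro holomorphic_intros hol)+
  obtain M1 where M1: "\<And>z. z \<in> cball x 1 \<Longrightarrow> norm (e2 z - f2 z + 2 * f1 z) \<le> M1" using bounded[OF h(1)] by blast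
  obtain M2 where M2: "\<And>z. z \<in> cball x 1 \<Longrightarrow> norm (e3 z - f3 z + 2 * f2 z) \<le> M2" using bounded[OF h(2)] by blast
  obtain M3 where M3: "\<And>z. z \<in> cball x 1 \<Longrightarrow> norm (e4 z - f4 z + 2 * f3 z) \<le> M3" using bounded[OF h(3)] by blast
  obtain M4 where M4: "\<And>z. z \<in> cball x 1 \<Longrightarrow> norm (2 * f4 z) \<le> M4" using bounded[OF h(4)] by blast
  obtain ME where ME: "\<And>z. z \<in> cball x 1 \<Longrightarrow> norm (E z) \<le> ME" using bounded[OF hol(5)] by blast
  obtain MF where MF: "\<And>z. z \<in> cball x 1 \<Longrightarrow> norm (F z) \<le> MF" using bounded[OF hol(6)] by blast
  obtain MG where MG: "\<And>z. z \<in> cball x 1 \<Longrightarrow> norm (G z) \<le> MG" using bounded[OF hol(7)] by blast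
  define P where "P = M1 + M2 + M3 + M4"
  \<comment> \<open>Beyond X the hypotheses of \<open>quartic_ratio_bound\<close> hold, and E + k, F
    + k, G + k have modulus at least k/2, so that the denominator is at least k (k/2)^3 = k^4 /
    8.\<close>
  define X where "X = max (max 2 (16 * P)) (max (2 * ME) (max (2 * MF) (2 * MG)))"
  define n0 where "n0 = nat \<lceil>X\<rceil>"
  have n0: "real n0 \<ge> X" unfolding n0_def by linarith
  obtain M0 where M0: "\<And>z. z \<in> cball x 1 \<Longrightarrow> norm (t n0 z) \<le> M0" using bounded[OF term_hol] by blast
  have decay: "norm (t (Suc k) z) \<le> (real k / (real k + 1)) powr (3 / 2) * norm (t k z)" if k: "k \<ge> n0" and z: "z \<in> cball x 1" for k z
  proof -
    have kX: "real k \<ge> X" using k n0 by linarith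
    have k2: "real k \<ge> 2" "real k \<ge> 16 * P" "real k / 2 \<ge> ME" "real k / 2 \<ge> MF" "real k / 2 \<ge> MG"
      using kX unfolding X_def by auto
    have low: "norm (w + of_nat k) \<ge> real k / 2" if "norm w \<le> real k / 2" for w :: complex
      using norm_triangle_ineq2[of "of_nat k" "- w"] that by (simp add: add.commute)
    have lowE: "norm (E z + of_nat k) \<ge> real k / 2" "norm (F z + of_nat k) \<ge> real k / 2" "norm (G z + of_nat k) \<ge> real k / 2"
      using ME[OF z] MF[OF z] MG[OF z] k2 by (intro low; linarith)+
    have nz: "E z + of_nat k \<noteq> 0" "F z + of_nat k \<noteq> 0" "G z + of_nat k \<noteq> 0"
      using lowE k2(1) by auto
    define Den where "Den = (1 + of_nat k) * (E z + of_nat k) * (F z + of_nat k) * (G z + of_nat k)"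
    define Num where "Num = (A z + of_nat k) * (B z + of_nat k) * (C z + of_nat k) * (D z + of_nat k)"
    have Den: "Den = of_real (real k) ^ 4 + f1 z * of_real (real k) ^ 3 + f2 z * of_real (real k) ^ 2 + f3 z * of_real (real k) + f4 z"
      unfolding Den_def f1_def f2_def f3_def f4_def of_real_of_nat_eq by algebra
    have Num: "Num = of_real (real k) ^ 4 + e1 z * of_real (real k) ^ 3 + e2 z * of_real (real k) ^ 2 + e3 z * of_real (real k) + e4 z"
      unfolding Num_def e1_def e2_def e3_def e4_def of_real_of_nat_eq by algebra
    have nDen: "norm Den \<ge> real k ^ 4 / 8"
    proof -
      have "norm (1 + of_nat k :: complex) = 1 + real k" by (metis norm_of_nat of_nat_Suc)
      hence "real k \<le> norm (1 + of_nat k :: complex)" by simp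
      hence "real k * (real k / 2) * (real k / 2) * (real k / 2) \<le> norm Den"
        unfolding Den_def norm_mult using lowE by (intro mult_mono) auto
      thus ?thesis by (simp add: power4_eq_xxxx)
    qed
    have "norm Num \<le> (1 - 3 / 2 / real k) * norm Den"
      unfolding Num Den
    proof (rule quartic_ratio_bound[where P = P])
      show "f1 z = e1 z + 2" using bal[of z] unfolding f1_def e1_def by algebra
      show "norm (e2 z - f2 z + 2 * f1 z) + norm (e3 z - f3 z + 2 * f2 z) + norm (e4 z - f4 z + 2 * f3 z) + norm (2 * f4 z) \<le> P"
        unfolding P_def by (intro add_mono M1 M2 M3 M4 z)
      show "real k ^ 4 / 8 \<le> norm (of_real (real k) ^ 4 + f1 z * of_real (real k) ^ 3 + f2 z * of_real (real k) ^ 2 + f3 z * of_real (real k) + f4 z)"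
        using nDen unfolding Den .
    qed (use k2 in auto)
    also have "\<dots> \<le> (real k / (real k + 1)) powr (3 / 2) * norm Den"
      using k2 by (intro mult_right_mono one_minus_le_powr_ratio) auto
    finally have r: "norm Num \<le> (real k / (real k + 1)) powr (3 / 2) * norm Den" .
    have Den0: "norm Den > 0" using nDen k2(1) by (metis divide_pos_pos less_le_trans not_numeral_le_zero order_le_less zero_less_numeral zero_less_power of_nat_0_le_iff)
    have "t (Suc k) z = t k z * Num / Den"
      unfolding t_def Num_def Den_def by (rule F43_term_Suc[OF nz])
    hence "norm (t (Suc k) z) = norm (t k z) * (norm Num / norm Den)" by (simp add: norm_mult norm_divide)
    also have "\<dots> \<le> norm (t k z) * (real k / (real k + 1)) powr (3 / 2)"
      using r Den0 by (intro mult_left_mono) (auto simp: divide_le_eq)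
    finally show ?thesis by (simp add: mult.commute)
  qed
  have X2: "X \<ge> 2" unfolding X_def by simp
  have bnd: "norm (t k z) \<le> (M0 * real n0 powr (3 / 2)) * real k powr (- 3 / 2)" if "k \<ge> n0" "z \<in> cball x 1" for k z
    using that(1)
  proof (induction k rule: dec_induct)
    case base
    have "n0 > 0" using n0 X2 by (cases n0) auto
    hence "real n0 powr (3 / 2) * real n0 powr (- 3 / 2) = 1" by (simp add: powr_add[symmetric])
    thus ?case using M0[OF that(2)] by (simp add: mult.assoc)
  next
    case (step k)
    have k0: "real k > 0" using step(1) n0 X2 by linarith
    have "norm (t (Suc k) z) \<le> (real k / (real k + 1)) powr (3 / 2) * norm (t k z)" by (rule decay) (use step that in auto)
    also have "\<dots> \<le> (real k / (real k + 1)) powr (3 / 2) * ((M0 * real n0 powr (3 / 2)) * real k powr (- 3 / 2))"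
      by (intro mult_left_mono step.IH) auto
    also have "\<dots> = (M0 * real n0 powr (3 / 2)) * ((real k / (real k + 1)) powr (3 / 2) * real k powr (- 3 / 2))" by (simp only: mult_ac)
    also have "(real k / (real k + 1)) powr (3 / 2) * real k powr (- 3 / 2) = real (Suc k) powr (- 3 / 2)"
      using k0 by (simp add: powr_divide powr_minus field_simps)
    finally show ?case .
  qed
  show "\<exists>d. 0 < d \<and> cball x d \<subseteq> UNIV \<and> uniform_limit (cball x d) (\<lambda>n z. \<Sum>k<n. t k z)
      (\<lambda>z. F43_reg (A z) (B z) (C z) (D z) (E z) (F z) (G z)) sequentially"
  proof (intro exI[of _ 1] conjI)
    have "uniform_limit (cball x 1) (\<lambda>n z. \<Sum>k<n. t k z) (\<lambda>z. \<Sum>k. t k z) sequentially"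
    proof (rule Weierstrass_m_test_ev)
      show "\<forall>\<^sub>F k in sequentially. \<forall>z\<in>cball x 1. norm (t k z) \<le> (M0 * real n0 powr (3 / 2)) * real k powr (- 3 / 2)"
        using eventually_ge_at_top[of n0] by eventually_elim (use bnd in blast)
      show "summable (\<lambda>k. (M0 * real n0 powr (3 / 2)) * real k powr (- 3 / 2))"
        by (intro summable_mult) (simp add: summable_real_powr_iff)
    qed
    thus "uniform_limit (cball x 1) (\<lambda>n z. \<Sum>k<n. t k z) (\<lambda>z. F43_reg (A z) (B z) (C z) (D z) (E z) (F z) (G z)) sequentially"
      by (simp add: F43_reg_suminf t_def)
  qed auto
qed

lemma K7_holomorphic:
  fixes a b c d e f g :: "complex \<Rightarrow> complex"
  assumes hol: "a holomorphic_on UNIV" "b holomorphic_on UNIV" "c holomorphic_on UNIV" "d holomorphic_on UNIV"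
      "e holomorphic_on UNIV" "f holomorphic_on UNIV" "g holomorphic_on UNIV"
    and bal: "\<And>z. e z + f z + g z = 1 + a z + b z + c z + d z"
  shows "(\<lambda>z. K7 (a z) (b z) (c z) (d z) (e z) (f z) (g z)) holomorphic_on UNIV"
proof -
  have g: "g = (\<lambda>z. 1 + a z + b z + c z + d z - e z - f z)" using bal by (simp add: fun_eq_iff algebra_simps)
  show ?thesis unfolding K7_def
    by (intro holomorphic_on_add holomorphic_on_mult F43_reg_holomorphic holomorphic_rGamma' holomorphic_on_diff holomorphic_on_const hol)
       (simp_all add: g)
qed

text \<open>The form of the identity theorem used for removing genericity: equality near one point
  of a complex line, here w, gives equality at every other point z of it.\<close>

lemma entire_eqI:
  fixes F G :: "complex \<Rightarrow> complex"
  assumes "F holomorphic_on UNIV" "G holomorphic_on UNIV" "eventually (\<lambda>z. F z = G z) (nhds w)"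
  shows "F z = G z"
proof -
  obtain U where U: "open U" "w \<in> U" "\<And>z. z \<in> U \<Longrightarrow> F z = G z"
    using assms(3) unfolding eventually_nhds by blast
  have "F z - G z = 0"
  proof (rule analytic_continuation[where f = "\<lambda>z. F z - G z" and S = UNIV and U = U and \<xi> = w])
    show "(\<lambda>z. F z - G z) holomorphic_on UNIV" by (intro holomorphic_intros assms)
    show "w islimpt U" using U by (intro interior_limit_point) (simp add: interior_open)
  qed (use U in auto)
  thus ?thesis by simp
qed

lemma not_Ints_between:
  assumes "of_int n < Re z" "Re z < of_int n + 1"
  shows "z \<notin> \<int>"
proof
  assume "z \<in> \<int>"
  then obtain m where "z = of_int m" by (elim Ints_cases)
  thus False using assms by simp
qed

lemma eventually_not_Ints:
  fixes h :: "complex \<Rightarrow> complex"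
  assumes "isCont h w" "h w \<notin> \<int>"
  shows "eventually (\<lambda>z. h z \<notin> \<int>) (nhds w)"
proof -
  have "filterlim h (nhds (h w)) (nhds w)" using assms(1) by (simp add: tendsto_at_iff_tendsto_nhds isCont_def)
  moreover have "open (- \<int> :: complex set)" by (simp add: closed_Ints open_Compl)
  ultimately have "eventually (\<lambda>z. h z \<in> - \<int>) (nhds w)" using assms(2) by (intro topological_tendstoD) auto
  thus ?thesis by simp
qed

lemma eventually_Re_greater:
  fixes h :: "complex \<Rightarrow> complex"
  assumes "isCont h w" "Re (h w) > r"
  shows "eventually (\<lambda>z. Re (h z) > r) (nhds w)"
proof -
  have "filterlim h (nhds (h w)) (nhds w)" using assms(1) by (simp add: tendsto_at_iff_tendsto_nhds isCont_def)
  hence "filterlim (\<lambda>z. Re (h z)) (nhds (Re (h w))) (nhds w)" by (intro tendsto_intros)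
  thus ?thesis using assms(2) by (rule order_tendstoD)
qed

text \<open>Up to exchanging b and c this is invariance under \<open>gen_4\<close>. Together with
  the evident permutations of b, c, d and of e, f, g it generates the whole symmetry group
  \<open>G_K\<close>.\<close>

theorem K7_transform:
  assumes bal: "e + f + g = 1 + a + b + c + d"
  shows "K7 a b c d e f g = K7 a (e - b) (e - c) d e (f - (b + c - e)) (g - (b + c - e))"
proof -
  \<comment> \<open>Complex line from a point satisfying the hypotheses of \<open>K7_transform_generic\<close> to the given one.\<close>
  define l :: "complex \<Rightarrow> complex \<Rightarrow> complex \<Rightarrow> complex" where "l = (\<lambda>p q z. p + z * (q - p))"
  define A B C D E F G where "A = l (14/100) a" and "B = l 0 b" and "C = l (150/100) c" and "D = l (9/100) d"
    and "E = l (30/100) e" and "F = l (8/100) f" and "G = l (235/100) g"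
  note defs = A_def B_def C_def D_def E_def F_def G_def l_def
  have hol: "A holomorphic_on UNIV" "B holomorphic_on UNIV" "C holomorphic_on UNIV" "D holomorphic_on UNIV"
     "E holomorphic_on UNIV" "F holomorphic_on UNIV" "G holomorphic_on UNIV"
    unfolding defs by (intro holomorphic_intros)+
  have bal': "E z + F z + G z = 1 + A z + B z + C z + D z" for z
  proof -
    have "E z + F z + G z - (1 + A z + B z + C z + D z) = z * (e + f + g - (1 + a + b + c + d))"
      unfolding defs by (simp add: algebra_simps)
    thus ?thesis using bal by simp
  qed
  have "K7 (A z) (B z) (C z) (D z) (E z) (F z) (G z) =
      K7 (A z) (E z - B z) (E z - C z) (D z) (E z) (F z - (B z + C z - E z)) (G z - (B z + C z - E z))" for z
  proof (rule entire_eqI[where w = 0 and F = "\<lambda>z. K7 (A z) (B z) (C z) (D z) (E z) (F z) (G z)" and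
        G = "\<lambda>z. K7 (A z) (E z - B z) (E z - C z) (D z) (E z) (F z - (B z + C z - E z)) (G z - (B z + C z - E z))"])
    show "(\<lambda>z. K7 (A z) (B z) (C z) (D z) (E z) (F z) (G z)) holomorphic_on UNIV"
      by (intro K7_holomorphic hol bal')
    show "(\<lambda>z. K7 (A z) (E z - B z) (E z - C z) (D z) (E z) (F z - (B z + C z - E z)) (G z - (B z + C z - E z))) holomorphic_on UNIV"
    proof -
      have h2: "(\<lambda>z. E z - B z) holomorphic_on UNIV" "(\<lambda>z. E z - C z) holomorphic_on UNIV"
        "(\<lambda>z. F z - (B z + C z - E z)) holomorphic_on UNIV" "(\<lambda>z. G z - (B z + C z - E z)) holomorphic_on UNIV"
        by (intro holomorphic_on_diff holomorphic_on_add hol)+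
      have "E z + (F z - (B z + C z - E z)) + (G z - (B z + C z - E z)) = 1 + A z + (E z - B z) + (E z - C z) + D z" for z
        using bal'[of z] by algebra
      from K7_holomorphic[OF hol(1) h2(1,2) hol(4,5) h2(3,4) this] show ?thesis .
    qed
    \<comment> \<open>Non-integrality and strict inequalities of real parts are open conditions, so
      it is enough that the numerical starting point at z = 0 satisfies them.\<close>
    have ev: "eventually (\<lambda>z. E z \<notin> \<int>) (nhds 0)" "eventually (\<lambda>z. F z \<notin> \<int>) (nhds 0)"
      "eventually (\<lambda>z. A z - D z \<notin> \<int>) (nhds 0)" "eventually (\<lambda>z. F z - D z - (B z + C z - E z) \<notin> \<int>) (nhds 0)"
      "eventually (\<lambda>z. F z - D z \<notin> \<int>) (nhds 0)" "eventually (\<lambda>z. B z + C z - E z \<notin> \<int>) (nhds 0)"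
      "eventually (\<lambda>z. A z - (B z + C z - E z) \<notin> \<int>) (nhds 0)" "eventually (\<lambda>z. A z + B z - E z \<notin> \<int>) (nhds 0)"
      "eventually (\<lambda>z. A z - E z \<notin> \<int>) (nhds 0)" "eventually (\<lambda>z. A z - C z \<notin> \<int>) (nhds 0)" "eventually (\<lambda>z. E z - C z \<notin> \<int>) (nhds 0)"
      by (rule eventually_not_Ints, simp add: defs, rule not_Ints_between[of 0] not_Ints_between[of "-1"] not_Ints_between[of "-2"] not_Ints_between[of 1]; simp add: defs)+
    have evR: "eventually (\<lambda>z. Re (B z + C z - E z) > 0) (nhds 0)" "eventually (\<lambda>z. Re (C z) > 1) (nhds 0)"
      "eventually (\<lambda>z. Re (G z - (B z + C z - E z)) > 1) (nhds 0)"
      by (rule eventually_Re_greater; simp add: defs)+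
    show "eventually (\<lambda>z. K7 (A z) (B z) (C z) (D z) (E z) (F z) (G z) =
      K7 (A z) (E z - B z) (E z - C z) (D z) (E z) (F z - (B z + C z - E z)) (G z - (B z + C z - E z))) (nhds 0)"
      using ev evR by eventually_elim (rule K7_transform_generic[OF bal'])
  qed
  from this[of 1] show ?thesis by (simp add: defs)
qed

section \<open>The three-term relation\<close>

lemma sin_pi_minus [simp]: "sin_pi (- z) = - sin_pi z"
  by (simp add: sin_pi_def)

lemma sin_pi_diff_commute: "sin_pi (x - y) = - sin_pi (y - x)"
  using sin_pi_minus[of "y - x"] by simp

lemma sin_pi_one_minus: "sin_pi (1 - z) = sin_pi z"
proof -
  have "sin (of_real pi :: complex) = 0" "cos (of_real pi :: complex) = -1"
    by (simp_all add: sin_of_real cos_of_real)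
  thus ?thesis by (simp add: sin_pi_def right_diff_distrib sin_diff)
qed

lemma rGamma_reflection_sin_pi: "of_real pi * (rGamma z * rGamma (1 - z)) = sin_pi z"
  by (simp add: rGamma_reflection_complex sin_pi_def)

lemma sin_pi_times_sin_pi:
  "sin_pi x * sin_pi y = (cos (of_real pi * (x - y)) - cos (of_real pi * (x + y))) / 2"
  by (simp add: sin_pi_def sin_times_sin distrib_left right_diff_distrib)

text \<open>The three-term Pluecker relation, or Ptolemy's theorem, for the points x, y, z,
  w.\<close>

lemma sin_pi_Pluecker: "sin_pi (x - y) * sin_pi (z - w) + sin_pi (y - w) * sin_pi (z - x) = sin_pi (x - w) * sin_pi (z - y)"
  by (simp add: sin_pi_def right_diff_distrib sin_diff) (simp add: algebra_simps)

text \<open>In the product-to-sum formula both products on the left contain the same term cos(pi (p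
  - q)), which cancels.\<close>

lemma sin_pi_difference: "sin_pi (p - x) * sin_pi (q - x) - sin_pi (p - y) * sin_pi (q - y) = sin_pi (y - x) * sin_pi (p + q - x - y)"
proof -
  have *: "(p - x) - (q - x) = p - q" "(p - x) + (q - x) = p + q - 2 * x" "(p - y) - (q - y) = p - q" "(p - y) + (q - y) = p + q - 2 * y"
    "(y - x) - (p + q - x - y) = - (p + q - 2 * y)" "(y - x) + (p + q - x - y) = p + q - 2 * x" by simp_all
  show ?thesis unfolding sin_pi_times_sin_pi * mult_minus_right cos_minus by (simp add: field_simps)
qed

text \<open>The series Ba occurs only in the first value of \<open>K\<close> and Ae only in the
  third, which fixes the outer coefficients up to a common factor. A0 is shared by the first two
  values and Bb by the last two; each of them determines the middle coefficient, and
  \<open>trig\<close> shows that the two answers coincide.\<close>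

theorem three_term_relation_generic:
  fixes a b c d e f g :: complex
  assumes bal: "e + f + g = 1 + a + b + c + d"
    and nz: "a \<notin> \<int>" "b \<notin> \<int>" "e \<notin> \<int>" "a - b \<notin> \<int>" "1 + a - e \<notin> \<int>" "1 + b - e \<notin> \<int>"
  shows "of_real pi ^ 3 * sin_pi e * (rGamma (e - a) * rGamma (1 + b - e) * rGamma (1 + b - f) * rGamma (1 + b - g) * rGamma (g - a) * rGamma (f - a)) * K7 a b c d e f g
    + sin_pi (e - a) * (sin_pi (a - b) * sin_pi c * sin_pi d - sin_pi e * sin_pi (f - a) * sin_pi (g - a)) * K7 b a c d e f g
    - of_real pi ^ 3 * sin_pi (a - b) * (rGamma a * rGamma (e - a) * rGamma c * rGamma d * rGamma (e - c) * rGamma (e - d)) *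
        K7 (1 + b - e) (1 + a - e) (1 + c - e) (1 + d - e) (2 - e) (1 + f - e) (1 + g - e) = 0"
proof -
  have g: "g = 1 + a + b + c + d - e - f" using bal by (simp add: algebra_simps)
  define A0 where "A0 = F43_reg a b c d e f g"
  define Ae where "Ae = F43_reg (1 + a - e) (1 + b - e) (1 + c - e) (1 + d - e) (2 - e) (1 + f - e) (1 + g - e)"
  define Ba where "Ba = F43_reg a (1 + a - e) (1 + a - f) (1 + a - g) (1 + a - b) (1 + a - c) (1 + a - d)"
  define Bb where "Bb = F43_reg b (1 + b - e) (1 + b - f) (1 + b - g) (1 + b - a) (1 + b - c) (1 + b - d)"
  have K1: "K7 a b c d e f g = A0 * (rGamma (1 + a - e) * rGamma (1 + a - f) * rGamma (1 + a - g)) + Ba * (rGamma b * rGamma c * rGamma d)"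
    by (simp only: K7_def A0_def Ba_def)
  have K2: "K7 b a c d e f g = A0 * (rGamma (1 + b - e) * rGamma (1 + b - f) * rGamma (1 + b - g)) + Bb * (rGamma a * rGamma c * rGamma d)"
    unfolding K7_def A0_def Bb_def F43_reg_commute[of a b] ..
  have K3: "K7 (1 + b - e) (1 + a - e) (1 + c - e) (1 + d - e) (2 - e) (1 + f - e) (1 + g - e) =
      Ae * (rGamma b * rGamma (1 + b - f) * rGamma (1 + b - g)) + Bb * (rGamma (1 + a - e) * rGamma (1 + c - e) * rGamma (1 + d - e))"
  proof -
    have s: "1 + (1 + b - e) - (2 - e) = b" "1 + (1 + b - e) - (1 + f - e) = 1 + b - f" "1 + (1 + b - e) - (1 + g - e) = 1 + b - g"
      "1 + (1 + b - e) - (1 + a - e) = 1 + b - a" "1 + (1 + b - e) - (1 + c - e) = 1 + b - c" "1 + (1 + b - e) - (1 + d - e) = 1 + b - d"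
      by simp_all
    show ?thesis unfolding K7_def s Ae_def Bb_def F43_reg_commute[of "1 + b - e"] ..
  qed
  \<comment> \<open>By the balance the quantity s of \<open>Barnes_residue_relation\<close> equals 2
    for this choice of parameters.\<close>
  have rel: "Barnes_coeff a b 0 (1 - e) f g * Ba + Barnes_coeff b a 0 (1 - e) f g * Bb =
     Barnes_coeff 0 (1 - e) a b (1 - c) (1 - d) * A0 + Barnes_coeff (1 - e) 0 a b (1 - c) (1 - d) * Ae"
  proof -
    have "Re (f + g + (1 - c) + (1 - d) - a - b - 0 - (1 - e)) > 1" by (simp add: g)
    moreover have "0 - (1 - e) \<notin> \<int>"
    proof
      assume "0 - (1 - e) \<in> \<int>"
      hence "0 - (1 - e) + 1 \<in> \<int>" by (rule Ints_add) simp
      thus False using nz(3) by simp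
    qed
    moreover have "a + (1 - e) \<notin> \<int>" "b + (1 - e) \<notin> \<int>" "a + 0 \<notin> \<int>" "b + 0 \<notin> \<int>"
      using nz by (simp_all add: algebra_simps)
    ultimately have *: "Barnes_coeff a b 0 (1 - e) f g *
           F43_reg (a + 0) (a + (1 - e)) (1 + a - f) (1 + a - g) (1 + a - b) (a + (1 - c)) (a + (1 - d)) +
         Barnes_coeff b a 0 (1 - e) f g *
           F43_reg (b + 0) (b + (1 - e)) (1 + b - f) (1 + b - g) (1 + b - a) (b + (1 - c)) (b + (1 - d)) =
         Barnes_coeff 0 (1 - e) a b (1 - c) (1 - d) *
           F43_reg (0 + a) (0 + b) (1 + 0 - (1 - c)) (1 + 0 - (1 - d)) (1 + 0 - (1 - e)) (0 + f) (0 + g) +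
         Barnes_coeff (1 - e) 0 a b (1 - c) (1 - d) *
           F43_reg ((1 - e) + a) ((1 - e) + b) (1 + (1 - e) - (1 - c)) (1 + (1 - e) - (1 - d)) (1 + (1 - e) - 0) ((1 - e) + f) ((1 - e) + g)"
      using nz(4) by (intro Barnes_residue_relation)
    have s: "a + 0 = a" "b + 0 = b" "a + (1 - e) = 1 + a - e" "b + (1 - e) = 1 + b - e" "a + (1 - c) = 1 + a - c" "a + (1 - d) = 1 + a - d"
      "b + (1 - c) = 1 + b - c" "b + (1 - d) = 1 + b - d" "0 + a = a" "0 + b = b" "1 + 0 - (1 - c) = c" "1 + 0 - (1 - d) = d" "1 + 0 - (1 - e) = e"
      "0 + f = f" "0 + g = g" "1 - e + a = 1 + a - e" "1 - e + b = 1 + b - e" "1 + (1 - e) - (1 - c) = 1 + c - e" "1 + (1 - e) - (1 - d) = 1 + d - e"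
      "1 + (1 - e) - 0 = 2 - e" "1 - e + f = 1 + f - e" "1 - e + g = 1 + g - e" by simp_all
    show ?thesis using * unfolding s A0_def Ae_def Ba_def Bb_def .
  qed
  have sn: "sin_pi e \<noteq> 0" "sin_pi (b - a) \<noteq> 0"
    using sin_pi_neq_0[OF nz(3)] sin_pi_neq_0[OF nz(4)] by (simp_all add: sin_pi_diff_commute[of b a])
  \<comment> \<open>This factor clears the sines and all Gamma values from the four Barnes
    coefficients.\<close>
  define L where "L = sin_pi (b - a) * sin_pi e / of_real pi * (rGamma a * rGamma b * rGamma (1 + a - e) * rGamma (1 + b - e))"
  note GG = Gamma_times_rGamma[OF nz(1)] Gamma_times_rGamma[OF nz(2)] Gamma_times_rGamma[OF nz(5)] Gamma_times_rGamma[OF nz(6)]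
  have L1: "L * Barnes_coeff a b 0 (1 - e) f g = sin_pi e * (rGamma b * rGamma (1 + b - e) * rGamma (f - a) * rGamma (g - a))"
  proof -
    have "L * Barnes_coeff a b 0 (1 - e) f g = sin_pi e * (rGamma b * rGamma (1 + b - e) * rGamma (f - a) * rGamma (g - a)) * (Gamma a * rGamma a) * (Gamma (1 + a - e) * rGamma (1 + a - e))"
      using sn by (simp add: L_def Barnes_coeff_def sin_pi_def[symmetric] add_diff_eq add.commute[of a 1])
    thus ?thesis unfolding GG by simp
  qed
  have L2: "L * Barnes_coeff b a 0 (1 - e) f g = - sin_pi e * (rGamma a * rGamma (1 + a - e) * rGamma (f - b) * rGamma (g - b))"
  proof -
    have "L * Barnes_coeff b a 0 (1 - e) f g = - sin_pi e * (rGamma a * rGamma (1 + a - e) * rGamma (f - b) * rGamma (g - b)) * (Gamma b * rGamma b) * (Gamma (1 + b - e) * rGamma (1 + b - e))"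
      using sn by (simp add: L_def Barnes_coeff_def sin_pi_def[symmetric] sin_pi_diff_commute[of a b] add_diff_eq add.commute[of b 1])
    thus ?thesis unfolding GG by simp
  qed
  have L3: "L * Barnes_coeff 0 (1 - e) a b (1 - c) (1 - d) = sin_pi (b - a) * (rGamma (1 + a - e) * rGamma (1 + b - e) * rGamma (1 - c) * rGamma (1 - d))"
  proof -
    have "L * Barnes_coeff 0 (1 - e) a b (1 - c) (1 - d) = sin_pi (b - a) * (rGamma (1 + a - e) * rGamma (1 + b - e) * rGamma (1 - c) * rGamma (1 - d)) * (Gamma a * rGamma a) * (Gamma b * rGamma b)"
      using sn by (simp add: L_def Barnes_coeff_def sin_pi_def[symmetric] sin_pi_one_minus)
    thus ?thesis unfolding GG by simp
  qed
  have L4: "L * Barnes_coeff (1 - e) 0 a b (1 - c) (1 - d) = - sin_pi (b - a) * (rGamma a * rGamma b * rGamma (e - c) * rGamma (e - d))"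
  proof -
    have s: "0 - (1 - e) = - (1 - e)" "1 - e + a = 1 + a - e" "1 - e + b = 1 + b - e" "1 - c - (1 - e) = e - c" "1 - d - (1 - e) = e - d" by simp_all
    have "L * Barnes_coeff (1 - e) 0 a b (1 - c) (1 - d) = - sin_pi (b - a) * (rGamma a * rGamma b * rGamma (e - c) * rGamma (e - d)) * (Gamma (1 + a - e) * rGamma (1 + a - e)) * (Gamma (1 + b - e) * rGamma (1 + b - e))"
      unfolding Barnes_coeff_def sin_pi_def[symmetric] s sin_pi_minus sin_pi_one_minus using sn by (simp add: L_def)
    thus ?thesis unfolding GG by simp
  qed
  have rel': "sin_pi e * (rGamma b * rGamma (1 + b - e) * rGamma (f - a) * rGamma (g - a)) * Ba
      - sin_pi e * (rGamma a * rGamma (1 + a - e) * rGamma (f - b) * rGamma (g - b)) * Bb =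
     sin_pi (b - a) * (rGamma (1 + a - e) * rGamma (1 + b - e) * rGamma (1 - c) * rGamma (1 - d)) * A0
     - sin_pi (b - a) * (rGamma a * rGamma b * rGamma (e - c) * rGamma (e - d)) * Ae"
    using rel L1 L2 L3 L4 by algebra
  have om: "1 - (e - a) = 1 + a - e" "1 - (f - a) = 1 + a - f" "1 - (g - a) = 1 + a - g" "1 - (f - b) = 1 + b - f" "1 - (g - b) = 1 + b - g"
    "1 - (e - c) = 1 + c - e" "1 - (e - d) = 1 + d - e" by simp_all
  note refl = rGamma_reflection_sin_pi[of "e - a"] rGamma_reflection_sin_pi[of "f - a"] rGamma_reflection_sin_pi[of "g - a"]
    rGamma_reflection_sin_pi[of "f - b"] rGamma_reflection_sin_pi[of "g - b"] rGamma_reflection_sin_pi[of "e - c"] rGamma_reflection_sin_pi[of "e - d"]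
    rGamma_reflection_sin_pi[of c] rGamma_reflection_sin_pi[of d]
  note refl = refl[unfolded om]
  \<comment> \<open>The left-hand side is the middle coefficient as demanded by A0, the right-hand
    side as demanded by Bb, both without the factor \<open>sin_pi (e - a)\<close>.\<close>
  have trig: "sin_pi (a - b) * sin_pi c * sin_pi d - sin_pi e * sin_pi (f - a) * sin_pi (g - a) =
    sin_pi (a - b) * sin_pi (e - c) * sin_pi (e - d) - sin_pi e * sin_pi (f - b) * sin_pi (g - b)"
  proof -
    have "sin_pi (e - c) * sin_pi (e - d) - sin_pi c * sin_pi d = sin_pi e * sin_pi (e - c - d)"
    proof -
      have *: "e - c - e = - c" "e - d - e = - d" "e - c - 0 = e - c" "e - d - 0 = e - d" "e - 0 = e" "e - c + (e - d) - 0 - e = e - c - d" by simp_all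
      show ?thesis using sin_pi_difference[of "e - c" 0 "e - d" e] unfolding * by simp
    qed
    moreover have "sin_pi (f - b) * sin_pi (g - b) - sin_pi (f - a) * sin_pi (g - a) = sin_pi (a - b) * sin_pi (f + g - b - a)"
      by (rule sin_pi_difference)
    moreover have "sin_pi (f + g - b - a) = sin_pi (e - c - d)"
      using sin_pi_one_minus[of "e - c - d"] by (simp add: g algebra_simps)
    ultimately show ?thesis by algebra
  qed
  define u v w where "u = of_real pi ^ 3 * sin_pi e * (rGamma (e - a) * rGamma (1 + b - e) * rGamma (1 + b - f) * rGamma (1 + b - g) * rGamma (g - a) * rGamma (f - a))"
    and "v = sin_pi (e - a) * (sin_pi (a - b) * sin_pi c * sin_pi d - sin_pi e * sin_pi (f - a) * sin_pi (g - a))"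
    and "w = of_real pi ^ 3 * sin_pi (a - b) * (rGamma a * rGamma (e - a) * rGamma c * rGamma d * rGamma (e - c) * rGamma (e - d))"
  \<comment> \<open>The multiple of the Barnes relation to be used: it is read off from the
    coefficient of Ba in \<open>c1\<close>, and \<open>c2\<close> confirms it for Ae.\<close>
  define m where "m = of_real pi ^ 3 * (rGamma c * rGamma d * rGamma (e - a) * rGamma (1 + b - f) * rGamma (1 + b - g))"
  have sba: "sin_pi (b - a) = - sin_pi (a - b)" by (rule sin_pi_diff_commute)
  have c1: "u * (rGamma b * rGamma c * rGamma d) = m * (sin_pi e * (rGamma b * rGamma (1 + b - e) * rGamma (f - a) * rGamma (g - a)))"
    unfolding u_def m_def by (simp only: mult_ac)
  have c2: "w * (rGamma b * rGamma (1 + b - f) * rGamma (1 + b - g)) = - m * (sin_pi (b - a) * (rGamma a * rGamma b * rGamma (e - c) * rGamma (e - d)))"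
    unfolding w_def m_def sba by (simp add: mult_ac)
  have c3: "m * (sin_pi e * (rGamma a * rGamma (1 + a - e) * rGamma (f - b) * rGamma (g - b))) = rGamma a * rGamma c * rGamma d * (sin_pi e * sin_pi (e - a) * sin_pi (f - b) * sin_pi (g - b))"
    unfolding m_def refl(1,4,5)[symmetric] by (simp only: power3_eq_cube mult_ac)
  have "m * (sin_pi (a - b) * (rGamma (1 + a - e) * rGamma (1 + b - e) * rGamma (1 - c) * rGamma (1 - d))) =
      rGamma (1 + b - e) * rGamma (1 + b - f) * rGamma (1 + b - g) * (sin_pi (a - b) * sin_pi (e - a) * sin_pi c * sin_pi d)"
    unfolding m_def refl(1,8,9)[symmetric] by (simp only: power3_eq_cube mult_ac)
  hence c4: "m * (sin_pi (b - a) * (rGamma (1 + a - e) * rGamma (1 + b - e) * rGamma (1 - c) * rGamma (1 - d))) =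
      - (rGamma (1 + b - e) * rGamma (1 + b - f) * rGamma (1 + b - g) * (sin_pi (a - b) * sin_pi (e - a) * sin_pi c * sin_pi d))"
    unfolding sba by simp
  have c5: "u * (rGamma (1 + a - e) * rGamma (1 + a - f) * rGamma (1 + a - g)) = rGamma (1 + b - e) * rGamma (1 + b - f) * rGamma (1 + b - g) * (sin_pi e * sin_pi (e - a) * sin_pi (f - a) * sin_pi (g - a))"
    unfolding u_def refl(1,2,3)[symmetric] by (simp only: power3_eq_cube mult_ac)
  have c6: "w * (rGamma (1 + a - e) * rGamma (1 + c - e) * rGamma (1 + d - e)) = rGamma a * rGamma c * rGamma d * (sin_pi (a - b) * sin_pi (e - a) * sin_pi (e - c) * sin_pi (e - d))"
    unfolding w_def refl(1,6,7)[symmetric] by (simp only: power3_eq_cube mult_ac)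
  have v2: "v = sin_pi (e - a) * (sin_pi (a - b) * sin_pi (e - c) * sin_pi (e - d) - sin_pi e * sin_pi (f - b) * sin_pi (g - b))"
    unfolding v_def trig ..
  have A0c: "u * (rGamma (1 + a - e) * rGamma (1 + a - f) * rGamma (1 + a - g)) + v * (rGamma (1 + b - e) * rGamma (1 + b - f) * rGamma (1 + b - g))
     + m * (sin_pi (b - a) * (rGamma (1 + a - e) * rGamma (1 + b - e) * rGamma (1 - c) * rGamma (1 - d))) = 0"
    unfolding c4 c5 v_def by algebra
  have Bbc: "v * (rGamma a * rGamma c * rGamma d) - w * (rGamma (1 + a - e) * rGamma (1 + c - e) * rGamma (1 + d - e))
     + m * (sin_pi e * (rGamma a * rGamma (1 + a - e) * rGamma (f - b) * rGamma (g - b))) = 0"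
    unfolding c3 c6 v2 by algebra
  have "u * K7 a b c d e f g + v * K7 b a c d e f g - w * K7 (1 + b - e) (1 + a - e) (1 + c - e) (1 + d - e) (2 - e) (1 + f - e) (1 + g - e) =
     A0 * (u * (rGamma (1 + a - e) * rGamma (1 + a - f) * rGamma (1 + a - g)) + v * (rGamma (1 + b - e) * rGamma (1 + b - f) * rGamma (1 + b - g)))
     + Bb * (v * (rGamma a * rGamma c * rGamma d) - w * (rGamma (1 + a - e) * rGamma (1 + c - e) * rGamma (1 + d - e)))
     + (u * (rGamma b * rGamma c * rGamma d)) * Ba - (w * (rGamma b * rGamma (1 + b - f) * rGamma (1 + b - g))) * Ae"
    unfolding K1 K2 K3 by algebra
  also have "\<dots> = 0" unfolding c1 c2 using A0c Bbc rel' by algebra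
  finally show ?thesis unfolding u_def v_def w_def .
qed

no_notation fps_nth (infixl "$" 75)

section \<open>Transport to the required form by the symmetries of K\<close>

lemma K_eq_K7: "K x = K7 (x$1) (x$2) (x$3) (x$4) (x$5) (x$6) (x$7)"
  by (simp add: K_def K7_def Let_def)

lemma K7_perm:
  "K7 a b c d e f g = K7 a c b d e f g" "K7 a b c d e f g = K7 a b d c e f g"
  "K7 a b c d e f g = K7 a b c d f e g" "K7 a b c d e f g = K7 a b c d e g f"
  unfolding K7_def F43_reg_def by (simp_all only: mult_ac)

lemma K7_cong:
  assumes "a = a'" "b = b'" "c = c'" "d = d'" "e = e'" "f = f'" "g = g'"
  shows "K7 a b c d e f g = K7 a' b' c' d' e' f' g'"
  using assms by simp

definition beta7 ::
  "complex \<Rightarrow> complex \<Rightarrow> complex \<Rightarrow> complex \<Rightarrow> complex \<Rightarrow> complex \<Rightarrow> complex \<Rightarrow> complex" where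
  "beta7 a b c d e f g = rGamma a * rGamma (1+b-e) * rGamma (f-c) * rGamma (f-d) * rGamma (g-c) * rGamma (g-d)"

text \<open>The entire function that extends \<open>\<gamma>\<close>.\<close>

definition gamma7 ::
  "complex \<Rightarrow> complex \<Rightarrow> complex \<Rightarrow> complex \<Rightarrow> complex \<Rightarrow> complex \<Rightarrow> complex \<Rightarrow> complex" where
  "gamma7 a b c d e f g = sin_pi (e - b) *
     (sin_pi (a - b) * sin_pi (f - c) * sin_pi (f - d) - sin_pi (e - a - b) * sin_pi (f - a) * sin_pi (g - b))"

text \<open>The Pluecker relation replaces sin(a - c) sin(f - b) by sin(a - b) sin(f - c) up to a
  multiple of sin(c - b). Then \<open>sin_pi_difference\<close> extracts sin(c - b) from the rest;
  the cofactor is sin(f - d) by the balance. This is the divisibility that removes the singularity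
  of \<gamma>.\<close>

lemma gamma7_times_sin_pi:
  assumes bal: "e + f + g = 1 + a + b + c + d"
  shows "sin_pi (c - b) * gamma7 a b c d e f g = sin_pi (e - b) *
       (sin_pi (a-c) * sin_pi (e-a-b) * sin_pi (f-b) * sin_pi (g-b)
      - sin_pi (a-b) * sin_pi (e-a-c) * sin_pi (f-c) * sin_pi (g-c))"
proof -
  have "e - a + g - b - c = 1 - (f - d)" using bal by (simp add: algebra_simps)
  hence "sin_pi (e - a + g - b - c) = sin_pi (f - d)" by (simp only: sin_pi_one_minus)
  moreover have "P * (S * (X * Y * Z - U * W * T)) = S * (Q * U * R * T - X * V * Y * N)"
    if "U * T - V * N = P * Z" "Q * R + P * W = X * Y" for P S X Y Z U W T Q R V N :: complex
    using that by algebra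
  ultimately show ?thesis unfolding gamma7_def
    using sin_pi_difference[of "e - a" b g c] sin_pi_Pluecker[of a c f b] by simp
qed

text \<open>\<open>three_term_relation_generic\<close> taken at (a, b, f - c, f - d, 1 + a + b - e,
  f, 1 + a + b - g). There its three values of K are related to the required ones by
  \<open>K7_transform\<close> and permutations, and its outer Gamma products become the two values
  of \<beta>.\<close>

lemma three_term_relation_scalar_generic:
  assumes bal: "e + f + g = 1 + a + b + c + d"
    and nz: "a \<notin> \<int>" "b \<notin> \<int>" "1 + a + b - e \<notin> \<int>" "a - b \<notin> \<int>" "e - b \<notin> \<int>" "e - a \<notin> \<int>"
  shows "of_real pi ^ 3 * sin_pi (e - a - b) * beta7 (1+b-e) b (f-c) (g-c) (1+a+b-e) (1+b-c) (1+b+d-e) * K7 a b c d e f g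
     + gamma7 a b c d e f g * K7 b c d a e f g
     - of_real pi ^ 3 * sin_pi (a - b) * beta7 a b c d e f g * K7 (e-a) (e-b) (e-c) (e-d) (1+e-f) (1+e-g) e = 0"
proof -
  have g: "g = 1 + a + b + c + d - e - f" using bal by (simp add: algebra_simps)
  have K1: "K7 a b c d e f g = K7 a b (f - c) (f - d) (1 + a + b - e) f (1 + a + b - g)"
  proof -
    have "K7 a b c d e f g = K7 a c d b f e g"
      using K7_perm(1)[of a b c d e f g] K7_perm(2)[of a c b d e f g] K7_perm(3)[of a c d b e f g] by simp
    \<comment> \<open>In \<open>K7_transform\<close> the parameters c, d, f take the places of b, c,
      e.\<close>
    also have "\<dots> = K7 a (f - c) (f - d) b f (e - (c + d - f)) (g - (c + d - f))"
      by (rule K7_transform) (simp add: g)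
    also have "\<dots> = K7 a (f - c) (f - d) b f (1 + a + b - g) (1 + a + b - e)"
      by (rule K7_cong; simp add: g)
    also have "K7 a (f - c) (f - d) b f (1 + a + b - g) (1 + a + b - e) = K7 a b (f - c) (f - d) (1 + a + b - e) f (1 + a + b - g)"
      using K7_perm(2)[of a "f - c" "f - d" b f "1 + a + b - g" "1 + a + b - e"] K7_perm(1)[of a "f - c" b "f - d" f "1 + a + b - g" "1 + a + b - e"]
        K7_perm(4)[of a b "f - c" "f - d" f "1 + a + b - g" "1 + a + b - e"] K7_perm(3)[of a b "f - c" "f - d" f "1 + a + b - e" "1 + a + b - g"] by simp
    finally show ?thesis .
  qed
  have K2: "K7 b c d a e f g = K7 b a (f - c) (f - d) (1 + a + b - e) f (1 + a + b - g)"
  proof -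
    have "K7 b c d a e f g = K7 b c d a f e g" by (rule K7_perm)
    also have "\<dots> = K7 b (f - c) (f - d) a f (e - (c + d - f)) (g - (c + d - f))"
      by (rule K7_transform) (simp add: g)
    also have "\<dots> = K7 b (f - c) (f - d) a f (1 + a + b - g) (1 + a + b - e)"
      by (rule K7_cong; simp add: g)
    also have "K7 b (f - c) (f - d) a f (1 + a + b - g) (1 + a + b - e) = K7 b a (f - c) (f - d) (1 + a + b - e) f (1 + a + b - g)"
      using K7_perm(2)[of b "f - c" "f - d" a f "1 + a + b - g" "1 + a + b - e"] K7_perm(1)[of b "f - c" a "f - d" f "1 + a + b - g" "1 + a + b - e"]
        K7_perm(4)[of b a "f - c" "f - d" f "1 + a + b - g" "1 + a + b - e"] K7_perm(3)[of b a "f - c" "f - d" f "1 + a + b - e" "1 + a + b - g"] by simp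
    finally show ?thesis .
  qed
  have K3: "K7 (e-a) (e-b) (e-c) (e-d) (1+e-f) (1+e-g) e =
     K7 (1 + b - (1 + a + b - e)) (1 + a - (1 + a + b - e)) (1 + (f - c) - (1 + a + b - e)) (1 + (f - d) - (1 + a + b - e)) (2 - (1 + a + b - e)) (1 + f - (1 + a + b - e)) (1 + (1 + a + b - g) - (1 + a + b - e))"
  proof -
    have "K7 (e-a) (e-b) (e-c) (e-d) (1+e-f) (1+e-g) e = K7 (e-a) (e-c) (e-d) (e-b) (1+e-g) (1+e-f) e"
      using K7_perm(1)[of "e-a" "e-b" "e-c" "e-d" "1+e-f" "1+e-g" e] K7_perm(2)[of "e-a" "e-c" "e-b" "e-d" "1+e-f" "1+e-g" e]
        K7_perm(3)[of "e-a" "e-c" "e-d" "e-b" "1+e-f" "1+e-g" e] by simp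
    also have "\<dots> = K7 (e-a) (1+e-g - (e-c)) (1+e-g - (e-d)) (e-b) (1+e-g) (1+e-f - ((e-c) + (e-d) - (1+e-g))) (e - ((e-c) + (e-d) - (1+e-g)))"
      by (rule K7_transform) (simp add: g)
    also have "\<dots> = K7 (1 + b - (1 + a + b - e)) (1 + (f - d) - (1 + a + b - e)) (1 + (f - c) - (1 + a + b - e)) (1 + a - (1 + a + b - e)) (1 + (1 + a + b - g) - (1 + a + b - e)) (2 - (1 + a + b - e)) (1 + f - (1 + a + b - e))"
      by (rule K7_cong; simp add: g)
    also have "K7 (1 + b - (1 + a + b - e)) (1 + (f - d) - (1 + a + b - e)) (1 + (f - c) - (1 + a + b - e)) (1 + a - (1 + a + b - e)) (1 + (1 + a + b - g) - (1 + a + b - e)) (2 - (1 + a + b - e)) (1 + f - (1 + a + b - e)) =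
      K7 (1 + b - (1 + a + b - e)) (1 + a - (1 + a + b - e)) (1 + (f - c) - (1 + a + b - e)) (1 + (f - d) - (1 + a + b - e)) (2 - (1 + a + b - e)) (1 + f - (1 + a + b - e)) (1 + (1 + a + b - g) - (1 + a + b - e))"
      (is "K7 ?p ?x ?y ?z ?r ?s ?t = _")
      using K7_perm(2)[of ?p ?x ?y ?z ?r ?s ?t] K7_perm(1)[of ?p ?x ?z ?y ?r ?s ?t] K7_perm(2)[of ?p ?z ?x ?y ?r ?s ?t]
        K7_perm(3)[of ?p ?z ?y ?x ?r ?s ?t] K7_perm(4)[of ?p ?z ?y ?x ?s ?r ?t] by simp
    finally show ?thesis .
  qed
  have s: "(1 + a + b - e) - a = 1 + b - e" "1 + b - (1 + a + b - e) = e - a" "1 + b - (1 + a + b - g) = g - a" "(1 + a + b - g) - a = 1 + b - g"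
    "(1 + a + b - e) - (f - c) = g - d" "(1 + a + b - e) - (f - d) = g - c" by (simp_all add: g)
  have b1: "beta7 (1+b-e) b (f-c) (g-c) (1+a+b-e) (1+b-c) (1+b+d-e) = rGamma (1 + b - e) * rGamma (e - a) * rGamma (1 + b - f) * rGamma (g - a) * rGamma (1 + b - g) * rGamma (f - a)"
  proof -
    have "1 + b - c - (f - c) = 1 + b - f" "1 + b - c - (g - c) = 1 + b - g" "1 + b + d - e - (f - c) = g - a" "1 + b + d - e - (g - c) = f - a"
      by (simp_all add: g)
    thus ?thesis unfolding beta7_def s by (simp only: mult_ac)
  qed
  have b2: "beta7 a b c d e f g = rGamma a * rGamma (1 + b - e) * rGamma (f - c) * rGamma (f - d) * rGamma (g - d) * rGamma (g - c)"
    by (simp add: beta7_def)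
  have sines: "sin_pi (1 + a + b - e) = sin_pi (e - a - b)" "sin_pi (1 + b - e) = sin_pi (e - b)" "sin_pi (1 + b - g) = sin_pi (g - b)"
    using sin_pi_one_minus[of "e - a - b"] sin_pi_one_minus[of "e - b"] sin_pi_one_minus[of "g - b"] by (simp_all add: algebra_simps)
  have "of_real pi ^ 3 * sin_pi (1 + a + b - e) * (rGamma (1 + a + b - e - a) * rGamma (1 + b - (1 + a + b - e)) * rGamma (1 + b - f) * rGamma (1 + b - (1 + a + b - g)) * rGamma (1 + a + b - g - a) * rGamma (f - a)) * K7 a b (f - c) (f - d) (1 + a + b - e) f (1 + a + b - g)
    + sin_pi (1 + a + b - e - a) * (sin_pi (a - b) * sin_pi (f - c) * sin_pi (f - d) - sin_pi (1 + a + b - e) * sin_pi (f - a) * sin_pi (1 + a + b - g - a)) * K7 b a (f - c) (f - d) (1 + a + b - e) f (1 + a + b - g)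
    - of_real pi ^ 3 * sin_pi (a - b) * (rGamma a * rGamma (1 + a + b - e - a) * rGamma (f - c) * rGamma (f - d) * rGamma (1 + a + b - e - (f - c)) * rGamma (1 + a + b - e - (f - d))) *
        K7 (1 + b - (1 + a + b - e)) (1 + a - (1 + a + b - e)) (1 + (f - c) - (1 + a + b - e)) (1 + (f - d) - (1 + a + b - e)) (2 - (1 + a + b - e)) (1 + f - (1 + a + b - e)) (1 + (1 + a + b - g) - (1 + a + b - e)) = 0"
    by (rule three_term_relation_generic) (use nz in \<open>simp_all add: g\<close>)
  thus ?thesis unfolding K1[symmetric] K2[symmetric] K3[symmetric] b1 b2 gamma7_def unfolding s sines
    by (simp only: mult_ac)
qed

text \<open>Continuation as in \<open>K7_transform\<close>; it requires the entire function
  \<open>gamma7\<close>, since the defining quotient of \<gamma> has singularities along the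
  line.\<close>

lemma three_term_relation_scalar:
  assumes bal: "e + f + g = 1 + a + b + c + d"
  shows "of_real pi ^ 3 * sin_pi (e - a - b) * beta7 (1+b-e) b (f-c) (g-c) (1+a+b-e) (1+b-c) (1+b+d-e) * K7 a b c d e f g
     + gamma7 a b c d e f g * K7 b c d a e f g
     - of_real pi ^ 3 * sin_pi (a - b) * beta7 a b c d e f g * K7 (e-a) (e-b) (e-c) (e-d) (1+e-f) (1+e-g) e = 0"
proof -
  \<comment> \<open>The line leads from the balanced point (0.1, 0.3, 0, 0, 0.65, 0, 0.75) at z = 0,
    at which the six integrality conditions hold, to the given parameters at z = 1.\<close>
  define l :: "complex \<Rightarrow> complex \<Rightarrow> complex \<Rightarrow> complex" where "l = (\<lambda>p q z. p + z * (q - p))"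
  define A B C D E F G where "A = l (10/100) a" and "B = l (30/100) b" and "C = l 0 c" and "D = l 0 d"
    and "E = l (65/100) e" and "F = l 0 f" and "G = l (75/100) g"
  note defs = A_def B_def C_def D_def E_def F_def G_def l_def
  have hol: "A holomorphic_on UNIV" "B holomorphic_on UNIV" "C holomorphic_on UNIV" "D holomorphic_on UNIV"
     "E holomorphic_on UNIV" "F holomorphic_on UNIV" "G holomorphic_on UNIV"
    unfolding defs by (intro holomorphic_intros)+
  have bal': "E z + F z + G z = 1 + A z + B z + C z + D z" for z
  proof -
    have "E z + F z + G z - (1 + A z + B z + C z + D z) = z * (e + f + g - (1 + a + b + c + d))"
      unfolding defs by (simp add: algebra_simps)
    thus ?thesis using bal by simp
  qed
  define R where "R = (\<lambda>z. of_real pi ^ 3 * sin_pi (E z - A z - B z) * beta7 (1+B z-E z) (B z) (F z-C z) (G z-C z) (1+A z+B z-E z) (1+B z-C z) (1+B z+D z-E z) * K7 (A z) (B z) (C z) (D z) (E z) (F z) (G z)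
     + gamma7 (A z) (B z) (C z) (D z) (E z) (F z) (G z) * K7 (B z) (C z) (D z) (A z) (E z) (F z) (G z)
     - of_real pi ^ 3 * sin_pi (A z - B z) * beta7 (A z) (B z) (C z) (D z) (E z) (F z) (G z) * K7 (E z-A z) (E z-B z) (E z-C z) (E z-D z) (1+E z-F z) (1+E z-G z) (E z))"
  have k1: "(\<lambda>z. K7 (A z) (B z) (C z) (D z) (E z) (F z) (G z)) holomorphic_on UNIV"
    by (rule K7_holomorphic[OF hol bal'])
  have "E z + F z + G z = 1 + B z + C z + D z + A z" for z using bal'[of z] by (simp add: add_ac)
  from K7_holomorphic[OF hol(2,3,4,1,5,6,7) this]
  have k2: "(\<lambda>z. K7 (B z) (C z) (D z) (A z) (E z) (F z) (G z)) holomorphic_on UNIV" .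
  have h: "(\<lambda>z. E z - A z) holomorphic_on UNIV" "(\<lambda>z. E z - B z) holomorphic_on UNIV" "(\<lambda>z. E z - C z) holomorphic_on UNIV"
    "(\<lambda>z. E z - D z) holomorphic_on UNIV" "(\<lambda>z. 1 + E z - F z) holomorphic_on UNIV" "(\<lambda>z. 1 + E z - G z) holomorphic_on UNIV"
    by (intro holomorphic_intros hol)+
  have "1 + E z - F z + (1 + E z - G z) + E z = 1 + (E z - A z) + (E z - B z) + (E z - C z) + (E z - D z)" for z
    using bal'[of z] by algebra
  from K7_holomorphic[OF h hol(5) this]
  have k3: "(\<lambda>z. K7 (E z-A z) (E z-B z) (E z-C z) (E z-D z) (1+E z-F z) (1+E z-G z) (E z)) holomorphic_on UNIV" .
  have "R holomorphic_on UNIV" unfolding R_def beta7_def gamma7_def sin_pi_def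
    by (intro holomorphic_intros holomorphic_rGamma' hol k1 k2 k3)
  moreover have "(\<lambda>z. 0) holomorphic_on (UNIV :: complex set)" by (rule holomorphic_on_const)
  moreover have "eventually (\<lambda>z. R z = 0) (nhds 0)"
  proof -
    have "eventually (\<lambda>z. A z \<notin> \<int>) (nhds 0)" "eventually (\<lambda>z. B z \<notin> \<int>) (nhds 0)" "eventually (\<lambda>z. 1 + A z + B z - E z \<notin> \<int>) (nhds 0)"
      "eventually (\<lambda>z. A z - B z \<notin> \<int>) (nhds 0)" "eventually (\<lambda>z. E z - B z \<notin> \<int>) (nhds 0)" "eventually (\<lambda>z. E z - A z \<notin> \<int>) (nhds 0)"
      by (rule eventually_not_Ints, simp add: defs, rule not_Ints_between[of 0] not_Ints_between[of "-1"]; simp add: defs)+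
    thus ?thesis
    proof eventually_elim
      case (elim z)
      show ?case unfolding R_def by (rule three_term_relation_scalar_generic[OF bal']) (use elim in simp_all)
    qed
  qed
  ultimately have "R 1 = 0" by (rule entire_eqI)
  moreover have "A 1 = a" "B 1 = b" "C 1 = c" "D 1 = d" "E 1 = e" "F 1 = f" "G 1 = g"
    by (simp_all add: defs)
  ultimately show ?thesis by (simp only: R_def)
qed

lemma gamma_generic_eq:
  fixes x :: "complex ^ 7"
  assumes "x \<in> V" "x$3 - x$2 \<notin> \<int>"
  shows "gamma_generic x = gamma7 (x$1) (x$2) (x$3) (x$4) (x$5) (x$6) (x$7)"
proof -
  have "x$5 + x$6 + x$7 = 1 + x$1 + x$2 + x$3 + x$4" using assms(1) by (simp add: V_def algebra_simps)
  from gamma7_times_sin_pi[OF this] show ?thesis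
    using sin_pi_neq_0[OF assms(2)] by (simp add: gamma_generic_def Let_def field_simps)
qed

text \<open>On the singular locus the limit of \<open>gamma_generic\<close> is that of the
  continuous function \<open>gamma7\<close>, with which it agrees on U. For \<open>Lim\<close> to be
  determined, x must be a limit point of U, and this is the actual content of the proof.\<close>

lemma gamma_eq:
  fixes x :: "complex ^ 7"
  assumes x: "x \<in> V"
  shows "gamma x = gamma7 (x$1) (x$2) (x$3) (x$4) (x$5) (x$6) (x$7)"
proof (cases "x$3 - x$2 \<in> \<int>")
  case True
  define U where "U = {y \<in> V. y$3 - y$2 \<notin> \<int>}"
  define h where "h = (\<lambda>y :: complex ^ 7. gamma7 (y$1) (y$2) (y$3) (y$4) (y$5) (y$6) (y$7))"
  \<comment> \<open>Moving along v keeps c + d fixed, hence stays in V, while c - b changes.\<close>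
  define v :: "complex ^ 7" where "v = vector [0, 0, 1, -1, 0, 0, 0]"
  have "x islimpt U"
    unfolding islimpt_approachable
  proof (intro allI impI)
    fix r :: real assume r: "r > 0"
    \<comment> \<open>The bound 1/2 puts the new c - b strictly between two consecutive integers;
      the other bound keeps the new point closer than r to x.\<close>
    define t where "t = min (1 / 2) (r / (2 * (norm v + 1)))"
    have nv: "norm v + 1 > 0" by (simp add: add_nonneg_pos)
    have "r / (2 * (norm v + 1)) > 0" using r nv by simp
    hence "0 < t" by (simp add: t_def)
    moreover have "t \<le> 1 / 2" unfolding t_def by (rule min.cobounded1)
    moreover have "t \<le> r / (2 * (norm v + 1))" unfolding t_def by (rule min.cobounded2)
    ultimately have t: "0 < t" "t \<le> 1 / 2" "t \<le> r / (2 * (norm v + 1))" by blast+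
    define y where "y = x + t *\<^sub>R v"
    have y: "y$1 = x$1" "y$2 = x$2" "y$3 = x$3 + of_real t" "y$4 = x$4 - of_real t" "y$5 = x$5" "y$6 = x$6" "y$7 = x$7"
      unfolding y_def v_def vector_add_component vector_scaleR_component vector_7
      by (simp_all add: scaleR_conv_of_real)
    obtain n where n: "x$3 - x$2 = of_int n" using True by (elim Ints_cases)
    have yn: "y$3 - y$2 \<notin> \<int>"
      by (rule not_Ints_between[of n]) (use t n[symmetric] in \<open>simp_all add: y algebra_simps complex_eq_iff\<close>)
    have "y \<in> U" using x yn by (simp add: U_def V_def y algebra_simps)
    moreover have "y \<noteq> x" using t y(3) by auto
    moreover have "dist y x < r"
    proof -
      have "dist y x = t * norm v" using t by (simp add: y_def dist_norm)
      also have "\<dots> \<le> r / (2 * (norm v + 1)) * (norm v + 1)" using t r nv by (intro mult_mono) auto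
      also have "\<dots> = r / 2" using nv by (simp add: field_simps)
      finally show ?thesis using r by simp
    qed
    ultimately show "\<exists>x'\<in>U. x' \<noteq> x \<and> dist x' x < r" by blast
  qed
  hence nt: "\<not> trivial_limit (at x within U)" by (simp add: trivial_limit_within)
  have "(h \<longlongrightarrow> h x) (at x within U)"
    unfolding h_def gamma7_def sin_pi_def by (intro tendsto_intros)
  moreover have "eventually (\<lambda>y. h y = gamma_generic y) (at x within U)"
    unfolding eventually_at_filter by (intro always_eventually) (simp add: U_def h_def gamma_generic_eq)
  ultimately have "(gamma_generic \<longlongrightarrow> h x) (at x within U)" by (rule Lim_transform_eventually)
  hence "Lim (at x within U) gamma_generic = h x" by (rule tendsto_Lim[OF nt])
  thus ?thesis using True by (simp add: gamma_def U_def h_def)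
next
  case False
  thus ?thesis using gamma_generic_eq[OF x] by (simp add: gamma_def)
qed

lemma three_term_relation:
  fixes x :: "complex ^ 7"
  assumes x: "x \<in> V"
  shows "of_real pi ^ 3 * sin_pi (x$5 - x$1 - x$2) * beta (\<sigma> x) * K_at p0 x
          + gamma x * K_at p1 x
          - of_real pi ^ 3 * sin_pi (x$1 - x$2) * beta x * K_at n4 x = 0"
proof -
  have bal: "x$5 + x$6 + x$7 = 1 + x$1 + x$2 + x$3 + x$4" using x by (simp add: V_def algebra_simps)
  have "beta y = beta7 (y$1) (y$2) (y$3) (y$4) (y$5) (y$6) (y$7)" for y
    by (simp add: beta_def beta7_def Let_def)
  hence "beta x = beta7 (x$1) (x$2) (x$3) (x$4) (x$5) (x$6) (x$7)"
    "beta (\<sigma> x) = beta7 (1 + x$2 - x$5) (x$2) (x$6 - x$3) (x$7 - x$3) (1 + x$1 + x$2 - x$5) (1 + x$2 - x$3) (1 + x$2 + x$4 - x$5)"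
    by (simp_all add: \<sigma>_def Let_def)
  thus ?thesis unfolding K_at_def act_p0 act_p1 act_n4[OF x] K_eq_K7 vector_7 gamma_eq[OF x]
    using three_term_relation_scalar[OF bal] by simp
qed

lemma \<sigma>_in_V: "x \<in> V \<Longrightarrow> \<sigma> x \<in> V"
  by (simp add: V_def \<sigma>_def Let_def algebra_simps)

lemma \<sigma>_cubed: "x \<in> V \<Longrightarrow> \<sigma> (\<sigma> (\<sigma> x)) = x"
  by (simp add: V_def \<sigma>_def Let_def vec_eq_iff forall_7) (simp add: algebra_simps)

section \<open>Hamming types in \<open>M_K\<close>\<close>

lemma exhaust_6: "i = 1 \<or> i = 2 \<or> i = 3 \<or> i = 4 \<or> i = 5 \<or> i = 6" for i :: 6
proof (induct i)
  case (of_int z)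
  then have "z = 0 \<or> z = 1 \<or> z = 2 \<or> z = 3 \<or> z = 4 \<or> z = 5"
    by fastforce
  then show ?case by auto
qed

lemma UNIV_6: "(UNIV :: 6 set) = {1, 2, 3, 4, 5, 6}"
  using exhaust_6 by auto

lemma forall_6: "(\<forall>i::6. P i) \<longleftrightarrow> P 1 \<and> P 2 \<and> P 3 \<and> P 4 \<and> P 5 \<and> P 6"
  by (metis exhaust_6)

lemma sum_6: "sum f (UNIV :: 6 set) = f 1 + f 2 + f 3 + f 4 + f 5 + f 6"
  unfolding UNIV_6 by (simp add: ac_simps)

lemma vector_6 [simp]:
  "(vector [a,b,c,d,e,f] :: 'a::zero ^ 6) $ 1 = a"
  "(vector [a,b,c,d,e,f] :: 'a::zero ^ 6) $ 2 = b"
  "(vector [a,b,c,d,e,f] :: 'a::zero ^ 6) $ 3 = c"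
  "(vector [a,b,c,d,e,f] :: 'a::zero ^ 6) $ 4 = d"
  "(vector [a,b,c,d,e,f] :: 'a::zero ^ 6) $ 5 = e"
  "(vector [a,b,c,d,e,f] :: 'a::zero ^ 6) $ 6 = f"
  unfolding vector_def by simp_all

lemmas matrix_simps = vec_eq_iff forall_6 forall_7 sum_6 sum_7 matrix_matrix_mult_def
  matrix_vector_mult_def mat_def

lemma group_GL: "group (GL :: (real ^ 'n ^ 'n) monoid)"
proof (rule groupI)
  fix x :: "real ^ 'n ^ 'n" assume "x \<in> carrier GL"
  then obtain y where "x ** y = mat 1" "y ** x = mat 1" by (auto simp: GL_def invertible_def)
  thus "\<exists>y\<in>carrier GL. y \<otimes>\<^bsub>GL\<^esub> x = \<one>\<^bsub>GL\<^esub>" by (auto simp: GL_def invertible_def)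
next
  have "invertible (mat 1 :: real ^ 'n ^ 'n)" unfolding invertible_def using matrix_mul_lid by blast
  thus "\<one>\<^bsub>GL\<^esub> \<in> carrier (GL :: (real ^ 'n ^ 'n) monoid)" by (simp add: GL_def)
qed (simp_all add: GL_def invertible_mult matrix_mul_assoc)

lemma matrix_inv_eqI:
  fixes A :: "real ^ 'n ^ 'n"
  assumes "A ** B = mat 1"
  shows "matrix_inv A = B"
proof -
  have "invertible A" using assms matrix_left_right_inverse by (auto simp: invertible_def)
  hence "matrix_inv A ** A = mat 1" unfolding invertible_def matrix_inv_def by (rule someI2_ex) simp
  hence "matrix_inv A = matrix_inv A ** (A ** B)" using assms by simp
  also have "\<dots> = B" using \<open>matrix_inv A ** A = mat 1\<close> by (simp add: matrix_mul_assoc)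
  finally show ?thesis .
qed

definition S_inv :: "real ^ 7 ^ 7" where
  "S_inv = vector
    [vector [1,0,0,0,0,0,0],
     vector [0,-1/2,1/2,1/2,0,0,0],
     vector [0,1/2,-1/2,1/2,0,0,0],
     vector [0,1/2,1/2,-1/2,0,0,0],
     vector [0,-1/2,-1/2,-1/2,1,0,0],
     vector [0,-1/2,-1/2,-1/2,0,1,0],
     vector [0,-1/2,-1/2,-1/2,0,0,1]]"

lemma S_S_inv: "S ** S_inv = mat 1"
  by (simp add: S_def S_inv_def matrix_simps)

lemma matrix_inv_S: "matrix_inv S = S_inv"
  by (rule matrix_inv_eqI[OF S_S_inv])

lemma S_inv_S: "S_inv ** S = mat 1"
  using S_S_inv matrix_left_right_inverse by blast

section \<open>Generators of \<open>M_K\<close>\<close>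

definition conj_S :: "(7 \<Rightarrow> 7) \<Rightarrow> real ^ 7 ^ 7" where
  "conj_S p = S ** perm_matrix p ** matrix_inv S"

lemma perm_matrix_comp: "perm_matrix (p \<circ> q) = perm_matrix p ** perm_matrix q"
proof -
  have "(\<Sum>k\<in>UNIV. (if i = p k then 1 else 0) * (if k = q j then 1 else 0)) = (if i = (p \<circ> q) j then 1 else (0::real))" for i j
  proof -
    have "(\<Sum>k\<in>UNIV. (if i = p k then 1 else 0) * (if k = q j then 1 else 0)) = (\<Sum>k\<in>UNIV. if k = q j then (if i = p k then 1 else 0) else (0::real))"
      by (intro sum.cong) auto
    thus ?thesis by simp
  qed
  thus ?thesis by (simp only: perm_matrix_def matrix_matrix_mult_def vec_eq_iff vec_lambda_beta) simp
qed

lemma perm_matrix_id: "perm_matrix id = mat 1"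
  by (simp add: perm_matrix_def mat_def)

lemma conj_S_comp: "conj_S (p \<circ> q) = conj_S p ** conj_S q"
proof -
  have "conj_S p ** conj_S q = S ** perm_matrix p ** (S_inv ** S) ** perm_matrix q ** S_inv"
    by (simp add: conj_S_def matrix_inv_S matrix_mul_assoc)
  thus ?thesis by (simp add: S_inv_S conj_S_def matrix_inv_S perm_matrix_comp matrix_mul_assoc)
qed

lemma conj_S_id: "conj_S id = mat 1"
  by (simp add: conj_S_def perm_matrix_id matrix_inv_S S_S_inv)

lemma conj_S_eqI: "S ** perm_matrix p = g ** S \<Longrightarrow> conj_S p = g"
  by (simp add: conj_S_def matrix_inv_S matrix_mul_assoc[symmetric] S_S_inv)

lemma GL_simps: "carrier GL = {A. invertible A}" "mult GL = (**)" "one GL = mat 1"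
  by (simp_all add: GL_def)

text \<open>The matrices \<open>gen_2\<close> to \<open>gen_6\<close> are the conjugates S (i i+1)
  S^(-1) for i = 2, ..., 6, multiplied out, and \<open>gen_12\<close> is the transposition (12); see
  \<open>gen_eq\<close>.\<close>

definition gen_2 :: "real ^ 7 ^ 7" where
  "gen_2 = vector
    [vector [1,0,0,0,0,0,0],
     vector [0,0,1,0,0,0,0],
     vector [0,1,0,0,0,0,0],
     vector [0,0,0,1,0,0,0],
     vector [0,0,0,0,1,0,0],
     vector [0,0,0,0,0,1,0],
     vector [0,0,0,0,0,0,1]]"

definition gen_3 :: "real ^ 7 ^ 7" where
  "gen_3 = vector
    [vector [1,0,0,0,0,0,0],
     vector [0,1,0,0,0,0,0],
     vector [0,0,0,1,0,0,0],
     vector [0,0,1,0,0,0,0],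
     vector [0,0,0,0,1,0,0],
     vector [0,0,0,0,0,1,0],
     vector [0,0,0,0,0,0,1]]"

definition gen_4 :: "real ^ 7 ^ 7" where
  "gen_4 = vector
    [vector [1,0,0,0,0,0,0],
     vector [0,0,-1,0,1,0,0],
     vector [0,-1,0,0,1,0,0],
     vector [0,0,0,1,0,0,0],
     vector [0,0,0,0,1,0,0],
     vector [0,-1,-1,0,1,1,0],
     vector [0,-1,-1,0,1,0,1]]"

definition gen_5 :: "real ^ 7 ^ 7" where
  "gen_5 = vector
    [vector [1,0,0,0,0,0,0],
     vector [0,1,0,0,0,0,0],
     vector [0,0,1,0,0,0,0],
     vector [0,0,0,1,0,0,0],
     vector [0,0,0,0,0,1,0],
     vector [0,0,0,0,1,0,0],
     vector [0,0,0,0,0,0,1]]"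

definition gen_6 :: "real ^ 7 ^ 7" where
  "gen_6 = vector
    [vector [1,0,0,0,0,0,0],
     vector [0,1,0,0,0,0,0],
     vector [0,0,1,0,0,0,0],
     vector [0,0,0,1,0,0,0],
     vector [0,0,0,0,1,0,0],
     vector [0,0,0,0,0,0,1],
     vector [0,0,0,0,0,1,0]]"

definition gen_12 :: "real ^ 7 ^ 7" where
  "gen_12 = vector
    [vector [0,1,0,0,0,0,0],
     vector [1,0,0,0,0,0,0],
     vector [0,0,1,0,0,0,0],
     vector [0,0,0,1,0,0,0],
     vector [0,0,0,0,1,0,0],
     vector [0,0,0,0,0,1,0],
     vector [0,0,0,0,0,0,1]]"

lemmas gen_defs = gen_2_def gen_3_def gen_4_def gen_5_def gen_6_def gen_12_def

lemma gen_eq: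
  "conj_S (Transposition.transpose 2 3) = gen_2"
  "conj_S (Transposition.transpose 3 4) = gen_3"
  "conj_S (Transposition.transpose 4 5) = gen_4"
  "conj_S (Transposition.transpose 5 6) = gen_5"
  "conj_S (Transposition.transpose 6 7) = gen_6"
  "perm_matrix (Transposition.transpose 1 2) = gen_12"
  by (intro conj_S_eqI; simp add: gen_defs S_def perm_matrix_def Transposition.transpose_def matrix_simps)+
    (simp add: gen_defs perm_matrix_def Transposition.transpose_def matrix_simps)

definition gens :: "(real ^ 7 ^ 7) set" where
  "gens = {gen_2, gen_3, gen_4, gen_5, gen_6, gen_12}"

lemma gens_involution: "g \<in> gens \<Longrightarrow> g ** g = mat 1"
  unfolding gens_def by (elim insertE emptyE; simp add: gen_defs matrix_simps)

text \<open>The columns of \<open>basis_matrix\<close> span the kernel of the linear form \<open>e + f + g - a - b - c - d\<close>, which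
  \<open>M_K\<close> fixes; \<open>coord_matrix\<close> reads off coordinates along it, with the fixed vector
  \<open>(1,1,1,1,2,2,2)\<close> as complement (\<open>fixed_proj\<close> is the projection onto its span). In this basis \<open>M_K\<close> acts by signed permutations.\<close>

definition basis_matrix :: "real ^ 6 ^ 7" where
  "basis_matrix = vector
    [vector [1/2,1/2,1/2,1/2,1/2,1/2],
     vector [1/2,-1/2,-1/2,1/2,1/2,1/2],
     vector [-1/2,1/2,-1/2,1/2,1/2,1/2],
     vector [-1/2,-1/2,1/2,1/2,1/2,1/2],
     vector [0,0,0,0,1,1],
     vector [0,0,0,1,0,1],
     vector [0,0,0,1,1,0]]"

definition coord_matrix :: "real ^ 7 ^ 6" where
  "coord_matrix = vector
    [vector [1/2,1/2,-1/2,-1/2,0,0,0],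
     vector [1/2,-1/2,1/2,-1/2,0,0,0],
     vector [1/2,-1/2,-1/2,1/2,0,0,0],
     vector [1/2,1/2,1/2,1/2,-1,0,0],
     vector [1/2,1/2,1/2,1/2,0,-1,0],
     vector [1/2,1/2,1/2,1/2,0,0,-1]]"

definition fixed_proj :: "real ^ 7 ^ 7" where
  "fixed_proj = vector
    [vector [-1/2,-1/2,-1/2,-1/2,1/2,1/2,1/2],
     vector [-1/2,-1/2,-1/2,-1/2,1/2,1/2,1/2],
     vector [-1/2,-1/2,-1/2,-1/2,1/2,1/2,1/2],
     vector [-1/2,-1/2,-1/2,-1/2,1/2,1/2,1/2],
     vector [-1,-1,-1,-1,1,1,1],
     vector [-1,-1,-1,-1,1,1,1],
     vector [-1,-1,-1,-1,1,1,1]]"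

lemma coord_basis: "coord_matrix ** basis_matrix = mat 1"
  by (simp add: coord_matrix_def basis_matrix_def matrix_simps)

lemma basis_coord: "basis_matrix ** coord_matrix = mat 1 - fixed_proj"
  by (simp add: coord_matrix_def basis_matrix_def fixed_proj_def matrix_simps)

lemma coord_fixed_proj: "coord_matrix ** fixed_proj = 0"
  by (simp add: coord_matrix_def fixed_proj_def matrix_simps)

lemma fixed_proj_idem: "fixed_proj ** fixed_proj = fixed_proj"
  by (simp add: fixed_proj_def matrix_simps)

lemma gens_fixed_proj: "g \<in> gens \<Longrightarrow> g ** fixed_proj = fixed_proj \<and> fixed_proj ** g = fixed_proj"
  unfolding gens_def by (elim insertE emptyE; simp add: gen_defs fixed_proj_def matrix_simps)

section \<open>The signed permutation representation\<close>

definition rep :: "real ^ 7 ^ 7 \<Rightarrow> real ^ 6 ^ 6" where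
  "rep \<mu> = coord_matrix ** \<mu> ** basis_matrix"

lemma rep_eqI: "\<mu> ** basis_matrix = basis_matrix ** B \<Longrightarrow> rep \<mu> = B"
  by (simp add: rep_def matrix_mul_assoc[symmetric]) (simp add: matrix_mul_assoc coord_basis)

lemma rep_gens:
  "rep gen_2 = M6 1 1 2"
  "rep gen_3 = M6 1 2 3"
  "rep gen_4 = M6 1 3 4"
  "rep gen_5 = M6 1 4 5"
  "rep gen_6 = M6 1 5 6"
  "rep gen_12 = M6 (-1) 2 3"
  by (intro rep_eqI; simp add: gen_defs basis_matrix_def M6_def Transposition.transpose_def matrix_simps)+

definition M_gen :: "(real ^ 7 ^ 7) set" where
  "M_gen = generate GL gens"

lemma gens_carrier: "gens \<subseteq> carrier GL"
  using gens_involution by (auto simp: GL_simps invertible_def)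

lemma inv_gens:
  assumes "g \<in> gens"
  shows "inv\<^bsub>GL\<^esub> g = g"
  by (rule group.inv_equality[OF group_GL]) (use assms gens_carrier gens_involution in \<open>auto simp: GL_simps\<close>)

lemma M_gen_subgroup: "subgroup M_gen GL"
  unfolding M_gen_def by (rule group.generate_is_subgroup[OF group_GL gens_carrier])

lemma M_gen_mult: "\<mu> \<in> M_gen \<Longrightarrow> \<nu> \<in> M_gen \<Longrightarrow> \<mu> ** \<nu> \<in> M_gen"
  using generate.eng[of \<mu> GL gens \<nu>] by (simp add: M_gen_def GL_simps)

lemma M_gen_one: "mat 1 \<in> M_gen"
  using generate.one[of GL gens] by (simp add: M_gen_def GL_simps)

lemma M_gen_gens: "g \<in> gens \<Longrightarrow> g \<in> M_gen"
  unfolding M_gen_def by (rule generate.incl)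

text \<open>(a c) = (a b)(b c)(a b), so all transpositions fixing 1 are reached from adjacent
  ones.\<close>

lemma conj_S_transpose_trans:
  assumes "conj_S (Transposition.transpose a b) \<in> M_gen" "conj_S (Transposition.transpose b c) \<in> M_gen"
  shows "conj_S (Transposition.transpose a c) \<in> M_gen"
proof (cases "a = c \<or> b = c")
  case True
  thus ?thesis using assms by (auto simp: conj_S_id M_gen_one)
next
  case False
  hence "Transposition.transpose a c = (Transposition.transpose a b \<circ> Transposition.transpose b c) \<circ> Transposition.transpose a b"
    by (simp add: transpose_comp_triple)
  thus ?thesis by (simp only: conj_S_comp) (intro M_gen_mult assms)
qed

lemma conj_S_transpose:
  assumes "a \<noteq> 1" "b \<noteq> 1"
  shows "conj_S (Transposition.transpose a b) \<in> M_gen"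
proof -
  have adj: "conj_S (Transposition.transpose 2 3) \<in> M_gen" "conj_S (Transposition.transpose 3 4) \<in> M_gen"
    "conj_S (Transposition.transpose 4 5) \<in> M_gen" "conj_S (Transposition.transpose 5 6) \<in> M_gen" "conj_S (Transposition.transpose 6 7) \<in> M_gen"
    unfolding gen_eq by (rule M_gen_gens; simp add: gens_def)+
  have two: "conj_S (Transposition.transpose 2 2) \<in> M_gen" by (simp add: conj_S_id M_gen_one)
  note t3 = conj_S_transpose_trans[OF two adj(1)]
  note t4 = conj_S_transpose_trans[OF t3 adj(2)]
  note t5 = conj_S_transpose_trans[OF t4 adj(3)]
  note t6 = conj_S_transpose_trans[OF t5 adj(4)]
  note t7 = conj_S_transpose_trans[OF t6 adj(5)]
  have from_2: "conj_S (Transposition.transpose 2 x) \<in> M_gen" if "x \<noteq> 1" for x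
    using exhaust_7[of x] that two t3 t4 t5 t6 t7 by (elim disjE) simp_all
  have "conj_S (Transposition.transpose a 2) \<in> M_gen"
    using from_2[OF assms(1)] by (simp only: transpose_commute)
  from conj_S_transpose_trans[OF this from_2[OF assms(2)]] show ?thesis .
qed

lemma conj_S_permutes:
  assumes "p permutes UNIV" "p 1 = 1"
  shows "conj_S p \<in> M_gen"
proof -
  have "p permutes - {1}"
    using assms unfolding permutes_def by auto
  moreover have "finite (- {1 :: 7})" by simp
  ultimately show ?thesis
  proof (induction rule: permutes_induct)
    case id
    show ?case using M_gen_one conj_S_id by (simp add: id_def)
  next
    case (swap a b p)
    thus ?case unfolding conj_S_comp by (intro M_gen_mult conj_S_transpose) auto
  qed
qed

text \<open>Permutations fixing 1 are products of transpositions fixing 1, and these are products of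
  adjacent ones; six involutions therefore suffice as generators, which makes inductions over the
  group short.\<close>

lemma M_K_eq: "M_K = M_gen"
proof
  have "G_K \<subseteq> M_gen"
    using conj_S_permutes by (auto simp: G_K_def P16_def conj_S_def)
  moreover have "gen_12 \<in> M_gen" by (rule M_gen_gens) (simp add: gens_def)
  ultimately have "G_K \<union> {perm_matrix (Transposition.transpose 1 2)} \<subseteq> M_gen" by (simp add: gen_eq)
  thus "M_K \<subseteq> M_gen"
    unfolding M_K_def by (rule group.generate_subgroup_incl[OF group_GL _ M_gen_subgroup])
  have "conj_S (Transposition.transpose a b) \<in> G_K" if "a \<noteq> 1" "b \<noteq> 1" for a b
  proof -
    have "Transposition.transpose a b permutes UNIV" by (rule permutes_swap_id) auto
    moreover have "Transposition.transpose a b 1 = 1" using that by (simp add: Transposition.transpose_def)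
    ultimately show ?thesis unfolding G_K_def P16_def conj_S_def by blast
  qed
  from this[of 2 3] this[of 3 4] this[of 4 5] this[of 5 6] this[of 6 7]
  have "gens \<subseteq> G_K \<union> {perm_matrix (Transposition.transpose 1 2)}"
    unfolding gen_eq gens_def by simp
  thus "M_gen \<subseteq> M_K"
    unfolding M_K_def M_gen_def by (rule group.mono_generate[OF group_GL])
qed

lemma M_gen_fixed_proj: "\<mu> \<in> M_gen \<Longrightarrow> \<mu> ** fixed_proj = fixed_proj \<and> fixed_proj ** \<mu> = fixed_proj"
  unfolding M_gen_def
proof (induction rule: generate.induct)
  case (eng h1 h2)
  thus ?case by (simp add: GL_simps matrix_mul_assoc) (metis matrix_mul_assoc)
qed (simp_all add: GL_simps gens_fixed_proj inv_gens)

lemma matrix_mult_add_right: "(A + B) ** C = A ** C + B ** (C :: real ^ 'n ^ 'm)"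
  by (simp add: matrix_matrix_mult_def vec_eq_iff sum.distrib distrib_right)

lemma basis_coord_add: "basis_matrix ** coord_matrix + fixed_proj = mat 1"
  by (simp add: basis_coord)

text \<open>Between the two factors one inserts 1 = basis_matrix ** coord_matrix + fixed_proj. The
  projection is preserved by \<mu> and annihilated by \<open>coord_matrix\<close>.\<close>

lemma rep_mult:
  assumes "\<mu> ** fixed_proj = fixed_proj"
  shows "rep (\<mu> ** \<nu>) = rep \<mu> ** rep \<nu>"
proof -
  have "rep (\<mu> ** \<nu>) = coord_matrix ** (\<mu> ** (basis_matrix ** coord_matrix + fixed_proj)) ** \<nu> ** basis_matrix"
    unfolding rep_def basis_coord_add by (simp add: matrix_mul_assoc)
  also have "coord_matrix ** (\<mu> ** (basis_matrix ** coord_matrix + fixed_proj)) = coord_matrix ** \<mu> ** basis_matrix ** coord_matrix"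
    by (simp add: matrix_add_ldistrib assms coord_fixed_proj matrix_mul_assoc)
  finally show ?thesis by (simp add: rep_def matrix_mul_assoc)
qed

lemma rep_one: "rep (mat 1) = mat 1"
  by (simp add: rep_def coord_basis)

text \<open>An element of the group is recovered from its action on the kernel and on the fixed
  vector as \<open>basis_matrix ** rep \<kappa> ** coord_matrix + fixed_proj\<close>.\<close>

lemma rep_inj:
  assumes "\<mu> \<in> M_gen" "\<nu> \<in> M_gen" "rep \<mu> = rep \<nu>"
  shows "\<mu> = \<nu>"
proof -
  have "\<kappa> = basis_matrix ** rep \<kappa> ** coord_matrix + fixed_proj" if "\<kappa> \<in> M_gen" for \<kappa>
  proof -
    note f = M_gen_fixed_proj[OF that]
    have "\<kappa> = (basis_matrix ** coord_matrix + fixed_proj) ** (\<kappa> ** (basis_matrix ** coord_matrix + fixed_proj))"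
      by (simp add: basis_coord_add)
    also have "\<kappa> ** (basis_matrix ** coord_matrix + fixed_proj) = \<kappa> ** basis_matrix ** coord_matrix + fixed_proj"
      using f by (simp add: matrix_add_ldistrib matrix_mul_assoc)
    also have "(basis_matrix ** coord_matrix + fixed_proj) ** (\<kappa> ** basis_matrix ** coord_matrix + fixed_proj) =
      basis_matrix ** rep \<kappa> ** coord_matrix + (fixed_proj ** \<kappa> ** (basis_matrix ** coord_matrix) + (basis_matrix ** (coord_matrix ** fixed_proj) + fixed_proj ** fixed_proj))"
      by (simp add: matrix_add_ldistrib matrix_mult_add_right rep_def matrix_mul_assoc add_ac)
    also have "fixed_proj ** \<kappa> ** (basis_matrix ** coord_matrix) = 0"
    proof -
      have "fixed_proj ** (basis_matrix ** coord_matrix) + fixed_proj ** fixed_proj = fixed_proj"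
        unfolding matrix_add_ldistrib[symmetric] basis_coord_add by simp
      thus ?thesis using f by (simp add: fixed_proj_idem)
    qed
    finally show ?thesis by (simp add: coord_fixed_proj fixed_proj_idem)
  qed
  from this[OF assms(1)] this[OF assms(2)] assms(3) show ?thesis by simp
qed

lemma rep_invertible:
  assumes "\<mu> \<in> M_gen"
  shows "invertible (rep \<mu>)"
proof -
  have "\<mu> \<in> carrier GL" using assms M_gen_subgroup subgroup.subset by blast
  then obtain \<nu> where \<nu>: "\<mu> ** \<nu> = mat 1" by (auto simp: GL_simps invertible_def)
  have "rep \<mu> ** rep \<nu> = mat 1"
    using rep_mult[of \<mu> \<nu>] M_gen_fixed_proj[OF assms] by (simp add: \<nu> rep_one)
  thus ?thesis using matrix_left_right_inverse by (auto simp: invertible_def)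
qed

text \<open>\<open>rep\<close> satisfies the specification, and a homomorphism is determined by its
  values on generators; existence and uniqueness together evaluate the definite description. The use
  of \<open>restrict\<close> supplies the default value that \<open>extensional\<close> demands
  outside \<open>M_K\<close>.\<close>

lemma \<theta>_eq:
  assumes "\<mu> \<in> M_K"
  shows "\<theta> \<mu> = rep \<mu>"
proof -
  define spec where "spec = (\<lambda>h. h \<in> hom (GL\<lparr>carrier := M_K\<rparr>) GL \<and> inj_on h M_K \<and> h \<in> extensional M_K
     \<and> (\<forall>i::nat. 2 \<le> i \<and> i \<le> 6 \<longrightarrow>
          h (S ** perm_matrix (Transposition.transpose (of_nat i) (of_nat (i + 1))) ** matrix_inv S)
            = M6 1 (of_nat (i - 1)) (of_nat i))
     \<and> h (perm_matrix (Transposition.transpose 1 2)) = M6 (-1) 2 3)"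
  have mem: "g \<in> M_K" if "g \<in> gens" for g using M_gen_gens[OF that] by (simp add: M_K_eq)
  have nat_cases: "i = 2 \<or> i = 3 \<or> i = 4 \<or> i = 5 \<or> i = 6" if "2 \<le> i \<and> i \<le> 6" for i :: nat using that by auto
  have spec_rep: "spec (restrict rep M_K)"
    unfolding spec_def
  proof (intro conjI allI impI)
    show "restrict rep M_K \<in> hom (GL\<lparr>carrier := M_K\<rparr>) GL"
    proof (rule homI)
      fix x assume "x \<in> carrier (GL\<lparr>carrier := M_K\<rparr>)"
      thus "restrict rep M_K x \<in> carrier GL" by (simp add: GL_simps M_K_eq rep_invertible)
    next
      fix x y assume "x \<in> carrier (GL\<lparr>carrier := M_K\<rparr>)" "y \<in> carrier (GL\<lparr>carrier := M_K\<rparr>)"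
      thus "restrict rep M_K (x \<otimes>\<^bsub>GL\<lparr>carrier := M_K\<rparr>\<^esub> y) = restrict rep M_K x \<otimes>\<^bsub>GL\<^esub> restrict rep M_K y"
        using M_gen_mult[of x y] rep_mult[of x y] M_gen_fixed_proj[of x] by (simp add: GL_simps M_K_eq)
    qed
    show "inj_on (restrict rep M_K) M_K"
      by (rule inj_onI) (use rep_inj in \<open>simp add: M_K_eq\<close>)
    show "restrict rep M_K \<in> extensional M_K" by simp
    show "restrict rep M_K (perm_matrix (Transposition.transpose 1 2)) = M6 (- 1) 2 3"
      using mem[of gen_12] by (simp add: gen_eq rep_gens gens_def)
    fix i :: nat assume i: "2 \<le> i \<and> i \<le> 6"
    show "restrict rep M_K (S ** perm_matrix (Transposition.transpose (of_nat i) (of_nat (i + 1))) ** matrix_inv S) = M6 1 (of_nat (i - 1)) (of_nat i)"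
      unfolding conj_S_def[symmetric] using nat_cases[OF i] mem[of gen_2] mem[of gen_3] mem[of gen_4] mem[of gen_5] mem[of gen_6]
      by (elim disjE) (simp_all add: gen_eq rep_gens gens_def)
  qed
  have unique: "h = restrict rep M_K" if h: "spec h" for h
  proof (rule extensionalityI[of h M_K])
    show "h \<in> extensional M_K" "restrict rep M_K \<in> extensional M_K" using h by (simp_all add: spec_def)
    have hom: "h \<in> hom (GL\<lparr>carrier := M_K\<rparr>) GL" using h by (simp add: spec_def)
    have ev: "h (conj_S (Transposition.transpose (of_nat i) (of_nat (i + 1)))) = M6 1 (of_nat (i - 1)) (of_nat i)" if "2 \<le> i" "i \<le> 6" for i
      using h that by (simp add: spec_def conj_S_def)
    have hg: "h g = rep g" if "g \<in> gens" for g
      using that ev[of 2] ev[of 3] ev[of 4] ev[of 5] ev[of 6] h unfolding gens_def spec_def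
      by (auto simp: gen_eq rep_gens)
    fix x assume "x \<in> M_K"
    hence "x \<in> M_gen" by (simp add: M_K_eq)
    hence "h x = rep x \<and> x \<in> M_gen"
      unfolding M_gen_def
    proof (induction rule: generate.induct)
      case one
      have "h (one (GL\<lparr>carrier := M_K\<rparr>)) = one GL"
        by (rule hom_one[OF hom]) (simp_all add: group_GL M_K_eq group.subgroup_imp_group[OF group_GL M_gen_subgroup])
      thus ?case using M_gen_one by (simp add: GL_simps rep_one M_gen_def)
    next
      case (incl g)
      thus ?case using hg generate.incl by fast
    next
      \<comment> \<open>The generators are involutions, so their inverses bring in no new
        values.\<close>
      case (inv g)
      thus ?case using hg generate.incl by (simp add: inv_gens)
    next
      case (eng x y)
      hence xy: "x \<in> M_K" "y \<in> M_K" by (simp_all add: M_K_eq M_gen_def)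
      have "h (x \<otimes>\<^bsub>GL\<lparr>carrier := M_K\<rparr>\<^esub> y) = h x \<otimes>\<^bsub>GL\<^esub> h y"
        by (rule hom_mult[OF hom]) (simp_all add: xy)
      moreover have "rep (x ** y) = rep x ** rep y"
        using xy M_gen_fixed_proj by (intro rep_mult) (simp add: M_K_eq)
      moreover have "x ** y \<in> generate GL gens" using eng M_gen_mult[of x y] by (simp add: M_gen_def)
      ultimately show ?case using eng by (simp add: GL_simps)
    qed
    thus "h x = restrict rep M_K x" using \<open>x \<in> M_K\<close> by simp
  qed
  have eq: "\<theta> = restrict rep M_K"
    unfolding \<theta>_def using spec_rep unique unfolding spec_def by (intro the_equality) blast+
  show ?thesis unfolding eq by (rule restrict_apply'[OF assms])
qed

section \<open>The three group elements and their Hamming distances\<close>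

lemma p0_in_M_K: "p0 \<in> M_K"
  by (simp add: p0_def M_K_eq M_gen_one)

lemma p1_in_M_K: "p1 \<in> M_K"
proof -
  have eq: "p1 = gen_3 ** gen_2 ** gen_12"
    by (simp add: p1_def gen_defs matrix_simps)
  show ?thesis unfolding M_K_eq eq by (intro M_gen_mult M_gen_gens; simp add: gens_def)
qed

lemma n4_in_M_K: "n4 \<in> M_K"
proof -
  \<comment> \<open>\<open>n4\<close> is a word of eleven generators; it is cut into the blocks x,
    y, z, given explicitly, so that each matrix product stays small.\<close>
  define x :: "real ^ 7 ^ 7" where "x = vector
    [vector [1,0,0,0,0,0,0],
     vector [0,0,0,1,0,0,0],
     vector [0,1,0,0,0,0,0],
     vector [0,0,1,0,0,0,0],
     vector [0,0,0,0,0,0,1],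
     vector [0,0,0,0,1,0,0],
     vector [0,0,0,0,0,1,0]]"
  define y :: "real ^ 7 ^ 7" where "y = vector
    [vector [0,-1,0,0,1,0,0],
     vector [1,0,0,0,0,0,0],
     vector [0,0,-1,0,1,0,0],
     vector [0,0,0,1,0,0,0],
     vector [0,-1,-1,0,1,1,0],
     vector [0,0,0,0,1,0,0],
     vector [0,-1,-1,0,1,0,1]]"
  define z :: "real ^ 7 ^ 7" where "z = vector
    [vector [0,0,-1,0,1,0,0],
     vector [1,0,0,0,0,0,0],
     vector [0,0,0,1,0,0,0],
     vector [0,-1,0,0,1,0,0],
     vector [0,0,0,0,1,0,0],
     vector [0,-1,-1,0,1,1,0],
     vector [0,-1,-1,0,1,0,1]]"
  have x_eq: "x = gen_2 ** gen_3 ** gen_5 ** gen_6" by (simp add: x_def gen_defs matrix_simps)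
  have x: "x \<in> M_gen" unfolding x_eq by (intro M_gen_mult M_gen_gens; simp add: gens_def)
  have y_eq: "y = gen_5 ** gen_12 ** gen_2 ** gen_4" by (simp add: y_def gen_defs matrix_simps)
  have y: "y \<in> M_gen" unfolding y_eq by (intro M_gen_mult M_gen_gens; simp add: gens_def)
  have z_eq: "z = gen_3 ** gen_12 ** gen_4" by (simp add: z_def gen_defs matrix_simps)
  have z: "z \<in> M_gen" unfolding z_eq by (intro M_gen_mult M_gen_gens; simp add: gens_def)
  have eq: "n4 = x ** y ** z" by (simp add: n4_def x_def y_def z_def matrix_simps)
  show ?thesis unfolding M_K_eq eq by (intro M_gen_mult x y z)
qed

text \<open>Avoids inverting a matrix: a candidate v is verified by applying \<mu> to it in the
  basis of the kernel.\<close>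

lemma rep_inverse_vector:
  assumes "\<mu> \<in> M_K" "coord_matrix *v (\<mu> *v (basis_matrix *v v)) = \<omega>\<^sub>0"
  shows "matrix_inv (\<theta> \<mu>) *v \<omega>\<^sub>0 = v"
proof -
  have r: "rep \<mu> *v v = \<omega>\<^sub>0" using assms(2) by (simp add: rep_def matrix_vector_mul_assoc matrix_mul_assoc)
  have "invertible (rep \<mu>)" using assms(1) by (simp add: M_K_eq rep_invertible)
  hence "matrix_inv (rep \<mu>) ** rep \<mu> = mat 1" unfolding invertible_def matrix_inv_def by (rule someI2_ex) simp
  hence "matrix_inv (rep \<mu>) *v (rep \<mu> *v v) = v" by (simp add: matrix_vector_mul_assoc)
  thus ?thesis by (simp add: \<theta>_eq[OF assms(1)] r)
qed

lemma \<theta>_inverse_omega: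
  "matrix_inv (\<theta> p0) *v \<omega>\<^sub>0 = vector [1, 1, 1, 1, 1, 1]"
  "matrix_inv (\<theta> p1) *v \<omega>\<^sub>0 = vector [1, -1, -1, 1, 1, 1]"
  "matrix_inv (\<theta> n4) *v \<omega>\<^sub>0 = vector [-1, -1, -1, -1, 1, 1]"
  by (rule rep_inverse_vector, rule p0_in_M_K p1_in_M_K n4_in_M_K,
      simp add: p0_def p1_def n4_def \<omega>\<^sub>0_def coord_matrix_def basis_matrix_def matrix_simps)+

lemma hamming_type_224: "hamming_type p0 p1 n4 = [2, 2, 4]"
proof -
  have "card {i :: 6. P i} = (\<Sum>i\<in>UNIV. if P i then 1 else 0)" for P
    by (simp add: sum.If_cases)
  hence "hamming_distance p0 p1 = 2" "hamming_distance p0 n4 = 4" "hamming_distance p1 n4 = 2"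
    unfolding hamming_distance_def \<theta>_inverse_omega by (simp_all add: sum_6)
  thus ?thesis by (simp add: hamming_type_def)
qed

theorem proposition6p4:
  shows "(\<forall>x \<in> V.
            of_real pi ^ 3 * sin_pi (x$5 - x$1 - x$2) * beta (\<sigma> x) * K_at p0 x
          + gamma x * K_at p1 x
          - of_real pi ^ 3 * sin_pi (x$1 - x$2) * beta x * K_at n4 x = 0)
       \<and> (\<forall>x \<in> V. \<sigma> x \<in> V \<and> \<sigma> (\<sigma> (\<sigma> x)) = x)
       \<and> p0 \<in> M_K \<and> p1 \<in> M_K \<and> n4 \<in> M_K
       \<and> hamming_type p0 p1 n4 = [2, 2, 4]"
  using three_term_relation \<sigma>_in_V \<sigma>_cubed p0_in_M_K p1_in_M_K n4_in_M_K hamming_type_224 by blast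

end
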